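(* Let $n\geq 3$ and $m\geq 3$, and let $M$ be a compact $n$-dimensional $C^m$ manifold with boundary $\partial M$, equipped with a $C^m$ Riemannian metric $\bar g$ such that $(M,\bar g)$ has minimal boundary and the second fundamental form $\mathbb{I}_{\bar g}$ of $\partial M$ satisfies $\mathbb{I}_{\bar g}(p)\ne 0$ for all $p\in\partial M$. Let $[\bar g]$ be the conformal class of $\bar g$. Then the set $$\mathcal{B}=\left\{ g\in[\bar g] : (M,g)\text{ has minimal boundary and } \|\mathbb{I}_g\|^2 \text{ has only non-degenerate critical points on }\partial M\right\}$$ is an open dense subset of $\{g\in[\bar g] : (M,g)\text{ has minimal boundary}\}$ (with the topology induced by the $C^m$ norm on symmetric covariant 2-tensors).
   Context: $C^m$ regularity of functions and tensor fields on $M$ is understood with respect to a fixed compatible smooth atlas. The conformal class is $[\bar g]=\{e^{2f}\bar g : f\in C^m(M)\}$. For a Riemannian metric $g$ on $M$, $h_{ij}$ ($1\le i,j\le n-1$) denote the components of the second fundamental form $\mathbb{I}_g$ of $\partial M$ in local coordinates of $\partial M$; $\mathbb{I}_g(p)\ne 0$ means that it is not the zero bilinear form on $T_p\partial M$. The squared norm is the function on $\partial M$ given by $\|\mathbb{I}_g\|^2=g^{ik}g^{j\ell}h_{ij}h_{k\ell}$ (summation over $1,\dots,n-1$). The boundary mean curvature is $H_g=g^{ij}h_{ij}$, and $(M,g)$ has minimal boundary if $H_g\equiv 0$ on $\partial M$. A critical point of the function $\|\mathbb{I}_g\|^2:\partial M\to\mathbb{R}$ is non-degenerate if its Hessian there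 is invertible. $\mathscr{S}^m$ is the Banach space of $C^m$ symmetric covariant 2-tensors on $M$ with norm $\|k\|_m=\sum_{\lambda\in\Lambda}\sum_{|\alpha|\le m}\sum_{i,j=1}^n\sup_{V_\lambda}|\partial^\alpha k_{ij}|$, where $\{V_\lambda\}_{\lambda\in\Lambda}$ is a fixed finite cover of $M$ such that the closure of each $V_\lambda$ lies in an open coordinate neighbourhood, and the components $k_{ij}$ and derivatives are taken in those coordinates. Sets of metrics carry the topology induced from $\mathscr{S}^m$. *)

theory Defs
  imports "HOL-Analysis.Analysis"
begin

section \<open>Calculus on subsets of Euclidean space\<close>

text \<open>The derivatives are taken within the set \<open>S\<close>. For \<open>S\<close> relatively open in a closed half-space
  they are unique; they are one-sided at the points of the bounding hyperplane and the usual ones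
  elsewhere.\<close>

definition pd :: "(real^'n) set \<Rightarrow> 'n \<Rightarrow> (real^'n \<Rightarrow> real) \<Rightarrow> real^'n \<Rightarrow> real" where
  "pd S i f = (\<lambda>y. frechet_derivative f (at y within S) (axis i 1))"

primrec Cdiff :: "nat \<Rightarrow> (real^'n) set \<Rightarrow> (real^'n \<Rightarrow> real) \<Rightarrow> bool" where
  "Cdiff 0 S f \<longleftrightarrow> continuous_on S f"
| "Cdiff (Suc k) S f \<longleftrightarrow> f differentiable_on S \<and> (\<forall>i. Cdiff k S (pd S i f))"

text \<open>The derivative \<open>\<partial>\<^sup>\<alpha> f\<close> for a multi-index \<open>\<alpha>\<close>. The coordinates are indexed by an unordered type, so
  the order of differentiation is an arbitrary one in which each direction \<open>i\<close> occurs \<open>\<alpha> i\<close> times;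
  the result does not depend on it if \<open>f\<close> has continuous derivatives up to order \<open>|\<alpha>|\<close>.\<close>

definition mpd :: "(real^'n) set \<Rightarrow> ('n \<Rightarrow> nat) \<Rightarrow> (real^'n \<Rightarrow> real) \<Rightarrow> real^'n \<Rightarrow> real" where
  "mpd S \<alpha> f = foldr (pd S) (SOME is. \<forall>i. count_list is i = \<alpha> i) f"


section \<open>Manifolds with boundary\<close>

text \<open>The coordinates of an \<open>n\<close>-manifold are indexed by \<open>'b option\<close>, so \<open>n = CARD('b option)\<close>. The
  index \<^term>\<open>None\<close> belongs to the coordinate that is non-negative on the half-space and
  vanishes on its boundary; the \<open>n - 1\<close> indices \<^term>\<open>Some i\<close> belong to the
  coordinates of the boundary. A chart is a pair of a domain and a coordinate map, whose values
  outside the domain are irrelevant.\<close>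

type_synonym ('a, 'b) chart = "'a set \<times> ('a \<Rightarrow> real^('b option))"

definition halfspace :: "(real^('b::finite option)) set" where
  "halfspace = {y. 0 \<le> y $ None}"

definition is_chart :: "'a topology \<Rightarrow> ('a, 'b::finite) chart \<Rightarrow> bool" where
  "is_chart X c \<longleftrightarrow> openin X (fst c) \<and> openin (top_of_set halfspace) (snd c ` fst c) \<and>
     homeomorphic_map (subtopology X (fst c)) (top_of_set (snd c ` fst c)) (snd c)"

definition coord_rep :: "('a, 'b::finite) chart \<Rightarrow> ('a \<Rightarrow> 'r) \<Rightarrow> real^('b option) \<Rightarrow> 'r" where
  "coord_rep c u = (\<lambda>y. u (inv_into (fst c) (snd c) y))"

definition atlas :: "nat \<Rightarrow> 'a topology \<Rightarrow> ('a, 'b::finite) chart set \<Rightarrow> bool" where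
  "atlas k X A \<longleftrightarrow> (\<forall>c\<in>A. is_chart X c) \<and> (\<Union>c\<in>A. fst c) = topspace X \<and>
     (\<forall>c\<in>A. \<forall>c'\<in>A. \<forall>i. Cdiff k (snd c ` (fst c \<inter> fst c')) (coord_rep c (\<lambda>p. snd c' p $ i)))"

definition manifold_with_boundary :: "nat \<Rightarrow> 'a topology \<Rightarrow> ('a, 'b::finite) chart set \<Rightarrow> bool" where
  "manifold_with_boundary k X A \<longleftrightarrow> Hausdorff_space X \<and> second_countable X \<and> atlas k X A"

definition compatible_smooth_atlas ::
    "nat \<Rightarrow> 'a topology \<Rightarrow> ('a, 'b::finite) chart set \<Rightarrow> ('a, 'b) chart set \<Rightarrow> bool" where
  "compatible_smooth_atlas m X C A \<longleftrightarrow> (\<forall>k. atlas k X A) \<and> atlas m X (C \<union> A)"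

definition bdry :: "('a, 'b::finite) chart set \<Rightarrow> 'a set" where
  "bdry A = {p. \<exists>c\<in>A. p \<in> fst c \<and> snd c p $ None = 0}"

definition Cfun :: "nat \<Rightarrow> ('a, 'b::finite) chart set \<Rightarrow> ('a \<Rightarrow> real) set" where
  "Cfun m A = {f. \<forall>c\<in>A. Cdiff m (snd c ` fst c) (coord_rep c f)}"


section \<open>Symmetric covariant 2-tensor fields and metrics\<close>

text \<open>A tensor field assigns to a chart and a point of its domain the matrix of components at that
  point in that chart, subject to the transformation law. The components are \<open>0\<close> where they have no
  meaning, so that equality of tensor fields is equality of functions.\<close>

type_synonym ('a, 'b) tensor = "('a, 'b) chart \<Rightarrow> 'a \<Rightarrow> real^('b option)^('b option)"

definition jac :: "('a, 'b::finite) chart \<Rightarrow> ('a, 'b) chart \<Rightarrow> 'a \<Rightarrow> real^('b option)^('b option)" where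
  "jac c c' p = (\<chi> k i. pd (snd c ` (fst c \<inter> fst c')) i (coord_rep c (\<lambda>q. snd c' q $ k)) (snd c p))"

definition sym_tensors :: "nat \<Rightarrow> ('a, 'b::finite) chart set \<Rightarrow> ('a, 'b) tensor set" where
  "sym_tensors m A = {k.
     (\<forall>c p. c \<notin> A \<or> p \<notin> fst c \<longrightarrow> k c p = 0) \<and>
     (\<forall>c\<in>A. \<forall>p\<in>fst c. transpose (k c p) = k c p) \<and>
     (\<forall>c\<in>A. \<forall>c'\<in>A. \<forall>p\<in>fst c \<inter> fst c'. k c p = transpose (jac c c' p) ** k c' p ** jac c c' p) \<and>
     (\<forall>c\<in>A. \<forall>i j. Cdiff m (snd c ` fst c) (coord_rep c (\<lambda>p. k c p $ i $ j)))}"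

definition riemannian_metrics :: "nat \<Rightarrow> ('a, 'b::finite) chart set \<Rightarrow> ('a, 'b) tensor set" where
  "riemannian_metrics m A = {g \<in> sym_tensors m A.
     \<forall>c\<in>A. \<forall>p\<in>fst c. \<forall>v. v \<noteq> 0 \<longrightarrow> v \<bullet> (g c p *v v) > 0}"

definition conformal_class :: "nat \<Rightarrow> ('a, 'b::finite) chart set \<Rightarrow> ('a, 'b) tensor \<Rightarrow> ('a, 'b) tensor set" where
  "conformal_class m A g = {(\<lambda>c p. exp (2 * f p) *\<^sub>R g c p) | f. f \<in> Cfun m A}"


section \<open>The norm of order \<open>m\<close> and its topology\<close>

text \<open>The family \<open>V\<close>, indexed by \<open>L\<close>, is the finite cover; \<open>ch l\<close> is the chart used on \<open>V l\<close>.\<close>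

definition admissible_cover ::
    "'a topology \<Rightarrow> ('a, 'b::finite) chart set \<Rightarrow> 'l set \<Rightarrow> ('l \<Rightarrow> 'a set) \<Rightarrow> ('l \<Rightarrow> ('a, 'b) chart) \<Rightarrow> bool" where
  "admissible_cover X A L V ch \<longleftrightarrow> finite L \<and> (\<Union>l\<in>L. V l) = topspace X \<and>
     (\<forall>l\<in>L. ch l \<in> A \<and> X closure_of V l \<subseteq> fst (ch l))"

text \<open>Inserting \<open>0\<close> changes the supremum of absolute values only if \<open>V l\<close> is empty.\<close>

definition Cnorm ::
    "nat \<Rightarrow> 'l set \<Rightarrow> ('l \<Rightarrow> 'a set) \<Rightarrow> ('l \<Rightarrow> ('a, 'b::finite) chart) \<Rightarrow> ('a, 'b) tensor \<Rightarrow> real" where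
  "Cnorm m L V ch k = (\<Sum>l\<in>L. \<Sum>\<alpha> | sum \<alpha> UNIV \<le> m. \<Sum>i\<in>UNIV. \<Sum>j\<in>UNIV.
     Sup (insert 0 ((\<lambda>p. \<bar>mpd (snd (ch l) ` fst (ch l)) \<alpha>
       (coord_rep (ch l) (\<lambda>q. k (ch l) q $ i $ j)) (snd (ch l) p)\<bar>) ` V l)))"

definition Ctopology ::
    "nat \<Rightarrow> ('a, 'b::finite) chart set \<Rightarrow> 'l set \<Rightarrow> ('l \<Rightarrow> 'a set) \<Rightarrow> ('l \<Rightarrow> ('a, 'b) chart) \<Rightarrow>
      ('a, 'b) tensor topology" where
  "Ctopology m A L V ch = topology (\<lambda>U. U \<subseteq> sym_tensors m A \<and>
     (\<forall>k\<in>U. \<exists>e>0. \<forall>l\<in>sym_tensors m A. Cnorm m L V ch (l - k) < e \<longrightarrow> l \<in> U))"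

lemma openin_Ctopology:
  "openin (Ctopology m A L V ch) U \<longleftrightarrow> U \<subseteq> sym_tensors m A \<and>
     (\<forall>k\<in>U. \<exists>e>0. \<forall>l\<in>sym_tensors m A. Cnorm m L V ch (l - k) < e \<longrightarrow> l \<in> U)"
proof -
  have "istopology (\<lambda>U. U \<subseteq> sym_tensors m A \<and>
     (\<forall>k\<in>U. \<exists>e>0. \<forall>l\<in>sym_tensors m A. Cnorm m L V ch (l - k) < e \<longrightarrow> l \<in> U))"
    unfolding istopology_def
  proof (intro conjI allI impI ballI)
    fix S T k
    assume S: "S \<subseteq> sym_tensors m A \<and>
        (\<forall>k\<in>S. \<exists>e>0. \<forall>l\<in>sym_tensors m A. Cnorm m L V ch (l - k) < e \<longrightarrow> l \<in> S)"
      and T: "T \<subseteq> sym_tensors m A \<and>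
        (\<forall>k\<in>T. \<exists>e>0. \<forall>l\<in>sym_tensors m A. Cnorm m L V ch (l - k) < e \<longrightarrow> l \<in> T)"
    show "S \<inter> T \<subseteq> sym_tensors m A" using S by blast
    assume "k \<in> S \<inter> T"
    then obtain d e where "d > 0" "e > 0"
      "\<forall>l\<in>sym_tensors m A. Cnorm m L V ch (l - k) < d \<longrightarrow> l \<in> S"
      "\<forall>l\<in>sym_tensors m A. Cnorm m L V ch (l - k) < e \<longrightarrow> l \<in> T"
      using S T by blast
    then show "\<exists>e>0. \<forall>l\<in>sym_tensors m A. Cnorm m L V ch (l - k) < e \<longrightarrow> l \<in> S \<inter> T"
      by (intro exI[of _ "min d e"]) auto
  next
    fix K k
    assume K: "\<forall>S\<in>K. S \<subseteq> sym_tensors m A \<and>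
        (\<forall>k\<in>S. \<exists>e>0. \<forall>l\<in>sym_tensors m A. Cnorm m L V ch (l - k) < e \<longrightarrow> l \<in> S)"
    show "\<Union>K \<subseteq> sym_tensors m A" using K by blast
    assume "k \<in> \<Union>K"
    then show "\<exists>e>0. \<forall>l\<in>sym_tensors m A. Cnorm m L V ch (l - k) < e \<longrightarrow> l \<in> \<Union>K"
      using K by (meson UnionE UnionI)
  qed
  then show ?thesis
    unfolding Ctopology_def by (simp add: topology_inverse')
qed


section \<open>The second fundamental form of the boundary\<close>

definition christoffel ::
    "('a, 'b::finite) tensor \<Rightarrow> ('a, 'b) chart \<Rightarrow> 'a \<Rightarrow> 'b option \<Rightarrow> 'b option \<Rightarrow> 'b option \<Rightarrow> real" where
  "christoffel g c p k i j =
     (let G = (\<lambda>a b. coord_rep c (\<lambda>q. g c q $ a $ b)); D = (\<lambda>a F. pd (snd c ` fst c) a F (snd c p))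
      in 1/2 * (\<Sum>l\<in>UNIV. matrix_inv (g c p) $ k $ l * (D i (G j l) + D j (G i l) - D l (G i j))))"

text \<open>The components of the inward unit normal: the gradient of the coordinate with index
  \<^term>\<open>None\<close>, normalized.\<close>

definition unit_normal :: "('a, 'b::finite) tensor \<Rightarrow> ('a, 'b) chart \<Rightarrow> 'a \<Rightarrow> real^('b option)" where
  "unit_normal g c p = (\<chi> k. matrix_inv (g c p) $ k $ None / sqrt (matrix_inv (g c p) $ None $ None))"

text \<open>\<open>h i j\<close> is the \<open>g\<close>-product of the covariant derivative \<open>\<nabla>\<^sub>i \<partial>\<^sub>j\<close> with the inward unit normal.\<close>

definition second_ff :: "('a, 'b::finite) tensor \<Rightarrow> ('a, 'b) chart \<Rightarrow> 'a \<Rightarrow> real^'b^'b" where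
  "second_ff g c p = (\<chi> i j. \<Sum>k\<in>UNIV. \<Sum>l\<in>UNIV.
     g c p $ k $ l * christoffel g c p k (Some i) (Some j) * unit_normal g c p $ l)"

definition bdry_metric :: "('a, 'b::finite) tensor \<Rightarrow> ('a, 'b) chart \<Rightarrow> 'a \<Rightarrow> real^'b^'b" where
  "bdry_metric g c p = (\<chi> i j. g c p $ Some i $ Some j)"

definition mean_curvature :: "('a, 'b::finite) tensor \<Rightarrow> ('a, 'b) chart \<Rightarrow> 'a \<Rightarrow> real" where
  "mean_curvature g c p = (\<Sum>i\<in>UNIV. \<Sum>j\<in>UNIV. matrix_inv (bdry_metric g c p) $ i $ j * second_ff g c p $ i $ j)"

definition minimal_boundary :: "('a, 'b::finite) chart set \<Rightarrow> ('a, 'b) tensor \<Rightarrow> bool" where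
  "minimal_boundary A g \<longleftrightarrow> (\<forall>c\<in>A. \<forall>p\<in>fst c \<inter> bdry A. mean_curvature g c p = 0)"

definition second_ff_nonzero :: "('a, 'b::finite) chart set \<Rightarrow> ('a, 'b) tensor \<Rightarrow> bool" where
  "second_ff_nonzero A g \<longleftrightarrow> (\<forall>c\<in>A. \<forall>p\<in>fst c \<inter> bdry A. second_ff g c p \<noteq> 0)"

definition second_ff_normsq_in :: "('a, 'b::finite) tensor \<Rightarrow> ('a, 'b) chart \<Rightarrow> 'a \<Rightarrow> real" where
  "second_ff_normsq_in g c p =
     (let gi = matrix_inv (bdry_metric g c p); h = second_ff g c p
      in \<Sum>i\<in>UNIV. \<Sum>j\<in>UNIV. \<Sum>k\<in>UNIV. \<Sum>l\<in>UNIV. gi $ i $ k * gi $ j $ l * h $ i $ j * h $ k $ l)"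

text \<open>The value does not depend on the chart, hence may be computed in an arbitrary one.\<close>

definition second_ff_normsq :: "('a, 'b::finite) chart set \<Rightarrow> ('a, 'b) tensor \<Rightarrow> 'a \<Rightarrow> real" where
  "second_ff_normsq A g p = second_ff_normsq_in g (SOME c. c \<in> A \<and> p \<in> fst c) p"


section \<open>Critical points of functions on the boundary\<close>

definition bdry_emb :: "real^'b \<Rightarrow> real^('b::finite option)" where
  "bdry_emb z = (\<chi> i. case i of None \<Rightarrow> 0 | Some j \<Rightarrow> z $ j)"

definition bdry_proj :: "real^('b::finite option) \<Rightarrow> real^'b" where
  "bdry_proj y = (\<chi> j. y $ Some j)"

text \<open>Image of, and coordinate representation in, the chart of the boundary induced by \<open>c\<close>.\<close>

definition bdry_image :: "('a, 'b::finite) chart \<Rightarrow> (real^'b) set" where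
  "bdry_image c = {z. bdry_emb z \<in> snd c ` fst c}"

definition bdry_rep :: "('a, 'b::finite) chart \<Rightarrow> ('a \<Rightarrow> real) \<Rightarrow> real^'b \<Rightarrow> real" where
  "bdry_rep c \<phi> = (\<lambda>z. coord_rep c \<phi> (bdry_emb z))"

definition critical_point :: "('a, 'b::finite) chart set \<Rightarrow> ('a \<Rightarrow> real) \<Rightarrow> 'a \<Rightarrow> bool" where
  "critical_point A \<phi> p \<longleftrightarrow> p \<in> bdry A \<and>
     (\<forall>c\<in>A. p \<in> fst c \<longrightarrow> (\<forall>i. pd (bdry_image c) i (bdry_rep c \<phi>) (bdry_proj (snd c p)) = 0))"

definition hessian :: "('a, 'b::finite) chart \<Rightarrow> ('a \<Rightarrow> real) \<Rightarrow> 'a \<Rightarrow> real^'b^'b" where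
  "hessian c \<phi> p =
     (\<chi> i j. pd (bdry_image c) i (pd (bdry_image c) j (bdry_rep c \<phi>)) (bdry_proj (snd c p)))"

definition only_nondegenerate_critical_points :: "('a, 'b::finite) chart set \<Rightarrow> ('a \<Rightarrow> real) \<Rightarrow> bool" where
  "only_nondegenerate_critical_points A \<phi> \<longleftrightarrow>
     (\<forall>p. critical_point A \<phi> p \<longrightarrow> (\<forall>c\<in>A. p \<in> fst c \<longrightarrow> invertible (hessian c \<phi> p)))"

end

theory Submission
  imports Defs
begin

text \<open>For \<open>g = e\<^sup>2\<^sup>f g\<^sub>0\<close> the second fundamental form is \<open>e\<^sup>f\<close> times that of \<open>g\<^sub>0\<close> minus a multiple
  of the boundary metric given by the normal derivative of \<open>f\<close>. Hence, if \<open>g\<^sub>0\<close> has minimal boundary, then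
  \<open>g\<close> has minimal boundary iff the normal derivative of \<open>f\<close> vanishes on the boundary, and in that case
  \<open>\<parallel>\<I>\<^sub>g\<parallel>\<^sup>2 = e\<^sup>-\<^sup>2\<^sup>f \<parallel>\<I>\<^sub>g\<^sub>0\<parallel>\<^sup>2\<close>. So the theorem says that \<open>2 f - ln \<parallel>\<I>\<^sub>g\<^sub>0\<parallel>\<^sup>2\<close> is a Morse function on the
  boundary for an open and dense set of admissible \<open>f\<close>. Openness is a compactness argument on 2-jets. For
  density, the boundary is covered by finitely many half-balls in charts; over one of them \<open>f\<close> is perturbed
  by a small linear function of the boundary coordinates, cut off and corrected to have vanishing normal
  derivative. By Sard's theorem applied to the gradient almost every such perturbation leaves no degenerate
  critical point there, and by openness small ones do not spoil the half-balls treated before.\<close>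

text \<open>For \<open>m = 3\<close> the squared norm, built from first derivatives of the metric,
  is only twice differentiable on the boundary. This is just enough: Sard's theorem between spaces
  of equal dimension asks only for a differentiable map, here the gradient, and a Morse condition
  involves nothing beyond the 2-jet. Since the second fundamental form vanishes nowhere, the
  logarithm is available; it makes the problem affine in \<open>f\<close>, so adding a linear
  function of the boundary coordinates to \<open>f\<close> shifts the gradient by a constant vector,
  and a regular value of the gradient is all that is needed.

  Two independence statements carry the geometry. The squared norm is defined through an arbitrarily
  chosen chart, so it must be chart independent before it can be differentiated; and degeneracy of a
  critical point must pass between charts. Both rest on the shape of the Jacobian along the
  boundary, where the normal coordinate has no tangential derivatives of first or second order.

  The topology is one on tensors, not on \<open>f\<close>; the 2-jet of \<open>f\<close> is
  recovered from a single diagonal component of the metric.\<close>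

section \<open>Calculus on sets with corners\<close>

text \<open>The condition holds for open sets and for relatively open subsets of the half-space, and it is enough
  for derivatives within the set to be unique and for mixed partial derivatives to commute.\<close>

definition corner :: "(real^'n) set \<Rightarrow> bool" where
  "corner S \<longleftrightarrow> (\<forall>y\<in>S. \<exists>e>0. \<forall>z. (\<forall>i. y $ i \<le> z $ i \<and> z $ i < y $ i + e) \<longrightarrow> z \<in> S)"

lemma corner_openin:
  assumes "corner S" "openin (top_of_set S) U"
  shows "corner U"
  unfolding corner_def
proof
  fix y assume y: "y \<in> U"
  obtain W where W: "open W" "U = S \<inter> W" using assms(2) by (auto simp: openin_open)
  obtain d where d: "d > 0" "\<And>z. (\<forall>i. y $ i \<le> z $ i \<and> z $ i < y $ i + d) \<Longrightarrow> z \<in> S"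
    using assms(1) y W unfolding corner_def by blast
  obtain r where r: "r > 0" "ball y r \<subseteq> W" using W y open_contains_ball by blast
  \<comment> \<open>The Euclidean norm is at most the sum of the absolute coordinates, so a box of
    edge \<open>r / CARD('a)\<close> fits into the ball of radius \<open>r\<close>.\<close>
  define e where "e = min d (r / real CARD('a))"
  have "e > 0" using d r by (simp add: e_def)
  moreover have "z \<in> U" if z: "\<forall>i. y $ i \<le> z $ i \<and> z $ i < y $ i + e" for z
  proof -
    have "e \<le> d" by (simp add: e_def)
    then have "y $ i \<le> z $ i \<and> z $ i < y $ i + d" for i
      using z[rule_format, of i] by linarith
    then have "z \<in> S" using d by blast
    moreover have "dist y z < r"
    proof -
      have "norm (z - y) \<le> (\<Sum>i\<in>UNIV. \<bar>(z - y) $ i\<bar>)" by (rule norm_le_l1_cart)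
      also have "\<dots> < (\<Sum>i\<in>(UNIV::'a set). r / real CARD('a))"
        proof (rule sum_strict_mono)
        fix i
        have "e \<le> r / real CARD('a)" by (simp add: e_def)
        then show "\<bar>(z - y) $ i\<bar> < r / real CARD('a)" using z[rule_format, of i] by simp
      qed auto
      finally show ?thesis by (simp add: dist_norm norm_minus_commute)
    qed
    ultimately show ?thesis using W r by auto
  qed
  ultimately show "\<exists>e>0. \<forall>z. (\<forall>i. y $ i \<le> z $ i \<and> z $ i < y $ i + e) \<longrightarrow> z \<in> U" by blast
qed

lemma corner_UNIV: "corner UNIV"
  unfolding corner_def by (auto intro: exI[of _ 1])

lemma corner_open: "open S \<Longrightarrow> corner S"
  using corner_openin[OF corner_UNIV, of S] by simp

lemma corner_halfspace: "corner halfspace"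
  unfolding corner_def halfspace_def by (auto intro!: exI[of _ 1]) (meson order_trans)

lemma corner_add_axis:
  assumes "corner S" "y \<in> S"
  shows "\<exists>e>0. \<forall>s i. 0 \<le> s \<and> s < e \<longrightarrow> y + s *\<^sub>R axis i 1 \<in> S"
proof -
  obtain e where "e > 0" "\<And>z. (\<forall>i. y $ i \<le> z $ i \<and> z $ i < y $ i + e) \<Longrightarrow> z \<in> S"
    using assms unfolding corner_def by blast
  then show ?thesis by (intro exI[of _ e]) (simp add: axis_def)
qed

text \<open>Provides the small coordinate squares on which second differences are taken in the proof
  that mixed partial derivatives commute.\<close>

lemma corner_add_axes:
  assumes "corner S" "y \<in> S"
  shows "\<exists>e>0. \<forall>s t i j. i \<noteq> j \<and> 0 \<le> s \<and> s < e \<and> 0 \<le> t \<and> t < e \<longrightarrow>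
      y + s *\<^sub>R axis i 1 + t *\<^sub>R axis j 1 \<in> S"
proof -
  obtain e where e: "e > 0" "\<And>z. (\<forall>i. y $ i \<le> z $ i \<and> z $ i < y $ i + e) \<Longrightarrow> z \<in> S"
    using assms unfolding corner_def by blast
  show ?thesis
  proof (intro exI[of _ e] conjI allI impI e)
    fix s t :: real and i j k :: 'a
    assume "i \<noteq> j \<and> 0 \<le> s \<and> s < e \<and> 0 \<le> t \<and> t < e"
    then show "y $ k \<le> (y + s *\<^sub>R axis i 1 + t *\<^sub>R axis j 1) $ k"
      "(y + s *\<^sub>R axis i 1 + t *\<^sub>R axis j 1) $ k < y $ k + e"
      by (auto simp: axis_def)
  qed
qed

text \<open>From a point of a corner set one can move a little in the positive direction of every
  axis, and one-sided difference quotients along the axes already determine a linear map.\<close>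

lemma corner_derivative_unique:
  fixes f :: "real^'n \<Rightarrow> real"
  assumes "corner S" "y \<in> S" "(f has_derivative f') (at y within S)" "(f has_derivative f'') (at y within S)"
  shows "f' = f''"
proof (rule frechet_derivative_unique_within[OF assms(3,4)])
  fix i :: "real^'n" and e :: real
  assume i: "i \<in> Basis" and e: "e > 0"
  then obtain j where j: "i = axis j 1" by (auto simp: Basis_vec_def)
  obtain d where d: "d > 0" "\<forall>s i. 0 \<le> s \<and> s < d \<longrightarrow> y + s *\<^sub>R axis i 1 \<in> S"
    using corner_add_axis[OF assms(1,2)] by (elim exE conjE)
  have "y + min (e/2) (d/2) *\<^sub>R i \<in> S" unfolding j using d(1) e by (intro d(2)[rule_format]) auto
  then show "\<exists>d. 0 < \<bar>d\<bar> \<and> \<bar>d\<bar> < e \<and> y + d *\<^sub>R i \<in> S"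
    using e d(1) by (intro exI[of _ "min (e/2) (d/2)"]) auto
qed

lemma pd_eq:
  assumes "corner S" "y \<in> S" "(f has_derivative f') (at y within S)"
  shows "pd S i f y = f' (axis i 1)"
proof -
  have "(f has_derivative frechet_derivative f (at y within S)) (at y within S)"
    using assms(3) frechet_derivative_works differentiableI by blast
  then show ?thesis unfolding pd_def using corner_derivative_unique[OF assms(1,2) _ assms(3)] by simp
qed

text \<open>Expands the derivative over the axes. The differentiation rules below combine such
  expansions and then read off one coordinate with \<open>pd_eq\<close>.\<close>

lemma has_derivative_pd:
  fixes f :: "real^'n \<Rightarrow> real"
  assumes "f differentiable (at y within S)"
  shows "(f has_derivative (\<lambda>v. \<Sum>i\<in>UNIV. v $ i * pd S i f y)) (at y within S)"
proof -
  let ?D = "frechet_derivative f (at y within S)"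
  have *: "(f has_derivative ?D) (at y within S)"
    using assms frechet_derivative_works by blast
  then interpret linear ?D by (rule has_derivative_linear)
  have "?D v = (\<Sum>i\<in>UNIV. v $ i * pd S i f y)" for v
  proof -
    have "v = (\<Sum>i\<in>UNIV. v $ i *\<^sub>R axis i 1)"
      using basis_expansion[of v] by (simp add: scalar_mult_eq_scaleR)
    then have "?D v = ?D (\<Sum>i\<in>UNIV. v $ i *\<^sub>R axis i 1)" by simp
    also have "\<dots> = (\<Sum>i\<in>UNIV. v $ i * ?D (axis i 1))" by (simp add: sum scale)
    finally show ?thesis by (simp add: pd_def)
  qed
  then have "?D = (\<lambda>v. \<Sum>i\<in>UNIV. v $ i * pd S i f y)" by blast
  with * show ?thesis by simp
qed

text \<open>\<open>frechet_derivative\<close> is a choice among the linear maps that satisfy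
  \<open>has_derivative\<close>, and two functions agreeing on \<open>S\<close> admit the same maps,
  hence the same choice.\<close>

lemma pd_cong:
  assumes "\<And>x. x \<in> S \<Longrightarrow> f x = g x" "y \<in> S"
  shows "pd S i f y = pd S i g y"
proof -
  have "(f has_derivative D) (at y within S) \<longleftrightarrow> (g has_derivative D) (at y within S)" for D
    using assms by (auto intro: has_derivative_transform[of y S, rotated 2])
  then show ?thesis unfolding pd_def frechet_derivative_def by simp
qed

lemma pd_subset:
  assumes "openin (top_of_set S) U" "y \<in> U"
  shows "pd U i f y = pd S i f y"
proof -
  obtain W where "open W" "U = S \<inter> W" using assms(1) by (auto simp: openin_open)
  then have "at y within U = at y within S"
    using assms(2) by (intro at_within_nhd[of _ W]) auto
  then show ?thesis by (simp add: pd_def)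
qed

section \<open>Basic properties of functions of class C^k within a set\<close>

lemma Cdiff_cong:
  assumes "\<And>x. x \<in> S \<Longrightarrow> f x = g x"
  shows "Cdiff k S f \<longleftrightarrow> Cdiff k S g"
  using assms
proof (induction k arbitrary: f g)
  case 0 then show ?case by (auto intro: continuous_on_eq)
next
  case (Suc k)
  have "f differentiable_on S \<longleftrightarrow> g differentiable_on S"
    using Suc.prems by (auto simp: differentiable_on_def intro: differentiable_transform_within[OF _ zero_less_one])
  moreover have "Cdiff k S (pd S i f) \<longleftrightarrow> Cdiff k S (pd S i g)" for i
    by (rule Suc.IH) (use Suc.prems in \<open>auto intro: pd_cong\<close>)
  ultimately show ?case by simp
qed

lemma Cdiff_SucD: "Cdiff (Suc k) S f \<Longrightarrow> Cdiff k S f"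
proof (induction k arbitrary: f)
  case 0 then show ?case by (simp add: differentiable_imp_continuous_on)
next
  case (Suc k)
  then show ?case by (metis Cdiff.simps(2))
qed

lemma Cdiff_mono: "Cdiff k S f \<Longrightarrow> j \<le> k \<Longrightarrow> Cdiff j S f"
  by (induction k) (auto simp: le_Suc_eq dest: Cdiff_SucD simp del: Cdiff.simps)

lemma Cdiff_continuous: "Cdiff k S f \<Longrightarrow> continuous_on S f"
  using Cdiff_mono[of k S f 0] by simp

lemma Cdiff_pd: "Cdiff (Suc k) S f \<Longrightarrow> Cdiff k S (pd S i f)"
  by simp

lemma Cdiff_differentiable: "Cdiff (Suc k) S f \<Longrightarrow> y \<in> S \<Longrightarrow> f differentiable (at y within S)"
  by (simp add: differentiable_on_def)

text \<open>The candidates \<open>h\<close> have to match the partial derivatives on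
  \<open>S\<close> only. The closure rules below are thus inductions in which the classical
  derivative formula is the witness.\<close>

lemma Cdiff_SucI:
  assumes "\<And>y. y \<in> S \<Longrightarrow> f differentiable (at y within S)"
    and "\<And>i. Cdiff k S (h i)" "\<And>i y. y \<in> S \<Longrightarrow> pd S i f y = h i y"
  shows "Cdiff (Suc k) S f"
  using assms Cdiff_cong[of S "pd S i f" "h i" k for i] by (auto simp: differentiable_on_def)

lemma Cdiff_openin:
  assumes "openin (top_of_set S) U" "Cdiff k S f"
  shows "Cdiff k U f"
  using assms(2)
proof (induction k arbitrary: f)
  case 0 then show ?case using openin_subset[OF assms(1)] by (auto intro: continuous_on_subset)
next
  case (Suc k)
  have U: "U \<subseteq> S" using openin_subset[OF assms(1)] by simp
  show ?case
  proof (rule Cdiff_SucI)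
    show "f differentiable at y within U" if "y \<in> U" for y
      using that U Suc.prems by (meson Cdiff_differentiable differentiable_within_subset subsetD)
    show "Cdiff k U (pd S i f)" for i using Suc by simp
  qed (simp add: pd_subset[OF assms(1)])
qed

text \<open>Gluing principle, needed for functions that are extended by zero from the domain of a
  chart.\<close>

lemma Cdiff_local:
  assumes "\<And>y. y \<in> S \<Longrightarrow> \<exists>U. openin (top_of_set S) U \<and> y \<in> U \<and> Cdiff k U f"
  shows "Cdiff k S f"
  using assms
proof (induction k arbitrary: f)
  case 0
  show ?case
    unfolding Cdiff.simps continuous_on_eq_continuous_within
  proof
    fix y assume "y \<in> S"
    then obtain U where U: "openin (top_of_set S) U" "y \<in> U" "continuous_on U f" using 0 by auto
    then obtain W where W: "open W" "U = S \<inter> W" by (auto simp: openin_open)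
    then have "at y within U = at y within S"
      using U by (intro at_within_nhd[of _ W]) auto
    then show "continuous (at y within S) f" using U by (metis continuous_on_eq_continuous_within)
  qed
next
  case (Suc k)
  show ?case
    unfolding Cdiff.simps differentiable_on_def
  proof (intro conjI ballI allI)
    fix y assume "y \<in> S"
    then obtain U where U: "openin (top_of_set S) U" "y \<in> U" "Cdiff (Suc k) U f" using Suc.prems by blast
    then obtain W where W: "open W" "U = S \<inter> W" by (auto simp: openin_open)
    then have "at y within U = at y within S"
      using U by (intro at_within_nhd[of _ W]) auto
    then show "f differentiable at y within S" using U by (metis Cdiff_differentiable)
  next
    fix i
    show "Cdiff k S (pd S i f)"
    proof (rule Suc.IH)
      fix y assume "y \<in> S"
      then obtain U where U: "openin (top_of_set S) U" "y \<in> U" "Cdiff (Suc k) U f" using Suc.prems by blast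
      have "Cdiff k U (pd U i f)" using U by simp
      then have "Cdiff k U (pd S i f)" by (simp add: pd_subset[OF U(1)] cong: Cdiff_cong)
      with U show "\<exists>U. openin (top_of_set S) U \<and> y \<in> U \<and> Cdiff k U (pd S i f)" by blast
    qed
  qed
qed

section \<open>Differentiation rules and closure under arithmetic\<close>

lemma pd_const: "corner S \<Longrightarrow> y \<in> S \<Longrightarrow> pd S i (\<lambda>_. c) y = 0"
  by (rule pd_eq[where f' = "\<lambda>_. 0"]) auto

lemma pd_coord: "corner S \<Longrightarrow> y \<in> S \<Longrightarrow> pd S i (\<lambda>y. y $ j) y = (if i = j then 1 else 0)"
  by (subst pd_eq[where f' = "\<lambda>y. y $ j"]) (auto simp: axis_def bounded_linear_vec_nth bounded_linear_imp_has_derivative)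

lemma differentiable_coord: "(\<lambda>y::real^'n. y $ j) differentiable (at y within S)"
  by (rule bounded_linear_imp_differentiable[OF bounded_linear_vec_nth])

lemma pd_add:
  assumes "corner S" "y \<in> S" "f differentiable (at y within S)" "g differentiable (at y within S)"
  shows "pd S i (\<lambda>y. f y + g y) y = pd S i f y + pd S i g y"
  by (subst pd_eq[OF assms(1,2) has_derivative_add[OF has_derivative_pd[OF assms(3)] has_derivative_pd[OF assms(4)]]])
     (simp add: axis_def if_distrib[of "\<lambda>x. x * _"] cong: if_cong)

lemma pd_diff:
  assumes "corner S" "y \<in> S" "f differentiable (at y within S)" "g differentiable (at y within S)"
  shows "pd S i (\<lambda>y. f y - g y) y = pd S i f y - pd S i g y"
  by (subst pd_eq[OF assms(1,2) has_derivative_diff[OF has_derivative_pd[OF assms(3)] has_derivative_pd[OF assms(4)]]])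
     (simp add: axis_def if_distrib[of "\<lambda>x. x * _"] cong: if_cong)

lemma pd_sum:
  assumes "corner S" "y \<in> S" "\<And>a. a \<in> I \<Longrightarrow> f a differentiable (at y within S)"
  shows "pd S i (\<lambda>y. \<Sum>a\<in>I. f a y) y = (\<Sum>a\<in>I. pd S i (f a) y)"
proof -
  have "((\<lambda>y. \<Sum>a\<in>I. f a y) has_derivative (\<lambda>v. \<Sum>a\<in>I. \<Sum>i\<in>UNIV. v $ i * pd S i (f a) y)) (at y within S)"
    using assms(3) by (intro has_derivative_sum has_derivative_pd)
  from pd_eq[OF assms(1,2) this] show ?thesis
    by (simp add: axis_def if_distrib[of "\<lambda>x. x * _"] cong: if_cong)
qed


lemma pd_mult:
  assumes "corner S" "y \<in> S" "f differentiable (at y within S)" "g differentiable (at y within S)"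
  shows "pd S i (\<lambda>y. f y * g y) y = pd S i f y * g y + f y * pd S i g y"
  by (subst pd_eq[OF assms(1,2) has_derivative_mult[OF has_derivative_pd[OF assms(3)] has_derivative_pd[OF assms(4)]]])
     (simp add: axis_def if_distrib[of "\<lambda>x. x * _"] cong: if_cong)

lemma pd_compose:
  fixes f :: "real^'n \<Rightarrow> real"
  assumes "corner S" "y \<in> S" "f differentiable (at y within S)" "(h has_real_derivative d) (at (f y))"
  shows "pd S i (\<lambda>y. h (f y)) y = d * pd S i f y"
    and "(\<lambda>y. h (f y)) differentiable (at y within S)"
proof -
  have "((\<lambda>y. h (f y)) has_derivative (\<lambda>v. d * (\<Sum>i\<in>UNIV. v $ i * pd S i f y))) (at y within S)"
    by (rule has_derivative_compose[OF has_derivative_pd[OF assms(3)] assms(4)[unfolded has_field_derivative_def]])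
  note D = this
  show "pd S i (\<lambda>y. h (f y)) y = d * pd S i f y"
    by (subst pd_eq[OF assms(1,2) D]) (simp add: axis_def if_distrib[of "\<lambda>x. x * _"] cong: if_cong)
  show "(\<lambda>y. h (f y)) differentiable (at y within S)" using D by (rule differentiableI)
qed

lemma Cdiff_const: "corner S \<Longrightarrow> Cdiff k S (\<lambda>_. c)"
proof (induction k arbitrary: c)
  case (Suc k) then show ?case by (intro Cdiff_SucI[where h = "\<lambda>_ _. 0"]) (auto simp: pd_const)
qed simp

lemma Cdiff_coord: "corner S \<Longrightarrow> Cdiff k S (\<lambda>y. y $ j)"
proof (induction k)
  case (Suc k) then show ?case
    by (intro Cdiff_SucI[where h = "\<lambda>i _. if i = j then 1 else 0"]) (auto simp: pd_coord differentiable_coord Cdiff_const)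
qed (auto intro!: continuous_intros)

lemma Cdiff_add: "corner S \<Longrightarrow> Cdiff k S f \<Longrightarrow> Cdiff k S g \<Longrightarrow> Cdiff k S (\<lambda>y. f y + g y)"
proof (induction k arbitrary: f g)
  case (Suc k)
  then show ?case
    by (intro Cdiff_SucI[where h = "\<lambda>i y. pd S i f y + pd S i g y"])
       (auto simp: pd_add differentiable_on_def intro!: differentiable_add)
qed (auto intro!: continuous_intros)

lemma Cdiff_mult: "corner S \<Longrightarrow> Cdiff k S f \<Longrightarrow> Cdiff k S g \<Longrightarrow> Cdiff k S (\<lambda>y. f y * g y)"
proof (induction k arbitrary: f g)
  case (Suc k)
  show ?case
  proof (rule Cdiff_SucI[where h = "\<lambda>i y. pd S i f y * g y + f y * pd S i g y"])
    show "Cdiff k S (\<lambda>y. pd S i f y * g y + f y * pd S i g y)" for i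
      using Suc Cdiff_SucD[OF Suc.prems(2)] Cdiff_SucD[OF Suc.prems(3)] by (intro Cdiff_add) auto
  qed (use Suc.prems in \<open>auto simp: pd_mult differentiable_on_def intro!: differentiable_mult\<close>)
qed (auto intro!: continuous_intros)

lemma Cdiff_cmult: "corner S \<Longrightarrow> Cdiff k S f \<Longrightarrow> Cdiff k S (\<lambda>y. c * f y)"
  by (intro Cdiff_mult Cdiff_const)

lemma Cdiff_uminus: "corner S \<Longrightarrow> Cdiff k S f \<Longrightarrow> Cdiff k S (\<lambda>y. - f y)"
  using Cdiff_cmult[of S k f "-1"] by simp

lemma Cdiff_diff: "corner S \<Longrightarrow> Cdiff k S f \<Longrightarrow> Cdiff k S g \<Longrightarrow> Cdiff k S (\<lambda>y. f y - g y)"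
  using Cdiff_add[of S k f "\<lambda>y. - g y"] by (simp add: Cdiff_uminus)

lemma Cdiff_sum: "corner S \<Longrightarrow> (\<And>x. x \<in> I \<Longrightarrow> Cdiff k S (f x)) \<Longrightarrow> Cdiff k S (\<lambda>y. \<Sum>x\<in>I. f x y)"
  by (induction I rule: infinite_finite_induct) (auto simp: Cdiff_const Cdiff_add)

lemma Cdiff_prod: "corner S \<Longrightarrow> (\<And>x. x \<in> I \<Longrightarrow> Cdiff k S (f x)) \<Longrightarrow> Cdiff k S (\<lambda>y. \<Prod>x\<in>I. f x y)"
  by (induction I rule: infinite_finite_induct) (auto simp: Cdiff_const Cdiff_mult)

lemma Cdiff_power: "corner S \<Longrightarrow> Cdiff k S f \<Longrightarrow> Cdiff k S (\<lambda>y. f y ^ n)"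
  by (induction n) (auto simp: Cdiff_const Cdiff_mult)

lemma Cdiff_exp: "corner S \<Longrightarrow> Cdiff k S f \<Longrightarrow> Cdiff k S (\<lambda>y. exp (f y))"
proof (induction k)
  case (Suc k)
  show ?case
  proof (rule Cdiff_SucI[where h = "\<lambda>i y. exp (f y) * pd S i f y"])
    show "Cdiff k S (\<lambda>y. exp (f y) * pd S i f y)" for i
      using Suc Cdiff_SucD[OF Suc.prems(2)] by (intro Cdiff_mult) auto
  qed (use Suc.prems in \<open>auto simp: differentiable_on_def pd_compose[OF _ _ _ DERIV_exp]\<close>)
qed (auto intro!: continuous_intros)

lemma Cdiff_inverse:
  assumes "corner S" "\<And>y. y \<in> S \<Longrightarrow> f y \<noteq> 0" "Cdiff k S f"
  shows "Cdiff k S (\<lambda>y. inverse (f y))"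
  using assms(3)
proof (induction k)
  case 0 then show ?case using assms by (auto intro!: continuous_intros)
next
  case (Suc k)
  have d: "(inverse has_real_derivative - (inverse (f y) * inverse (f y))) (at (f y))" if "y \<in> S" for y
    using DERIV_inverse[of "f y" UNIV] assms(2)[OF that] by (simp add: power2_eq_square numeral_2_eq_2)
  show ?case
  proof (rule Cdiff_SucI[where h = "\<lambda>i y. - (inverse (f y) * inverse (f y)) * pd S i f y"])
    show "Cdiff k S (\<lambda>y. - (inverse (f y) * inverse (f y)) * pd S i f y)" for i
      using Suc Cdiff_SucD[OF Suc.prems] assms(1) by (intro Cdiff_mult Cdiff_uminus) auto
  qed (use Suc.prems pd_compose[OF assms(1) _ _ d] in \<open>auto simp: differentiable_on_def\<close>)
qed

lemma Cdiff_divide: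
  assumes "corner S" "\<And>y. y \<in> S \<Longrightarrow> f y \<noteq> 0" "Cdiff k S f" "Cdiff k S g"
  shows "Cdiff k S (\<lambda>y. g y / f y)"
  using assms by (simp add: divide_inverse Cdiff_mult Cdiff_inverse)

lemma Cdiff_ln:
  assumes "corner S" "\<And>y. y \<in> S \<Longrightarrow> f y > 0" "Cdiff k S f"
  shows "Cdiff k S (\<lambda>y. ln (f y))"
\<comment> \<open>No induction is required: the derivative of \<open>ln\<close> is a reciprocal,
  which \<open>Cdiff_inverse\<close> covers to every order.\<close>
proof (cases k)
  case 0 then show ?thesis using assms by (auto intro!: continuous_intros dest: less_imp_neq[symmetric])
next
  case (Suc j)
  have d: "(ln has_real_derivative inverse (f y)) (at (f y))" if "y \<in> S" for y
    using DERIV_ln[OF assms(2)[OF that]] by simp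
  show ?thesis unfolding Suc
  proof (rule Cdiff_SucI[where h = "\<lambda>i y. inverse (f y) * pd S i f y"])
    show "Cdiff j S (\<lambda>y. inverse (f y) * pd S i f y)" for i
      using assms Suc Cdiff_SucD[of j S f] by (intro Cdiff_mult Cdiff_inverse) (auto dest: less_imp_neq[symmetric])
  qed (use assms Suc pd_compose[OF assms(1) _ _ d] in \<open>auto simp: differentiable_on_def\<close>)
qed

section \<open>The chain rule\<close>

lemma pd_chain:
  fixes \<tau> :: "real^'n \<Rightarrow> real^'k"
  assumes "corner S" "y \<in> S" "\<And>a. (\<lambda>y. \<tau> y $ a) differentiable (at y within S)"
    "f differentiable (at (\<tau> y) within T)" "\<tau> ` S \<subseteq> T"
  shows "pd S i (\<lambda>y. f (\<tau> y)) y = (\<Sum>a\<in>UNIV. pd T a f (\<tau> y) * pd S i (\<lambda>y. \<tau> y $ a) y)"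
    and "(\<lambda>y. f (\<tau> y)) differentiable (at y within S)"
proof -
  have "(\<tau> has_derivative (\<lambda>v. \<chi> a. \<Sum>i\<in>UNIV. v $ i * pd S i (\<lambda>y. \<tau> y $ a) y)) (at y within S)"
    unfolding has_derivative_componentwise_within[of \<tau>]
    using has_derivative_pd[OF assms(3)] by (auto simp: Basis_vec_def inner_axis)
  moreover have "(f has_derivative (\<lambda>v. \<Sum>a\<in>UNIV. v $ a * pd T a f (\<tau> y))) (at (\<tau> y) within \<tau> ` S)"
    using has_derivative_pd[OF assms(4)] assms(5) has_derivative_subset by blast
  ultimately have D: "((\<lambda>y. f (\<tau> y)) has_derivative
      (\<lambda>v. \<Sum>a\<in>UNIV. (\<chi> a. \<Sum>i\<in>UNIV. v $ i * pd S i (\<lambda>y. \<tau> y $ a) y) $ a * pd T a f (\<tau> y))) (at y within S)"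
    by (rule has_derivative_in_compose)
  show "pd S i (\<lambda>y. f (\<tau> y)) y = (\<Sum>a\<in>UNIV. pd T a f (\<tau> y) * pd S i (\<lambda>y. \<tau> y $ a) y)"
    by (subst pd_eq[OF assms(1,2) D]) (simp add: axis_def if_distrib[of "\<lambda>x. x * _"] mult.commute cong: if_cong)
  show "(\<lambda>y. f (\<tau> y)) differentiable (at y within S)" using D by (auto simp: differentiable_def)
qed

lemma continuous_on_vec_componentwise:
  "continuous_on S (\<tau> :: 'a::t2_space \<Rightarrow> real^'k) \<longleftrightarrow> (\<forall>a. continuous_on S (\<lambda>y. \<tau> y $ a))"
  unfolding continuous_on_componentwise[of S \<tau>] by (auto simp: Basis_vec_def inner_axis)

lemma Cdiff_chain:
  fixes \<tau> :: "real^'n \<Rightarrow> real^'k"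
  assumes "corner S" "\<And>a. Cdiff k S (\<lambda>y. \<tau> y $ a)" "\<tau> ` S \<subseteq> T" "Cdiff k T f"
  shows "Cdiff k S (\<lambda>y. f (\<tau> y))"
  using assms(2,4)
proof (induction k arbitrary: f)
  case 0
  then have "continuous_on S \<tau>" by (simp add: continuous_on_vec_componentwise)
  then show ?case using 0 assms(3) continuous_on_compose2[of T f S \<tau>] by auto
next
  case (Suc k)
  have y: "pd S i (\<lambda>y. f (\<tau> y)) y = (\<Sum>a\<in>UNIV. pd T a f (\<tau> y) * pd S i (\<lambda>y. \<tau> y $ a) y)"
    "(\<lambda>y. f (\<tau> y)) differentiable (at y within S)" if "y \<in> S" for y i
  proof -
    have *: "(\<lambda>y. \<tau> y $ a) differentiable (at y within S)" for a
      using Suc.prems(1) that by (rule Cdiff_differentiable)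
    have "\<tau> y \<in> T" using that assms(3) by blast
    with Suc.prems(2) have "f differentiable (at (\<tau> y) within T)" by (rule Cdiff_differentiable)
    note ** = pd_chain[OF assms(1) that * this assms(3)]
    show "pd S i (\<lambda>y. f (\<tau> y)) y = (\<Sum>a\<in>UNIV. pd T a f (\<tau> y) * pd S i (\<lambda>y. \<tau> y $ a) y)"
      by (rule **(1))
    show "(\<lambda>y. f (\<tau> y)) differentiable (at y within S)"
      by (rule **(2))
  qed
  show ?case
  proof (rule Cdiff_SucI[where h = "\<lambda>i y. \<Sum>a\<in>UNIV. pd T a f (\<tau> y) * pd S i (\<lambda>y. \<tau> y $ a) y", OF y(2)])
    show "Cdiff k S (\<lambda>y. \<Sum>a\<in>UNIV. pd T a f (\<tau> y) * pd S i (\<lambda>y. \<tau> y $ a) y)" for i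
    proof (intro Cdiff_sum Cdiff_mult assms(1))
      fix a
      show "Cdiff k S (\<lambda>y. pd T a f (\<tau> y))"
        by (rule Suc.IH[OF Cdiff_SucD[OF Suc.prems(1)] Cdiff_pd[OF Suc.prems(2)]])
      show "Cdiff k S (pd S i (\<lambda>y. \<tau> y $ a))"
        by (rule Cdiff_pd[OF Suc.prems(1)])
    qed
  qed (use y(1) in blast)+
qed

section \<open>Equality of mixed partial derivatives\<close>

lemma DERIV_slice:
  fixes F :: "real^'n \<Rightarrow> real"
  assumes "corner S" "\<And>y. y \<in> S \<Longrightarrow> F differentiable (at y within S)" "\<And>s. s \<in> I \<Longrightarrow> q + s *\<^sub>R axis i 1 \<in> S" "s \<in> I"
  shows "((\<lambda>s. F (q + s *\<^sub>R axis i 1)) has_derivative (\<lambda>h. h * pd S i F (q + s *\<^sub>R axis i 1))) (at s within I)"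
proof -
  have 1: "((\<lambda>s. q + s *\<^sub>R axis i 1) has_derivative (\<lambda>h. h *\<^sub>R axis i 1)) (at s within I)"
    by (auto intro!: derivative_eq_intros)
  have 2: "(F has_derivative (\<lambda>v. \<Sum>k\<in>UNIV. v $ k * pd S k F (q + s *\<^sub>R axis i 1)))
      (at (q + s *\<^sub>R axis i 1) within (\<lambda>s. q + s *\<^sub>R axis i 1) ` I)"
    by (rule has_derivative_subset[OF has_derivative_pd[OF assms(2)[OF assms(3)[OF assms(4)]]]])
       (use assms(3) in auto)
  have "(\<lambda>v. \<Sum>k\<in>UNIV. v $ k * pd S k F (q + s *\<^sub>R axis i 1)) \<circ> (\<lambda>h. h *\<^sub>R axis i 1)
      = (\<lambda>h. h * pd S i F (q + s *\<^sub>R axis i 1))"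
    by (auto simp: axis_def if_distrib[of "\<lambda>x. _ * x"] if_distrib[of "\<lambda>x. x * _"] cong: if_cong)
  then show ?thesis using has_derivative_in_compose[OF 1 2] by (simp add: o_def)
qed

text \<open>The mean value theorem is used twice, along axis \<open>i\<close> for the difference of
  \<open>f\<close> between two opposite sides of the square, and then along axis \<open>j\<close>
  for the derivative so obtained. All points have non-negative offsets from \<open>y\<close>, which
  suits corner sets.\<close>

lemma double_difference:
  fixes f :: "real^'n \<Rightarrow> real"
  assumes S: "corner S" and f: "Cdiff 2 S f" and h: "h > 0"
    and P: "\<And>s t. 0 \<le> s \<Longrightarrow> s \<le> h \<Longrightarrow> 0 \<le> t \<Longrightarrow> t \<le> h \<Longrightarrow> y + s *\<^sub>R axis i 1 + t *\<^sub>R axis j 1 \<in> S"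
  obtains s t where "0 < s" "s < h" "0 < t" "t < h"
    "f (y + h *\<^sub>R axis i 1 + h *\<^sub>R axis j 1) - f (y + h *\<^sub>R axis i 1) - f (y + h *\<^sub>R axis j 1) + f y
      = h * h * pd S j (pd S i f) (y + s *\<^sub>R axis i 1 + t *\<^sub>R axis j 1)"
proof -
  have f2: "Cdiff (Suc (Suc 0)) S f" using f by (simp add: numeral_2_eq_2)
  have d1: "f differentiable (at y within S)" if "y \<in> S" for y
    using f2 that by (rule Cdiff_differentiable)
  have d2: "pd S i f differentiable (at y within S)" if "y \<in> S" for y
    using Cdiff_pd[OF f2] that by (rule Cdiff_differentiable)
  let ?\<phi> = "\<lambda>s. f ((y + h *\<^sub>R axis j 1) + s *\<^sub>R axis i 1) - f (y + s *\<^sub>R axis i 1)"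
  have "\<exists>s\<in>{0<..<h}. ?\<phi> h - ?\<phi> 0 = (\<lambda>s x. x * pd S i f ((y + h *\<^sub>R axis j 1) + s *\<^sub>R axis i 1) - x * pd S i f (y + s *\<^sub>R axis i 1)) s (h - 0)"
  proof (rule mvt_simple[OF h])
    fix s assume s: "0 \<le> s" "s \<le> h"
    have *: "(y + h *\<^sub>R axis j 1) + s *\<^sub>R axis i 1 \<in> S" "y + s *\<^sub>R axis i 1 \<in> S" if "s \<in> {0..h}" for s
      using P[of s h] P[of s 0] that h by (auto simp: algebra_simps)
    show "(?\<phi> has_derivative (\<lambda>x. x * pd S i f ((y + h *\<^sub>R axis j 1) + s *\<^sub>R axis i 1) - x * pd S i f (y + s *\<^sub>R axis i 1))) (at s within {0..h})"
      using s by (intro has_derivative_diff DERIV_slice[OF S d1]) (auto intro: *)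
  qed
  then obtain s where s: "0 < s" "s < h"
    "?\<phi> h - ?\<phi> 0 = h * (pd S i f ((y + h *\<^sub>R axis j 1) + s *\<^sub>R axis i 1) - pd S i f (y + s *\<^sub>R axis i 1))"
    by (auto simp: algebra_simps)
  let ?\<psi> = "\<lambda>t. pd S i f ((y + s *\<^sub>R axis i 1) + t *\<^sub>R axis j 1)"
  have "\<exists>t\<in>{0<..<h}. ?\<psi> h - ?\<psi> 0 = (\<lambda>t x. x * pd S j (pd S i f) ((y + s *\<^sub>R axis i 1) + t *\<^sub>R axis j 1)) t (h - 0)"
  proof (rule mvt_simple[OF h])
    fix t assume t: "0 \<le> t" "t \<le> h"
    show "(?\<psi> has_derivative (\<lambda>x. x * pd S j (pd S i f) ((y + s *\<^sub>R axis i 1) + t *\<^sub>R axis j 1))) (at t within {0..h})"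
      using s t by (intro DERIV_slice[OF S d2]) (auto intro!: P)
  qed
  then obtain t where t: "0 < t" "t < h"
    "?\<psi> h - ?\<psi> 0 = h * pd S j (pd S i f) ((y + s *\<^sub>R axis i 1) + t *\<^sub>R axis j 1)"
    by auto
  have "(y + h *\<^sub>R axis j 1) + s *\<^sub>R axis i 1 = (y + s *\<^sub>R axis i 1) + h *\<^sub>R axis j 1"
    "(y + h *\<^sub>R axis j 1) + h *\<^sub>R axis i 1 = (y + h *\<^sub>R axis i 1) + h *\<^sub>R axis j 1" by (simp_all add: algebra_simps)
  then have "f (y + h *\<^sub>R axis i 1 + h *\<^sub>R axis j 1) - f (y + h *\<^sub>R axis i 1) - f (y + h *\<^sub>R axis j 1) + f y
      = ?\<phi> h - ?\<phi> 0" by (simp add: add.assoc add.commute add.left_commute)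
  also have "\<dots> = h * (?\<psi> h - ?\<psi> 0)"
    unfolding s(3) \<open>(y + h *\<^sub>R axis j 1) + s *\<^sub>R axis i 1 = _\<close> by simp
  finally show ?thesis using s t by (intro that[of s t]) (simp_all add: mult.assoc)
qed

text \<open>The second difference is symmetric in the two axes. Hence, up to the same factor
  \<open>h * h\<close>, it is a value of either mixed derivative at some point of the square, and
  both derivatives are continuous at its vertex \<open>y\<close>.\<close>

lemma pd_swap:
  fixes f :: "real^'n \<Rightarrow> real"
  assumes S: "corner S" and f: "Cdiff 2 S f" and y: "y \<in> S"
  shows "pd S i (pd S j f) y = pd S j (pd S i f) y"
proof (cases "i = j")
  case ij: False
  show ?thesis
  proof (rule ccontr)
    let ?a = "pd S i (pd S j f)" and ?b = "pd S j (pd S i f)"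
    assume ne: "?a y \<noteq> ?b y"
    \<comment> \<open>Half the gap: a common value closer than \<epsilon> to both numbers is then
      impossible.\<close>
    define \<epsilon> where "\<epsilon> = \<bar>?a y - ?b y\<bar> / 2"
    have \<epsilon>: "\<epsilon> > 0" using ne by (simp add: \<epsilon>_def)
    have c: "continuous_on S ?a" "continuous_on S ?b"
      using f by (simp_all add: numeral_2_eq_2)
    have "\<exists>d>0. \<forall>z\<in>S. dist z y < d \<longrightarrow> \<bar>h z - h y\<bar> < \<epsilon>" if "continuous_on S h" for h :: "real^'n \<Rightarrow> real"
      using that y \<epsilon> unfolding continuous_on_iff dist_real_def by blast
    from this[OF c(1)] this[OF c(2)] obtain d1 d2 where d: "d1 > 0" "d2 > 0"
      "\<And>z. z \<in> S \<Longrightarrow> dist z y < d1 \<Longrightarrow> \<bar>?a z - ?a y\<bar> < \<epsilon>"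
      "\<And>z. z \<in> S \<Longrightarrow> dist z y < d2 \<Longrightarrow> \<bar>?b z - ?b y\<bar> < \<epsilon>"
      by blast
    obtain e where e: "e > 0"
      "\<forall>s t i j. i \<noteq> j \<and> 0 \<le> s \<and> s < e \<and> 0 \<le> t \<and> t < e \<longrightarrow> y + s *\<^sub>R axis i 1 + t *\<^sub>R axis j 1 \<in> S"
      using corner_add_axes[OF S y] by (elim exE conjE)
    \<comment> \<open>Points of the open square of side \<open>h\<close> are at distance less than
      \<open>2 * h\<close> from \<open>y\<close>, so \<open>h\<close> is at most half of either
      continuity radius.\<close>
    define h where "h = min (e/2) (min (d1/2) (d2/2))"
    have h: "h > 0" "h < e" "2 * h \<le> d1" "2 * h \<le> d2" using e d by (auto simp: h_def)
    have P: "y + s *\<^sub>R axis i 1 + t *\<^sub>R axis j 1 \<in> S" if "i \<noteq> j" "0 \<le> s" "s \<le> h" "0 \<le> t" "t \<le> h" for s t i j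
      using that h(2) e(2) by simp
    have dP: "dist (y + s *\<^sub>R axis i 1 + t *\<^sub>R axis j 1) y < 2 * h" if "0 < s" "s < h" "0 < t" "t < h" for s t i j
    proof -
      have "norm (s *\<^sub>R axis i 1 + t *\<^sub>R axis j (1::real)) \<le> s + t"
        using norm_triangle_ineq[of "s *\<^sub>R axis i 1" "t *\<^sub>R axis j (1::real)"] that by simp
      then show ?thesis using that by (simp add: dist_norm add.assoc)
    qed
    let ?\<Delta> = "f (y + h *\<^sub>R axis i 1 + h *\<^sub>R axis j 1) - f (y + h *\<^sub>R axis i 1) - f (y + h *\<^sub>R axis j 1) + f y"
    obtain s t :: real where st: "0 < s" "s < h" "0 < t" "t < h" "?\<Delta> = h * h * ?b (y + s *\<^sub>R axis i 1 + t *\<^sub>R axis j 1)"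
      by (rule double_difference[OF S f h(1) P[OF ij]])
    obtain s' t' where st': "0 < s'" "s' < h" "0 < t'" "t' < h"
      "f (y + h *\<^sub>R axis j 1 + h *\<^sub>R axis i 1) - f (y + h *\<^sub>R axis j 1) - f (y + h *\<^sub>R axis i 1) + f y
        = h * h * ?a (y + s' *\<^sub>R axis j 1 + t' *\<^sub>R axis i 1)"
      by (rule double_difference[OF S f h(1) P[OF ij[symmetric]]])
    have sw: "y + h *\<^sub>R axis j 1 + h *\<^sub>R axis i 1 = y + h *\<^sub>R axis i 1 + h *\<^sub>R axis j 1"
      by (simp add: add.assoc add.commute add.left_commute)
    have "?\<Delta> = h * h * ?a (y + s' *\<^sub>R axis j 1 + t' *\<^sub>R axis i 1)"
      using st'(5) unfolding sw by linarith
    then have eq: "?a (y + s' *\<^sub>R axis j 1 + t' *\<^sub>R axis i 1) = ?b (y + s *\<^sub>R axis i 1 + t *\<^sub>R axis j 1)"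
      using st(5) h(1) by simp
    have "\<bar>?a (y + s' *\<^sub>R axis j 1 + t' *\<^sub>R axis i 1) - ?a y\<bar> < \<epsilon>"
      using st' h(3) dP[OF st'(1-4), of j i] by (intro d(3) P) (use ij in simp_all)
    moreover have "\<bar>?b (y + s *\<^sub>R axis i 1 + t *\<^sub>R axis j 1) - ?b y\<bar> < \<epsilon>"
      using st h(4) dP[OF st(1-4), of i j] by (intro d(4) P) (use ij in simp_all)
    moreover have "\<bar>?a y - ?b y\<bar> \<le> \<bar>x - ?a y\<bar> + \<bar>x - ?b y\<bar>" for x by arith
    ultimately show False unfolding \<epsilon>_def eq by (smt (verit) field_sum_of_halves)
  qed
qed simp


section \<open>Uniform convergence of families with their derivatives\<close>

text \<open>Derivatives are taken within \<open>S\<close>; the convergence to \<open>0\<close> is uniform on \<open>Q\<close> only.\<close>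

primrec Ctends :: "nat \<Rightarrow> (real^'n) set \<Rightarrow> (real^'n) set \<Rightarrow> ('x \<Rightarrow> real^'n \<Rightarrow> real) \<Rightarrow> 'x filter \<Rightarrow> bool" where
  "Ctends 0 Q S u F \<longleftrightarrow> uniform_limit Q u (\<lambda>_. 0) F"
| "Ctends (Suc k) Q S u F \<longleftrightarrow> uniform_limit Q u (\<lambda>_. 0) F \<and> (\<forall>i. Ctends k Q S (\<lambda>x. pd S i (u x)) F)"

lemma Ctends_uniform: "Ctends k Q S u F \<Longrightarrow> uniform_limit Q u (\<lambda>_. 0) F"
  by (cases k) auto

lemma Ctends_SucD: "Ctends (Suc k) Q S u F \<Longrightarrow> Ctends k Q S u F"
  by (induction k arbitrary: u) auto

lemma Ctends_SucI:
  "uniform_limit Q u (\<lambda>_. 0) F \<Longrightarrow> (\<And>i. Ctends k Q S (\<lambda>x. pd S i (u x)) F) \<Longrightarrow> Ctends (Suc k) Q S u F"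
  by simp

lemma eventually_Cdiff:
  assumes "\<forall>\<^sub>F x in F. Cdiff (Suc k) S (u x)"
  shows "\<forall>\<^sub>F x in F. Cdiff k S (u x)" "\<forall>\<^sub>F x in F. Cdiff k S (pd S i (u x))"
proof -
  show "\<forall>\<^sub>F x in F. Cdiff k S (u x)" using assms by eventually_elim (rule Cdiff_SucD)
  show "\<forall>\<^sub>F x in F. Cdiff k S (pd S i (u x))" using assms by eventually_elim (rule Cdiff_pd)
qed

text \<open>Agreement is asked on \<open>S\<close> rather than on \<open>Q\<close>, since the
  derivatives at points of \<open>Q\<close> depend on values in \<open>S\<close>.\<close>

lemma Ctends_cong:
  assumes "Q \<subseteq> S" "\<forall>\<^sub>F x in F. \<forall>y\<in>S. u x y = v x y" "Ctends k Q S u F"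
  shows "Ctends k Q S v F"
  using assms(2,3)
proof (induction k arbitrary: u v)
  case 0
  have "\<forall>\<^sub>F x in F. \<forall>y\<in>Q. u x y = v x y" using 0(1) by eventually_elim (use assms(1) in auto)
  then show ?case using 0(2) uniform_limit_cong[of Q u v F "\<lambda>_. 0" "\<lambda>_. 0"] by auto
next
  case (Suc k)
  have "\<forall>\<^sub>F x in F. \<forall>y\<in>Q. u x y = v x y" using Suc.prems(1) by eventually_elim (use assms(1) in auto)
  then have "uniform_limit Q v (\<lambda>_. 0) F"
    using Suc.prems(2) uniform_limit_cong[of Q u v F "\<lambda>_. 0" "\<lambda>_. 0"] by auto
  moreover have "Ctends k Q S (\<lambda>x. pd S i (v x)) F" for i
  proof (rule Suc.IH)
    show "\<forall>\<^sub>F x in F. \<forall>y\<in>S. pd S i (u x) y = pd S i (v x) y"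
      using Suc.prems(1) by eventually_elim (auto intro: pd_cong)
  qed (use Suc.prems in simp)
  ultimately show ?case by simp
qed

lemma Ctends_add:
  assumes "corner S" "Q \<subseteq> S" "\<forall>\<^sub>F x in F. Cdiff k S (u x)" "\<forall>\<^sub>F x in F. Cdiff k S (v x)"
    "Ctends k Q S u F" "Ctends k Q S v F"
  shows "Ctends k Q S (\<lambda>x y. u x y + v x y) F"
  using assms(3-)
proof (induction k arbitrary: u v)
  case 0
  then show ?case using uniform_limit_add[OF 0(3,4)[THEN Ctends_uniform]] by simp
next
  case (Suc k)
  show ?case
  proof (rule Ctends_SucI)
    show "uniform_limit Q (\<lambda>x y. u x y + v x y) (\<lambda>_. 0) F"
      using uniform_limit_add[OF Suc.prems(3,4)[THEN Ctends_uniform]] by simp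
    fix i
    have "Ctends k Q S (\<lambda>x y. pd S i (u x) y + pd S i (v x) y) F"
      using Suc.prems by (intro Suc.IH) (auto elim: eventually_mono)
    moreover have "\<forall>\<^sub>F x in F. \<forall>y\<in>S. pd S i (u x) y + pd S i (v x) y = pd S i (\<lambda>y. u x y + v x y) y"
      using Suc.prems(1,2) by eventually_elim (simp add: pd_add assms(1) differentiable_on_def)
    ultimately show "Ctends k Q S (\<lambda>x. pd S i (\<lambda>y. u x y + v x y)) F"
      by (rule Ctends_cong[OF assms(2), rotated])
  qed
qed

lemma uniform_limit_mult_bounded:
  fixes u v :: "'x \<Rightarrow> 'y \<Rightarrow> real"
  assumes "uniform_limit Q u (\<lambda>_. 0) F" "\<And>y. y \<in> Q \<Longrightarrow> \<bar>g y\<bar> \<le> B"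
  shows "uniform_limit Q (\<lambda>x y. g y * u x y) (\<lambda>_. 0) F"
  unfolding uniform_limit_iff
proof (intro allI impI)
  fix e :: real assume e: "e > 0"
  then have "\<forall>\<^sub>F x in F. \<forall>y\<in>Q. dist (u x y) 0 < e / (\<bar>B\<bar> + 1)"
    using assms(1) unfolding uniform_limit_iff by (meson abs_ge_zero add_nonneg_pos divide_pos_pos zero_less_one)
  then show "\<forall>\<^sub>F x in F. \<forall>y\<in>Q. dist (g y * u x y) 0 < e"
  proof eventually_elim
    case (elim x)
    show ?case
    proof
      fix y assume y: "y \<in> Q"
      have "\<bar>g y\<bar> * \<bar>u x y\<bar> \<le> (\<bar>B\<bar> + 1) * \<bar>u x y\<bar>"
        using assms(2)[OF y] by (intro mult_right_mono) auto
      also have "\<dots> < e" using elim y by (auto simp: field_simps)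
      finally show "dist (g y * u x y) 0 < e" by (simp add: abs_mult)
    qed
  qed
qed

text \<open>The compact set \<open>K\<close> between \<open>Q\<close> and \<open>S\<close> bounds
  the fixed factor and its derivatives on \<open>Q\<close>. In the application \<open>Q\<close> is
  the image of a member of the cover and \<open>K\<close> that of its closure.\<close>

lemma Ctends_mult_fixed:
  assumes S: "corner S" and Q: "Q \<subseteq> K" "compact K" "K \<subseteq> S" and g: "Cdiff k S g"
    and "\<forall>\<^sub>F x in F. Cdiff k S (u x)" "Ctends k Q S u F"
  shows "Ctends k Q S (\<lambda>x y. g y * u x y) F"
  using g assms(6-)
proof (induction k arbitrary: g u)
  case 0
  have "compact (g ` K)" using 0 Q by (auto intro: compact_continuous_image continuous_on_subset)
  then obtain B where "\<forall>x\<in>g ` K. norm x \<le> B" using compact_imp_bounded bounded_iff by blast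
  then have "\<And>y. y \<in> Q \<Longrightarrow> \<bar>g y\<bar> \<le> B" using Q by auto
  with 0(3)[THEN Ctends_uniform] have "uniform_limit Q (\<lambda>x y. g y * u x y) (\<lambda>_. 0) F"
    by (rule uniform_limit_mult_bounded)
  then show ?case by simp
next
  case (Suc k)
  have g: "Cdiff k S g" "Cdiff k S (pd S i g)" for i using Suc.prems(1) Cdiff_SucD by auto
  have u: "\<forall>\<^sub>F x in F. Cdiff k S (u x)" "\<forall>\<^sub>F x in F. Cdiff k S (pd S i (u x))" for i
    using Suc.prems(2) by (rule eventually_Cdiff)+
  have u': "Ctends k Q S u F" "Ctends k Q S (\<lambda>x. pd S i (u x)) F" for i using Suc.prems(3) by (rule Ctends_SucD, simp)
  have m: "\<forall>\<^sub>F x in F. Cdiff k S (\<lambda>y. a y * b x y)"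
    if "Cdiff k S a" "\<forall>\<^sub>F x in F. Cdiff k S (b x)" for a b
    using that(2) by eventually_elim (rule Cdiff_mult[OF S that(1)])
  show ?case
  proof (rule Ctends_SucI)
    show "uniform_limit Q (\<lambda>x y. g y * u x y) (\<lambda>_. 0) F"
      using Ctends_uniform[OF Suc.IH[OF g(1) u(1) u'(1)]] .
    fix i
    have "Ctends k Q S (\<lambda>x y. pd S i g y * u x y + g y * pd S i (u x) y) F"
      using g u u' Q m by (intro Ctends_add S Suc.IH) auto
    moreover have "\<forall>\<^sub>F x in F. \<forall>y\<in>S. pd S i g y * u x y + g y * pd S i (u x) y = pd S i (\<lambda>y. g y * u x y) y"
      using Suc.prems(2) by eventually_elim (use Suc.prems(1) in \<open>simp add: pd_mult S differentiable_on_def\<close>)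
    ultimately show "Ctends k Q S (\<lambda>x. pd S i (\<lambda>y. g y * u x y)) F"
      by (rule Ctends_cong[OF subset_trans[OF Q(1,3)], rotated])
  qed
qed

text \<open>Serves \<open>Ctends_exp\<close>, where a derivative of the exponent multiplies a factor
  that also tends to \<open>0\<close>.\<close>

lemma Ctends_mult:
  assumes S: "corner S" "Q \<subseteq> S" and "\<forall>\<^sub>F x in F. Cdiff k S (v x)" "Ctends k Q S v F"
    and "\<forall>\<^sub>F x in F. Cdiff k S (u x)" "Ctends k Q S u F"
  shows "Ctends k Q S (\<lambda>x y. v x y * u x y) F"
  using assms(3-)
proof (induction k arbitrary: v u)
  case 0
  show ?case unfolding Ctends.simps uniform_limit_iff
  proof (intro allI impI)
    fix e :: real assume e: "e > 0"
    have "\<forall>\<^sub>F x in F. \<forall>y\<in>Q. dist (u x y) 0 < e" "\<forall>\<^sub>F x in F. \<forall>y\<in>Q. dist (v x y) 0 < 1"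
      using 0 e unfolding Ctends.simps uniform_limit_iff by auto
    then show "\<forall>\<^sub>F x in F. \<forall>y\<in>Q. dist (v x y * u x y) 0 < e"
    proof eventually_elim
      case (elim x)
      show ?case
      proof
        fix y assume y: "y \<in> Q"
        have "\<bar>v x y\<bar> * \<bar>u x y\<bar> \<le> 1 * \<bar>u x y\<bar>"
          using elim y by (intro mult_right_mono) (auto intro: less_imp_le)
        also have "\<dots> < e" using elim y by auto
        finally show "dist (v x y * u x y) 0 < e" by (simp add: abs_mult)
      qed
    qed
  qed
next
  case (Suc k)
  have v: "\<forall>\<^sub>F x in F. Cdiff k S (v x)" "\<forall>\<^sub>F x in F. Cdiff k S (pd S i (v x))" for i
    using Suc.prems(1) by (rule eventually_Cdiff)+
  have u: "\<forall>\<^sub>F x in F. Cdiff k S (u x)" "\<forall>\<^sub>F x in F. Cdiff k S (pd S i (u x))" for i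
    using Suc.prems(3) by (rule eventually_Cdiff)+
  have u': "Ctends k Q S u F" "Ctends k Q S (\<lambda>x. pd S i (u x)) F" for i using Suc.prems(4) by (rule Ctends_SucD, simp)
  have v': "Ctends k Q S v F" "Ctends k Q S (\<lambda>x. pd S i (v x)) F" for i using Suc.prems(2) by (rule Ctends_SucD, simp)
  have m: "\<forall>\<^sub>F x in F. Cdiff k S (\<lambda>y. a x y * b x y)"
    if "\<forall>\<^sub>F x in F. Cdiff k S (a x)" "\<forall>\<^sub>F x in F. Cdiff k S (b x)" for a b
    using that by eventually_elim (rule Cdiff_mult[OF S(1)])
  show ?case
  proof (rule Ctends_SucI)
    show "uniform_limit Q (\<lambda>x y. v x y * u x y) (\<lambda>_. 0) F"
      by (rule Ctends_uniform[OF Suc.IH[OF v(1) v'(1) u(1) u'(1)]])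
    fix i
    have "Ctends k Q S (\<lambda>x y. pd S i (v x) y * u x y + v x y * pd S i (u x) y) F"
      using v v' u u' by (intro Ctends_add S Suc.IH m)
    moreover have "\<forall>\<^sub>F x in F. \<forall>y\<in>S. pd S i (v x) y * u x y + v x y * pd S i (u x) y = pd S i (\<lambda>y. v x y * u x y) y"
      using Suc.prems(1,3) by eventually_elim (simp add: pd_mult S differentiable_on_def)
    ultimately show "Ctends k Q S (\<lambda>x. pd S i (\<lambda>y. v x y * u x y)) F"
      by (rule Ctends_cong[OF S(2), rotated])
  qed
qed

text \<open>Subtracting \<open>1\<close> makes the induction close: each partial derivative is
  \<open>pd S i (u x)\<close> times the same expression, plus \<open>pd S i (u x)\<close>
  itself.\<close>

lemma Ctends_exp:
  assumes S: "corner S" "Q \<subseteq> S" and "\<forall>\<^sub>F x in F. Cdiff k S (u x)" "Ctends k Q S u F"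
  shows "Ctends k Q S (\<lambda>x y. exp (u x y) - 1) F"
proof -
  have un: "uniform_limit Q (\<lambda>x y. exp (u x y) - 1) (\<lambda>_. 0) F" if "uniform_limit Q u (\<lambda>_. 0) F" for u :: "'b \<Rightarrow> real^'a \<Rightarrow> real"
    unfolding uniform_limit_iff
  proof (intro allI impI)
    fix e :: real assume "e > 0"
    moreover have "isCont (exp :: real \<Rightarrow> real) 0" by simp
    ultimately obtain d where d: "d > 0" "\<And>t::real. \<bar>t\<bar> < d \<Longrightarrow> \<bar>exp t - 1\<bar> < e"
      unfolding continuous_at_eps_delta dist_real_def by auto
    have "\<forall>\<^sub>F x in F. \<forall>y\<in>Q. dist (u x y) 0 < d" using that d(1) unfolding uniform_limit_iff by blast
    then show "\<forall>\<^sub>F x in F. \<forall>y\<in>Q. dist (exp (u x y) - 1) 0 < e"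
      by eventually_elim (use d(2) in \<open>simp add: dist_real_def\<close>)
  qed
  show ?thesis using assms(3-)
  proof (induction k)
    case 0 then show ?case using un by simp
  next
    case (Suc k)
    have u: "\<forall>\<^sub>F x in F. Cdiff k S (u x)" "\<forall>\<^sub>F x in F. Cdiff k S (pd S i (u x))" for i
      using Suc.prems(1) by (rule eventually_Cdiff)+
    have u3: "\<forall>\<^sub>F x in F. Cdiff k S (\<lambda>y. exp (u x y) - 1)"
      using u(1) by eventually_elim (intro Cdiff_diff Cdiff_exp Cdiff_const S)
    have m: "\<forall>\<^sub>F x in F. Cdiff k S (\<lambda>y. pd S i (u x) y * (exp (u x y) - 1))" for i
      using u(2)[of i] u3 by eventually_elim (rule Cdiff_mult[OF S(1)])
    have u': "Ctends k Q S u F" "Ctends k Q S (\<lambda>x. pd S i (u x)) F" for i using Suc.prems(2) by (rule Ctends_SucD, simp)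
    show ?case
    proof (rule Ctends_SucI)
      show "uniform_limit Q (\<lambda>x y. exp (u x y) - 1) (\<lambda>_. 0) F"
        using un Ctends_uniform[OF u'(1)] .
      fix i
      have "Ctends k Q S (\<lambda>x y. pd S i (u x) y * (exp (u x y) - 1) + pd S i (u x) y) F"
        using u u3 u' m by (intro Ctends_add Ctends_mult S Suc.IH)
      moreover have "\<forall>\<^sub>F x in F. \<forall>y\<in>S. pd S i (u x) y * (exp (u x y) - 1) + pd S i (u x) y = pd S i (\<lambda>y. exp (u x y) - 1) y"
        using Suc.prems(1)
      proof eventually_elim
        case (elim x)
        show ?case
        proof
          fix y assume y: "y \<in> S"
          have "((\<lambda>t. exp t - 1) has_real_derivative exp (u x y)) (at (u x y))"
            by (auto intro!: derivative_eq_intros)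
          from pd_compose(1)[OF S(1) y Cdiff_differentiable[OF elim y] this]
          show "pd S i (u x) y * (exp (u x y) - 1) + pd S i (u x) y = pd S i (\<lambda>y. exp (u x y) - 1) y"
            by (simp add: algebra_simps)
        qed
      qed
      ultimately show "Ctends k Q S (\<lambda>x. pd S i (\<lambda>y. exp (u x y) - 1)) F"
        by (rule Ctends_cong[OF S(2), rotated])
    qed
  qed
qed

lemma Ctends_cmult:
  assumes S: "corner S" and Q: "Q \<subseteq> K" "compact K" "K \<subseteq> S" and f: "Cdiff k S f" and a: "(a \<longlongrightarrow> 0) F"
  shows "Ctends k Q S (\<lambda>x y. a x * f y) F"
  using f
proof (induction k arbitrary: f)
  case 0
  have "compact (f ` K)" using 0 Q by (auto intro: compact_continuous_image continuous_on_subset)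
  then obtain B where "\<forall>x\<in>f ` K. norm x \<le> B" using compact_imp_bounded bounded_iff by blast
  then have B: "\<And>y. y \<in> Q \<Longrightarrow> \<bar>f y\<bar> \<le> B" using Q by auto
  have "uniform_limit Q (\<lambda>x y. a x) (\<lambda>_. 0) F"
    using a unfolding uniform_limit_iff tendsto_iff by (auto elim!: eventually_mono)
  then show ?case using uniform_limit_mult_bounded[OF _ B] by (simp add: mult.commute)
next
  case (Suc k)
  have "Ctends k Q S (\<lambda>x. pd S i (\<lambda>y. a x * f y)) F" for i
  proof (rule Ctends_cong)
    show "Ctends k Q S (\<lambda>x y. a x * pd S i f y) F" using Suc by simp
    show "\<forall>\<^sub>F x in F. \<forall>y\<in>S. a x * pd S i f y = pd S i (\<lambda>y. a x * f y) y"
      using Suc.prems by (auto simp: pd_mult S pd_const differentiable_on_def)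
  qed (use Q in auto)
  moreover have "uniform_limit Q (\<lambda>x y. a x * f y) (\<lambda>_. 0) F"
    using Suc.IH[OF Cdiff_SucD[OF Suc.prems]] Ctends_uniform by blast
  ultimately show ?case by simp
qed

lemma Ctends_zero: "corner S \<Longrightarrow> Q \<subseteq> S \<Longrightarrow> Ctends k Q S (\<lambda>x y. 0) F"
proof (induction k)
  case 0 then show ?case by (simp add: uniform_limit_iff)
next
  case (Suc k)
  have "Ctends k Q S (\<lambda>x. pd S i (\<lambda>y. 0)) F" for i
    by (rule Ctends_cong[OF Suc.prems(2) _ Suc.IH[OF Suc.prems]]) (simp add: pd_const Suc.prems)
  then show ?case by (simp add: uniform_limit_iff)
qed

lemma Ctends_sum:
  assumes S: "corner S" "Q \<subseteq> S" and "finite I" "\<And>i x. i \<in> I \<Longrightarrow> Cdiff k S (u i x)" "\<And>i. i \<in> I \<Longrightarrow> Ctends k Q S (u i) F"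
  shows "Ctends k Q S (\<lambda>x y. \<Sum>i\<in>I. u i x y) F"
  using assms(3-)
proof (induction I)
  case empty then show ?case using Ctends_zero[OF S] by simp
next
  case (insert i I)
  then show ?case
    by (simp, intro Ctends_add S) (auto intro!: Cdiff_sum S always_eventually)
qed


subsection \<open>Multi-indices\<close>

text \<open>The list picked by \<open>mpd\<close> is unknown, but its multiset is determined by the
  multi-index, so the list is a permutation of any other candidate.\<close>

lemma mpd_count_list:
  fixes S :: "(real^'n) set"
  shows "\<exists>is. mset is = mset js \<and> mpd S (count_list js) f = foldr (pd S) is f"
proof -
  let ?is = "SOME is. \<forall>i. count_list is i = count_list js i"
  have "\<forall>i. count_list ?is i = count_list js i"
    by (rule someI[of _ js]) simp
  then have "mset ?is = mset js" by (intro multiset_eqI) (simp add: count_mset)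
  then show ?thesis unfolding mpd_def by blast
qed

lemma ex_count_list:
  fixes \<alpha> :: "'n::finite \<Rightarrow> nat"
  obtains js where "\<alpha> = count_list js" "length js = sum \<alpha> UNIV"
proof -
  obtain js where js: "mset js = Abs_multiset \<alpha>" using ex_mset by blast
  have "count (Abs_multiset \<alpha>) = \<alpha>" by (simp add: count_Abs_multiset)
  then have "\<alpha> = count_list js" using js by (metis count_mset ext)
  moreover from this have "length js = sum \<alpha> UNIV" using sum_count_set[of js UNIV] by simp
  ultimately show ?thesis by (rule that)
qed

text \<open>The list depends on the set and the multi-index alone, so one list works for all
  functions at once; this makes additivity and limits of \<open>mpd\<close> accessible without
  commuting derivatives.\<close>

lemma mpd_foldr:
  fixes S :: "(real^'n) set"
  obtains "is" where "length is = sum \<alpha> UNIV" "\<And>f. mpd S \<alpha> f = foldr (pd S) is f"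
proof -
  obtain js where js: "\<alpha> = count_list js" "length js = sum \<alpha> UNIV" by (rule ex_count_list)
  let ?is = "SOME is. \<forall>i. count_list is i = \<alpha> i"
  have "\<forall>i. count_list ?is i = \<alpha> i"
    by (rule someI[of _ js]) (simp add: js)
  then have "mset ?is = mset js" by (intro multiset_eqI) (simp add: js count_mset)
  then have "length ?is = length js" by (rule mset_eq_length)
  then show ?thesis using js(2) by (intro that[of ?is]) (auto simp: mpd_def)
qed

lemma Cdiff_foldr: "Cdiff k S f \<Longrightarrow> length is \<le> k \<Longrightarrow> Cdiff (k - length is) S (foldr (pd S) is f)"
proof (induction "is")
  case (Cons i "is")
  then have "Cdiff (Suc (k - length (i # is))) S (foldr (pd S) is f)" by (simp add: Suc_diff_Suc)
  then show ?case using Cdiff_pd by simp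
qed simp

lemma Ctends_foldr:
  "Ctends k Q S u F \<Longrightarrow> length is \<le> k \<Longrightarrow> Ctends (k - length is) Q S (\<lambda>x. foldr (pd S) is (u x)) F"
proof (induction "is")
  case (Cons i "is")
  then have "Ctends (Suc (k - length (i # is))) Q S (\<lambda>x. foldr (pd S) is (u x)) F" by (simp add: Suc_diff_Suc)
  then show ?case by simp
qed simp

lemma Cdiff_mpd: "Cdiff k S f \<Longrightarrow> sum \<alpha> UNIV \<le> k \<Longrightarrow> continuous_on S (mpd S \<alpha> f)"
  by (rule mpd_foldr[of \<alpha> S]) (metis Cdiff_foldr Cdiff_continuous)

lemma Ctends_mpd: "Ctends k Q S u F \<Longrightarrow> sum \<alpha> UNIV \<le> k \<Longrightarrow> uniform_limit Q (\<lambda>x. mpd S \<alpha> (u x)) (\<lambda>_. 0) F"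
  by (rule mpd_foldr[of \<alpha> S]) (simp add: Ctends_uniform[OF Ctends_foldr])

lemma mpd_add:
  assumes S: "corner S" and f: "Cdiff k S f" "Cdiff k S g" "sum \<alpha> UNIV \<le> k" and y: "y \<in> S"
  shows "mpd S \<alpha> (\<lambda>y. f y + g y) y = mpd S \<alpha> f y + mpd S \<alpha> g y"
proof -
  have *: "length is \<le> k \<Longrightarrow> \<forall>y\<in>S. foldr (pd S) is (\<lambda>y. f y + g y) y = foldr (pd S) is f y + foldr (pd S) is g y" for "is"
  proof (induction "is")
    case (Cons i "is")
    show ?case
    proof
      fix y assume y: "y \<in> S"
      have *: "Suc (k - length (i # is)) = k - length is" using Cons.prems by (simp add: Suc_diff_Suc)
      have d: "foldr (pd S) is f differentiable (at y within S)" "foldr (pd S) is g differentiable (at y within S)"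
        using Cdiff_foldr[OF f(1), of "is"] Cdiff_foldr[OF f(2), of "is"] Cons.prems
        unfolding *[symmetric] by (auto intro: Cdiff_differentiable[OF _ y] simp del: Cdiff.simps)
      have "foldr (pd S) (i # is) (\<lambda>y. f y + g y) y = pd S i (\<lambda>y. foldr (pd S) is f y + foldr (pd S) is g y) y"
        unfolding foldr.simps o_def by (rule pd_cong[OF _ y]) (use Cons in auto)
      also have "\<dots> = foldr (pd S) (i # is) f y + foldr (pd S) (i # is) g y" using pd_add[OF S y d] by simp
      finally show "foldr (pd S) (i # is) (\<lambda>y. f y + g y) y = foldr (pd S) (i # is) f y + foldr (pd S) (i # is) g y" .
    qed
  qed simp
  obtain "is" where "length is = sum \<alpha> UNIV" "\<And>f. mpd S \<alpha> f = foldr (pd S) is f" using mpd_foldr[of \<alpha> S] by blast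
  then show ?thesis using * f(3) y by simp
qed

text \<open>Converse of \<open>Ctends_mpd\<close> in the order that matters for Hessians. Here the
  unknown order of two differentiations does matter, and \<open>pd_swap\<close> settles it.\<close>

lemma Ctends_2_mpd:
  fixes S :: "(real^'n) set"
  assumes S: "corner S" and Q: "Q \<subseteq> S" and u: "\<forall>\<^sub>F x in F. Cdiff 2 S (u x)"
    and lim: "\<And>\<alpha> :: 'n \<Rightarrow> nat. sum \<alpha> UNIV \<le> 2 \<Longrightarrow> uniform_limit Q (\<lambda>x. mpd S \<alpha> (u x)) (\<lambda>_. 0) F"
  shows "Ctends 2 Q S u F"
proof -
  have len: "sum (count_list js) UNIV = length js" for js :: "'n list"
    by (rule sum_count_set) auto
  have 0: "uniform_limit Q u (\<lambda>_. 0) F"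
  proof -
    have "mpd S (count_list []) f = f" for f :: "real^'n \<Rightarrow> real"
      using mpd_count_list[of "[]" S f] by auto
    then show ?thesis using lim[of "count_list []"] by (simp add: len[symmetric])
  qed
  have 1: "uniform_limit Q (\<lambda>x. pd S i (u x)) (\<lambda>_. 0) F" for i
  proof -
    have "mpd S (count_list [i]) f = pd S i f" for f
      using mpd_count_list[of "[i]" S f] by auto
    then show ?thesis using lim[of "count_list [i]"] by (simp only: len) simp
  qed
  have 2: "uniform_limit Q (\<lambda>x. pd S i (pd S j (u x))) (\<lambda>_. 0) F" for i j
  proof -
    have *: "\<forall>\<^sub>F x in F. \<forall>y\<in>Q. mpd S (count_list [i, j]) (u x) y = pd S i (pd S j (u x)) y"
      using u
    proof eventually_elim
      case (elim x)
      obtain js where js: "mset js = mset [i, j]" "mpd S (count_list [i, j]) (u x) = foldr (pd S) js (u x)"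
        using mpd_count_list[of "[i, j]"] by blast
      then have "length js = 2" using mset_eq_length by fastforce
      then obtain a b where "js = [a, b]" by (auto simp: length_Suc_conv numeral_2_eq_2)
      with js have "js = [i, j] \<or> js = [j, i]" by (auto simp: add_eq_conv_ex)
      then show ?case using js(2) pd_swap[OF S elim] Q by auto
    qed
    have "uniform_limit Q (\<lambda>x. mpd S (count_list [i, j]) (u x)) (\<lambda>_. 0) F"
      using lim[of "count_list [i, j]"] by (simp only: len) simp
    then show ?thesis using uniform_limit_cong[OF *] by blast
  qed
  show ?thesis using 0 1 2 by (simp add: numeral_2_eq_2)
qed

section \<open>Matrices\<close>

lemma matrix_inv_right_left:
  fixes A :: "real^'n^'n"
  assumes "invertible A"
  shows "A ** matrix_inv A = mat 1" "matrix_inv A ** A = mat 1"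
  using someI_ex[OF assms[unfolded invertible_def]] unfolding matrix_inv_def by auto

lemma matrix_inv_eq:
  fixes A :: "real^'n^'n"
  assumes "A ** B = mat 1"
  shows "matrix_inv A = B"
proof -
  have "invertible A" using assms invertible_right_inverse by blast
  then have "matrix_inv A ** (A ** B) = B"
    unfolding matrix_mul_assoc by (simp add: matrix_inv_right_left(2))
  then show ?thesis using assms by simp
qed

text \<open>Exhibits the entries of the inverse as quotients of determinants, from which regularity
  of an inverse matrix field follows.\<close>

lemma matrix_inv_cramer:
  fixes A :: "real^'n^'n"
  assumes "invertible A"
  shows "matrix_inv A $ k $ l = det (\<chi> i j. if j = k then (if i = l then 1 else 0) else A $ i $ j) / det A"
proof -
  have "A *v (matrix_inv A *v axis l 1) = axis l 1"
    using matrix_inv_right_left(1)[OF assms] by (simp add: matrix_vector_mul_assoc)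
  moreover have "det A \<noteq> 0" using assms invertible_det_nz by blast
  ultimately have "matrix_inv A *v axis l 1 = (\<chi> k. det (\<chi> i j. if j = k then axis l 1 $ i else A $ i $ j) / det A)"
    using cramer by blast
  then have "(matrix_inv A *v axis l 1) $ k = det (\<chi> i j. if j = k then axis l 1 $ i else A $ i $ j) / det A"
    by simp
  moreover have "(matrix_inv A *v axis l 1) $ k = matrix_inv A $ k $ l"
    by (simp add: matrix_vector_mult_basis column_def)
  moreover have "(axis l 1 :: real^'n) $ i = (if i = l then 1 else 0)" for i by (simp add: axis_def)
  ultimately show ?thesis by (simp cong: if_cong)
qed

lemma Cdiff_det:
  assumes "corner S" "\<And>i j. Cdiff k S (\<lambda>y. M y $ i $ j)"
  shows "Cdiff k S (\<lambda>y. det (M y :: real^'n^'n))"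
  unfolding det_def by (intro Cdiff_sum Cdiff_cmult Cdiff_prod assms)

lemma Cdiff_matrix_inv:
  fixes M :: "real^'m \<Rightarrow> real^'n^'n"
  assumes S: "corner S" and M: "\<And>i j. Cdiff k S (\<lambda>y. M y $ i $ j)" and inv: "\<And>y. y \<in> S \<Longrightarrow> invertible (M y)"
  shows "Cdiff k S (\<lambda>y. matrix_inv (M y) $ a $ b)"
proof -
  have "Cdiff k S (\<lambda>y. det (\<chi> i j. if j = a then (if i = b then 1 else 0) else M y $ i $ j) / det (M y))"
  proof (intro Cdiff_divide Cdiff_det S)
    show "Cdiff k S (\<lambda>y. (\<chi> i j. if j = a then (if i = b then 1 else 0) else M y $ i $ j) $ i $ j)" for i j
      using M[of i j] by (cases "j = a"; cases "i = b") (simp_all add: Cdiff_const S)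
  qed (use M inv invertible_det_nz in auto)
  then show ?thesis
    using Cdiff_cong[of S "\<lambda>y. matrix_inv (M y) $ a $ b"] matrix_inv_cramer[OF inv] by simp
qed

lemma matrix_inv_scaleR:
  fixes A :: "real^'n^'n"
  assumes "invertible A" "c \<noteq> 0"
  shows "matrix_inv (c *\<^sub>R A) = inverse c *\<^sub>R matrix_inv A"
proof (rule matrix_inv_eq)
  have "c *\<^sub>R A ** inverse c *\<^sub>R matrix_inv A = (inverse c * c) *\<^sub>R (A ** matrix_inv A)"
    unfolding matrix_scalar_ac scalar_matrix_assoc by simp
  then show "c *\<^sub>R A ** inverse c *\<^sub>R matrix_inv A = mat 1"
    using assms by (simp add: matrix_inv_right_left)
qed

text \<open>Transformation law of the inverse metric; \<open>J\<close> and \<open>K\<close> stand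
  for the Jacobians of a transition map and of its inverse.\<close>

lemma matrix_inv_congruence:
  fixes G J K :: "real^'n^'n"
  assumes "invertible G" "J ** K = mat 1"
  shows "matrix_inv (transpose J ** G ** J) = K ** matrix_inv G ** transpose K"
proof (rule matrix_inv_eq)
  have *: "transpose J ** transpose K = mat 1"
    unfolding matrix_transpose_mul[symmetric] using assms(2) matrix_left_right_inverse[of J K] by (simp add: transpose_mat)
  have "transpose J ** G ** J ** (K ** matrix_inv G ** transpose K)
      = transpose J ** (G ** ((J ** K) ** matrix_inv G)) ** transpose K"
    by (simp only: matrix_mul_assoc)
  also have "\<dots> = mat 1" using assms(1) * by (simp add: assms(2) matrix_inv_right_left)
  finally show "transpose J ** G ** J ** (K ** matrix_inv G ** transpose K) = mat 1" .
qed

section \<open>Positive definite matrices\<close>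

definition pos_def :: "real^'n^'n \<Rightarrow> bool" where
  "pos_def A \<longleftrightarrow> transpose A = A \<and> (\<forall>v. v \<noteq> 0 \<longrightarrow> v \<bullet> (A *v v) > 0)"

lemma transpose_entry: "transpose A = A \<Longrightarrow> A $ i $ j = A $ j $ i"
  by (metis transpose_def vec_lambda_beta)

lemma pos_def_sym: "pos_def A \<Longrightarrow> A $ i $ j = A $ j $ i"
  unfolding pos_def_def using transpose_entry by blast

lemma pos_def_invertible:
  assumes "pos_def A"
  shows "invertible A"
proof -
  have "\<forall>x. A *v x = 0 \<longrightarrow> x = 0"
    using assms unfolding pos_def_def by (metis inner_zero_right less_irrefl)
  then show ?thesis
    by (simp add: invertible_left_inverse matrix_left_invertible_ker)
qed

lemma pos_def_diag:
  assumes "pos_def A"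
  shows "A $ i $ i > 0"
proof -
  have "axis i 1 \<bullet> (A *v axis i 1) > 0"
    using assms unfolding pos_def_def by (metis axis_eq_0_iff zero_neq_one)
  then show ?thesis by (simp add: matrix_vector_mult_basis inner_axis' column_def)
qed

lemma pos_def_matrix_inv:
  assumes "pos_def A"
  shows "pos_def (matrix_inv A)"
  unfolding pos_def_def
proof (intro conjI allI impI)
  note inv = pos_def_invertible[OF assms]
  have "A ** transpose (matrix_inv A) = transpose (matrix_inv A ** A)"
    using assms by (simp add: matrix_transpose_mul pos_def_def)
  also have "\<dots> = mat 1" using matrix_inv_right_left(2)[OF inv] by (simp add: transpose_mat)
  finally show "transpose (matrix_inv A) = matrix_inv A"
    by (rule matrix_inv_eq[symmetric])
  fix v :: "real^'a" assume v: "v \<noteq> 0"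
  let ?w = "matrix_inv A *v v"
  have Aw: "A *v ?w = v" by (simp add: matrix_vector_mul_assoc matrix_inv_right_left inv)
  then have "?w \<noteq> 0" using v by auto
  then have "?w \<bullet> (A *v ?w) > 0" using assms pos_def_def by blast
  then show "v \<bullet> ?w > 0" unfolding Aw by (simp add: inner_commute)
qed

lemma inner_matrix_vector_sum: "(v :: real^'n) \<bullet> (A *v v) = (\<Sum>i\<in>UNIV. \<Sum>k\<in>UNIV. A $ i $ k * v $ i * v $ k)"
  unfolding inner_vec_def matrix_vector_mult_def vec_lambda_beta inner_real_def sum_distrib_left
  by (intro sum.cong refl) simp

text \<open>Completing the square in one variable leaves a quadratic form in the remaining ones that
  is again positive, so the factorization is built by induction on the index set.\<close>

lemma ex_cholesky:
  fixes P :: "'n \<Rightarrow> 'n \<Rightarrow> real"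
  assumes "finite I" "\<And>i k. P i k = P k i"
    "\<And>x. (\<exists>i\<in>I. x i \<noteq> 0) \<Longrightarrow> (\<Sum>i\<in>I. \<Sum>k\<in>I. P i k * x i * x k) > 0"
  shows "\<exists>R. \<forall>i\<in>I. \<forall>k\<in>I. P i k = (\<Sum>r\<in>I. R r i * R r k)"
  using assms
proof (induction I arbitrary: P)
  case (insert a I)
  have quad: "(\<Sum>i\<in>insert a I. \<Sum>k\<in>insert a I. P i k * x i * x k)
      = P a a * x a * x a + 2 * x a * (\<Sum>k\<in>I. P a k * x k) + (\<Sum>i\<in>I. \<Sum>k\<in>I. P i k * x i * x k)" for x
  proof -
    have 1: "(\<Sum>k\<in>I. P a k * x a * x k) = x a * (\<Sum>k\<in>I. P a k * x k)"
      unfolding sum_distrib_left by (intro sum.cong refl) simp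
    have 2: "(\<Sum>i\<in>I. P i a * x i * x a) = x a * (\<Sum>k\<in>I. P a k * x k)"
      unfolding sum_distrib_left insert.prems(1)[of _ a] by (intro sum.cong refl) simp
    show ?thesis using insert.hyps by (simp add: sum.distrib 1 2)
  qed
  have Paa: "P a a > 0"
    using insert.prems(2)[of "\<lambda>i. if i = a then 1 else 0"] insert.hyps unfolding quad
    by (simp add: if_distrib[of "\<lambda>x. _ * x"] sum.neutral cong: if_cong)
  \<comment> \<open>The Schur complement of the entry \<open>P a a\<close>.\<close>
  define P' where "P' i k = P i k - P a i * P a k / P a a" for i k
  have "\<exists>R. \<forall>i\<in>I. \<forall>k\<in>I. P' i k = (\<Sum>r\<in>I. R r i * R r k)"
  proof (rule insert.IH)
    show "P' i k = P' k i" for i k using insert.prems(1)[of i k] by (simp add: P'_def)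
    fix x :: "'n \<Rightarrow> real" assume x: "\<exists>i\<in>I. x i \<noteq> 0"
    define b where "b = (\<Sum>k\<in>I. P a k * x k)"
    \<comment> \<open>The value at \<open>a\<close> minimizes the quadratic form in that variable;
      the minimum is the form of the Schur complement at \<open>x\<close>.\<close>
    define y where "y = x(a := - b / P a a)"
    have y: "y i = x i" if "i \<in> I" for i using that insert.hyps by (auto simp: y_def)
    have "0 < (\<Sum>i\<in>insert a I. \<Sum>k\<in>insert a I. P i k * y i * y k)"
      using x y by (intro insert.prems(2)) auto
    also have "\<dots> = (\<Sum>i\<in>I. \<Sum>k\<in>I. P i k * x i * x k) - b * b / P a a"
      using Paa unfolding quad by (simp add: y y_def[THEN fun_cong, of a] b_def[symmetric] cong: sum.cong)
    also have "b * b / P a a = (\<Sum>i\<in>I. \<Sum>k\<in>I. P a i * P a k / P a a * x i * x k)"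
      unfolding b_def sum_product by (simp add: sum_divide_distrib mult_ac)
    finally show "0 < (\<Sum>i\<in>I. \<Sum>k\<in>I. P' i k * x i * x k)"
      by (simp add: P'_def left_diff_distrib sum_subtractf)
  qed
  then obtain R where R: "\<And>i k. i \<in> I \<Longrightarrow> k \<in> I \<Longrightarrow> P' i k = (\<Sum>r\<in>I. R r i * R r k)" by blast
  \<comment> \<open>The new row accounts for the completed square; the old rows are extended by
    \<open>0\<close> in column \<open>a\<close>.\<close>
  define Q where "Q r i = (if r = a then P a i / sqrt (P a a) else if i = a then 0 else R r i)" for r i
  have *: "(\<Sum>r\<in>I. Q r i * Q r k) = (if i = a \<or> k = a then 0 else P' i k)" if "i \<in> insert a I" "k \<in> insert a I" for i k
  proof -
    have "(\<Sum>r\<in>I. Q r i * Q r k) = (\<Sum>r\<in>I. if i = a \<or> k = a then 0 else R r i * R r k)"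
      using insert.hyps by (intro sum.cong) (auto simp: Q_def)
    then show ?thesis using R that by auto
  qed
  have "P i k = (\<Sum>r\<in>insert a I. Q r i * Q r k)" if "i \<in> insert a I" "k \<in> insert a I" for i k
  proof -
    have "Q a i * Q a k = P a i * P a k / P a a"
      using Paa by (simp add: Q_def real_sqrt_mult[symmetric] flip: power2_eq_square)
    moreover have "P i a = P a i" using insert.prems(1) .
    ultimately show ?thesis
      using *[OF that] Paa insert.hyps by (auto simp: P'_def)
  qed
  then show ?case by blast
qed auto

text \<open>With \<open>P\<close> factored as the transpose of \<open>R\<close> times
  \<open>R\<close>, the contraction is the sum over the rows of \<open>R h\<close> of the quadratic
  form of \<open>P\<close>. Since \<open>R\<close> is injective, some row is nonzero.\<close>

lemma pos_def_contraction_pos: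
  fixes P h :: "real^'n^'n"
  assumes P: "pos_def P" and "h \<noteq> 0"
  shows "(\<Sum>i\<in>UNIV. \<Sum>j\<in>UNIV. \<Sum>k\<in>UNIV. \<Sum>l\<in>UNIV. P $ i $ k * P $ j $ l * h $ i $ j * h $ k $ l) > 0"
proof -
  have pos: "(\<Sum>i\<in>UNIV. \<Sum>k\<in>UNIV. P $ i $ k * x i * x k) > 0" if "\<exists>i. x i \<noteq> 0" for x :: "'n \<Rightarrow> real"
    using P that inner_matrix_vector_sum[of "\<chi> i. x i" P] unfolding pos_def_def
    by (auto simp: vec_eq_iff dest!: spec[of _ "\<chi> i. x i"])
  obtain R :: "'n \<Rightarrow> 'n \<Rightarrow> real" where R: "P $ i $ k = (\<Sum>r\<in>UNIV. R r i * R r k)" for i k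
  proof -
    have "\<exists>R :: 'n \<Rightarrow> 'n \<Rightarrow> real. \<forall>i\<in>UNIV. \<forall>k\<in>UNIV. P $ i $ k = (\<Sum>r\<in>UNIV. R r i * R r k)"
      by (rule ex_cholesky[of UNIV "\<lambda>i k. P $ i $ k"]) (use pos pos_def_sym[OF P] in auto)
    then show ?thesis using that by auto
  qed
  have quad: "(\<Sum>i\<in>UNIV. \<Sum>k\<in>UNIV. P $ i $ k * x i * y k) = (\<Sum>r\<in>UNIV. (\<Sum>i\<in>UNIV. R r i * x i) * (\<Sum>k\<in>UNIV. R r k * y k))" for x y
  proof -
    have "(\<Sum>i\<in>UNIV. \<Sum>k\<in>UNIV. P $ i $ k * x i * y k) = (\<Sum>i\<in>UNIV. \<Sum>k\<in>UNIV. \<Sum>r\<in>UNIV. (R r i * x i) * (R r k * y k))"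
      unfolding R sum_distrib_right by (intro sum.cong refl) simp
    also have "\<dots> = (\<Sum>i\<in>UNIV. \<Sum>r\<in>UNIV. \<Sum>k\<in>UNIV. (R r i * x i) * (R r k * y k))"
      by (intro sum.cong refl sum.swap)
    also have "\<dots> = (\<Sum>r\<in>UNIV. \<Sum>i\<in>UNIV. \<Sum>k\<in>UNIV. (R r i * x i) * (R r k * y k))"
      by (rule sum.swap)
    finally show ?thesis unfolding sum_product .
  qed
  \<comment> \<open>A vector killed by all rows of \<open>R\<close> has vanishing quadratic form,
    because \<open>quad\<close> writes the form as a sum of squares.\<close>
  have R0: "x i = 0" if "\<And>r. (\<Sum>i\<in>UNIV. R r i * x i) = 0" for x i
  proof (rule ccontr)
    assume "x i \<noteq> 0"
    then have "0 < (\<Sum>i\<in>UNIV. \<Sum>k\<in>UNIV. P $ i $ k * x i * x k)" using pos by blast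
    then show False unfolding quad that by simp
  qed
  define a where "a r j = (\<Sum>i\<in>UNIV. R r i * h $ i $ j)" for r j
  obtain i j where "h $ i $ j \<noteq> 0" using \<open>h \<noteq> 0\<close> by (metis vec_eq_iff zero_index)
  then obtain r where r: "a r j \<noteq> 0" using R0[of "\<lambda>i. h $ i $ j"] unfolding a_def by blast
  have nonneg: "(\<Sum>j\<in>UNIV. \<Sum>l\<in>UNIV. P $ j $ l * x j * x l) \<ge> 0" for x
    unfolding quad by (rule sum_nonneg) simp
  have "0 < (\<Sum>j\<in>UNIV. \<Sum>l\<in>UNIV. P $ j $ l * a r j * a r l)" using r by (intro pos) auto
  also have "\<dots> \<le> (\<Sum>r\<in>UNIV. \<Sum>j\<in>UNIV. \<Sum>l\<in>UNIV. P $ j $ l * a r j * a r l)"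
    by (rule member_le_sum) (auto intro: nonneg)
  also have "\<dots> = (\<Sum>j\<in>UNIV. \<Sum>r\<in>UNIV. \<Sum>l\<in>UNIV. P $ j $ l * a r j * a r l)" by (rule sum.swap)
  also have "\<dots> = (\<Sum>j\<in>UNIV. \<Sum>l\<in>UNIV. \<Sum>r\<in>UNIV. P $ j $ l * a r j * a r l)" by (intro sum.cong refl sum.swap)
  also have "\<dots> = (\<Sum>j\<in>UNIV. \<Sum>l\<in>UNIV. P $ j $ l * (\<Sum>i\<in>UNIV. \<Sum>k\<in>UNIV. P $ i $ k * h $ i $ j * h $ k $ l))"
    unfolding quad a_def[symmetric] sum_distrib_left by (intro sum.cong refl) simp
  also have "\<dots> = (\<Sum>j\<in>UNIV. \<Sum>l\<in>UNIV. \<Sum>i\<in>UNIV. \<Sum>k\<in>UNIV. P $ i $ k * P $ j $ l * h $ i $ j * h $ k $ l)"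
    unfolding sum_distrib_left by (intro sum.cong refl) simp
  also have "\<dots> = (\<Sum>j\<in>UNIV. \<Sum>i\<in>UNIV. \<Sum>l\<in>UNIV. \<Sum>k\<in>UNIV. P $ i $ k * P $ j $ l * h $ i $ j * h $ k $ l)"
    by (intro sum.cong refl sum.swap)
  also have "\<dots> = (\<Sum>j\<in>UNIV. \<Sum>i\<in>UNIV. \<Sum>k\<in>UNIV. \<Sum>l\<in>UNIV. P $ i $ k * P $ j $ l * h $ i $ j * h $ k $ l)"
    by (intro sum.cong refl sum.swap)
  also have "\<dots> = (\<Sum>i\<in>UNIV. \<Sum>j\<in>UNIV. \<Sum>k\<in>UNIV. \<Sum>l\<in>UNIV. P $ i $ k * P $ j $ l * h $ i $ j * h $ k $ l)"
    by (rule sum.swap)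
  finally show ?thesis .
qed

section \<open>Sard's theorem for an arbitrary finite index type\<close>

text \<open>The library's Sard theorem needs a well-ordered index type; this copy of the index type carries
  an arbitrary well-order.\<close>

typedef 'b wo = "UNIV :: 'b set" by simp

lemma bij_Rep_wo: "bij (Rep_wo :: 'b wo \<Rightarrow> 'b)"
  using type_definition.Abs_inverse[OF type_definition_wo] type_definition.Rep_inverse[OF type_definition_wo]
  by (metis UNIV_I bij_def inj_on_def surjI)

instance wo :: (finite) finite
proof
  show "finite (UNIV :: 'a wo set)" using bij_betw_finite[OF bij_Rep_wo] finite[of "UNIV :: 'a set"] by blast
qed

definition wo_nat :: "'b::finite wo \<Rightarrow> nat" where "wo_nat = (SOME f. inj f)"

lemma inj_wo_nat: "inj wo_nat"
proof -
  have "\<exists>f :: 'a wo \<Rightarrow> nat. inj f"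
    using finite_imp_inj_to_nat_seg[OF finite[of "UNIV :: 'a wo set"]] by auto
  then show ?thesis unfolding wo_nat_def by (rule someI_ex)
qed

instantiation wo :: (finite) wellorder
begin
definition "x \<le> y \<longleftrightarrow> wo_nat x \<le> wo_nat y" for x y :: "'a wo"
definition "x < y \<longleftrightarrow> wo_nat x < wo_nat y" for x y :: "'a wo"
instance
proof
  fix P :: "'a wo \<Rightarrow> bool" and a :: "'a wo"
  assume *: "\<And>x. (\<And>y. y < x \<Longrightarrow> P y) \<Longrightarrow> P x"
  show "P a"
    by (induction a rule: measure_induct_rule[of wo_nat]) (rule *, simp add: less_wo_def)
qed (auto simp: less_eq_wo_def less_wo_def dest: injD[OF inj_wo_nat])
end

text \<open>The critical values form a negligible set, which contains no ball. The maps \<phi> and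
  \<psi> merely relabel coordinates to reach the well-ordered index type and return.\<close>

lemma Sard_finite:
  fixes f :: "real^'b::finite \<Rightarrow> real^'b"
  assumes f: "\<And>x. x \<in> T \<Longrightarrow> (f has_derivative f' x) (at x within T)"
    and crit: "\<And>x. x \<in> T \<Longrightarrow> \<not> inj (f' x)" and e: "e > 0"
  obtains a where "norm a < e" "a \<notin> f ` T"
proof -
  define \<phi> :: "real^'b wo \<Rightarrow> real^'b" where "\<phi> v = (\<chi> i. v $ Abs_wo i)" for v
  define \<psi> :: "real^'b \<Rightarrow> real^'b wo" where "\<psi> v = (\<chi> i. v $ Rep_wo i)" for v
  have inv: "\<phi> (\<psi> v) = v" "\<psi> (\<phi> u) = u" for u v
    by (auto simp: \<phi>_def \<psi>_def vec_eq_iff Rep_wo_inverse Abs_wo_inverse)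
  have lin: "linear \<phi>" "linear \<psi>"
    by (auto intro!: linearI simp: \<phi>_def \<psi>_def vec_eq_iff)
  have bl: "bounded_linear \<phi>" "bounded_linear \<psi>" using lin linear_conv_bounded_linear by auto
  let ?S = "\<phi> -` T"
  have "negligible ((\<lambda>x. \<psi> (f (\<phi> x))) ` ?S)"
  proof (rule baby_Sard)
    fix x assume x: "x \<in> ?S"
    have "(f has_derivative f' (\<phi> x)) (at (\<phi> x) within \<phi> ` ?S)"
      using f[of "\<phi> x"] x by (auto intro: has_derivative_subset)
    from has_derivative_in_compose[OF bounded_linear_imp_has_derivative[OF bl(1)] this]
    have "((\<lambda>x. f (\<phi> x)) has_derivative (\<lambda>v. f' (\<phi> x) (\<phi> v))) (at x within ?S)" .
    from bounded_linear.has_derivative[OF bl(2) this]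
    show D: "((\<lambda>x. \<psi> (f (\<phi> x))) has_derivative (\<lambda>v. \<psi> (f' (\<phi> x) (\<phi> v)))) (at x within ?S)" .
    have "\<not> inj (\<lambda>v. \<psi> (f' (\<phi> x) (\<phi> v)))"
    proof
      assume "inj (\<lambda>v. \<psi> (f' (\<phi> x) (\<phi> v)))"
      then have "inj (f' (\<phi> x))" unfolding inj_def by (metis inv(1))
      then show False using crit x by auto
    qed
    then show "rank (matrix (\<lambda>v. \<psi> (f' (\<phi> x) (\<phi> v)))) < CARD('b wo)"
      using has_derivative_linear[OF D] by (simp add: less_rank_noninjective)
  qed simp
  moreover have "open (\<phi> -` ball 0 e)"
    using bl(1) by (intro open_vimage linear_continuous_on) auto
  moreover have "0 \<in> \<phi> -` ball 0 e" using e lin(1) by (simp add: linear_0)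
  ultimately have "\<not> \<phi> -` ball 0 e \<subseteq> (\<lambda>x. \<psi> (f (\<phi> x))) ` ?S"
    using open_not_negligible negligible_subset by blast
  then obtain a where a: "\<phi> a \<in> ball 0 e" "a \<notin> (\<lambda>x. \<psi> (f (\<phi> x))) ` ?S" by blast
  have "\<phi> a \<notin> f ` T"
  proof
    assume "\<phi> a \<in> f ` T"
    then obtain x where "x \<in> T" "\<phi> a = f x" by blast
    then have "a = \<psi> (f (\<phi> (\<psi> x)))" "\<psi> x \<in> ?S" using inv by (auto, metis)
    then show False using a(2) by blast
  qed
  then show ?thesis using a(1) that[of "\<phi> a"] by simp
qed


section \<open>Degenerate critical points\<close>

definition hess :: "(real^'n) set \<Rightarrow> (real^'n \<Rightarrow> real) \<Rightarrow> real^'n \<Rightarrow> real^'n^'n" where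
  "hess S w z = (\<chi> i j. pd S i (pd S j w) z)"

text \<open>Being critical and being degenerate are joined in one predicate: its negation is the
  Morse condition at a single point, and it is a closed condition on 2-jets.\<close>

definition degen :: "(real^'n) set \<Rightarrow> (real^'n \<Rightarrow> real) \<Rightarrow> real^'n \<Rightarrow> bool" where
  "degen S w z \<longleftrightarrow> (\<forall>i. pd S i w z = 0) \<and> \<not> invertible (hess S w z)"

text \<open>Sard's theorem is applied to the gradient map on the points with singular Hessian.
  Subtracting from \<open>w\<close> the linear form with coefficients \<open>a\<close> then leaves
  no degenerate critical point, by \<open>degen_add_linear\<close>.\<close>

lemma ex_small_regular_gradient:
  fixes S :: "(real^'b::finite) set"
  assumes S: "open S" and w: "Cdiff 2 S w" and e: "e > 0"
  obtains a :: "real^'b" where "norm a < e" "\<And>z. z \<in> S \<Longrightarrow> (\<forall>i. pd S i w z = a $ i) \<Longrightarrow> invertible (hess S w z)"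
proof -
  let ?g = "\<lambda>z. \<chi> i. pd S i w z"
  let ?T = "{z \<in> S. \<not> invertible (hess S w z)}"
  let ?g' = "\<lambda>z v. \<chi> j. \<Sum>i\<in>UNIV. v $ i * pd S i (pd S j w) z"
  have g: "(?g has_derivative ?g' z) (at z within S)" if "z \<in> S" for z
  proof -
    have "Cdiff (Suc 0) S (pd S j w)" for j using w by (simp add: numeral_2_eq_2)
    then have "((\<lambda>z. pd S j w z) has_derivative (\<lambda>v. \<Sum>i\<in>UNIV. v $ i * pd S i (pd S j w) z)) (at z within S)" for j
      using Cdiff_differentiable has_derivative_pd that by blast
    then show ?thesis
      unfolding has_derivative_componentwise_within[of ?g] by (auto simp: Basis_vec_def inner_axis)
  qed
  obtain a where a: "norm a < e" "a \<notin> ?g ` ?T"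
  proof (rule Sard_finite[OF _ _ e])
    fix z assume z: "z \<in> ?T"
    then show "(?g has_derivative ?g' z) (at z within ?T)"
      using g[of z] by (auto intro: has_derivative_subset)
    \<comment> \<open>The outer derivative is the first index of \<open>hess\<close>, whence the
      transpose; invertibility is not affected by it.\<close>
    have "?g' z = (*v) (transpose (hess S w z))"
      by (auto simp: hess_def transpose_def matrix_vector_mult_def vec_eq_iff mult.commute)
    then show "\<not> inj (?g' z)"
      using z by (simp add: matrix_left_invertible_injective[symmetric] invertible_left_inverse[symmetric] invertible_det_nz)
  qed
  show ?thesis
  proof (rule that[OF a(1)])
    fix z assume z: "z \<in> S" "\<forall>i. pd S i w z = a $ i"
    then have "a = (\<chi> i. pd S i w z)" by (simp add: vec_eq_iff)
    then show "invertible (hess S w z)" using a(2) z(1) by blast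
  qed
qed

lemma degen_cong:
  assumes "\<And>z. z \<in> S \<Longrightarrow> w z = w' z" "z \<in> S"
  shows "degen S w z \<longleftrightarrow> degen S w' z"
proof -
  have "pd S i w z = pd S i w' z" if "z \<in> S" for i z by (rule pd_cong[OF assms(1) that])
  then have "hess S w z = hess S w' z" "\<And>i. pd S i w z = pd S i w' z"
    using assms(2) by (auto simp: hess_def vec_eq_iff intro: pd_cong)
  then show ?thesis by (simp add: degen_def)
qed

lemma degen_openin:
  assumes "openin (top_of_set S) U" "z \<in> U"
  shows "degen U w z \<longleftrightarrow> degen S w z"
proof -
  have "pd U i (pd U j w) z = pd S i (pd S j w) z" for i j
    using pd_cong[of U "pd U j w" "pd S j w"] pd_subset[OF assms(1)] assms(2) by metis
  then show ?thesis using assms by (simp add: degen_def hess_def pd_subset[OF assms(1)])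
qed

text \<open>At a critical point the product of gradients drops out of the Hessian of the composite,
  and a nonzero multiple of the Hessian of \<open>u\<close> is left. The case \<open>c = -1\<close>
  serves the squared norm, \<open>c = 1\<close> its reciprocal.\<close>

lemma degen_exp:
  assumes S: "corner S" and u: "Cdiff 2 S u" and z: "z \<in> S" and c: "c \<noteq> 0"
  shows "degen S (\<lambda>z. exp (c * u z)) z \<longleftrightarrow> degen S u z"
proof -
  have u2: "Cdiff (Suc (Suc 0)) S u" using u by (simp add: numeral_2_eq_2)
  have du: "u differentiable (at y within S)" "pd S j u differentiable (at y within S)" if "y \<in> S" for y j
    using Cdiff_differentiable[OF u2 that] Cdiff_differentiable[OF Cdiff_pd[OF u2] that] by auto
  have "((\<lambda>t. exp (c * t)) has_real_derivative c * exp (c * u y)) (at (u y))" for y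
    by (auto intro!: derivative_eq_intros)
  from pd_compose[OF S _ du(1) this]
  have 1: "pd S i (\<lambda>z. exp (c * u z)) y = c * exp (c * u y) * pd S i u y"
    and d: "(\<lambda>z. exp (c * u z)) differentiable (at y within S)" if "y \<in> S" for y i using that by auto
  have 2: "pd S i (pd S j (\<lambda>z. exp (c * u z))) z = c * exp (c * u z) * pd S i (pd S j u) z"
    if "\<forall>i. pd S i u z = 0" for i j
  proof -
    have "pd S i (pd S j (\<lambda>z. exp (c * u z))) z = pd S i (\<lambda>z. exp (c * u z) * (c * pd S j u z)) z"
      by (rule pd_cong[OF _ z]) (simp add: 1)
    also have "\<dots> = exp (c * u z) * pd S i (\<lambda>z. c * pd S j u z) z"
      using that by (subst pd_mult[OF S z d[OF z]]) (auto intro!: differentiable_mult du z)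
    also have "pd S i (\<lambda>z. c * pd S j u z) z = c * pd S i (pd S j u) z"
      by (subst pd_mult[OF S z]) (auto simp: pd_const[OF S z] du z)
    finally show ?thesis by simp
  qed
  show ?thesis
  proof (cases "\<forall>i. pd S i u z = 0")
    case True
    define k where "k = c * exp (c * u z)"
    have "k \<noteq> 0" using c by (simp add: k_def)
    have "hess S (\<lambda>z. exp (c * u z)) z = k *\<^sub>R hess S u z"
      using True by (simp add: hess_def vec_eq_iff 2 k_def)
    then have "invertible (hess S (\<lambda>z. exp (c * u z)) z) \<longleftrightarrow> invertible (hess S u z)"
      using \<open>k \<noteq> 0\<close> scalar_invertible[of k "hess S u z"]
        scalar_invertible[of "inverse k" "k *\<^sub>R hess S u z"] by auto
    then show ?thesis using True by (simp add: degen_def 1 z)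
  qed (use c z in \<open>auto simp: degen_def 1\<close>)
qed

text \<open>At a critical point the second derivatives of \<sigma> are multiplied by the vanishing
  gradient, so the Hessian changes by a congruence; a product with a singular factor is
  singular.\<close>

lemma degen_chain:
  fixes \<sigma> :: "real^'n \<Rightarrow> real^'n"
  assumes S: "corner S" and T: "corner T" and \<sigma>: "\<And>a. Cdiff 2 S (\<lambda>y. \<sigma> y $ a)" "\<sigma> ` S \<subseteq> T" and w: "Cdiff 2 T w"
    and z: "z \<in> S" and deg: "degen T w (\<sigma> z)"
  shows "degen S (\<lambda>z. w (\<sigma> z)) z"
proof -
  have w2: "Cdiff (Suc (Suc 0)) T w" and s2: "Cdiff (Suc (Suc 0)) S (\<lambda>y. \<sigma> y $ a)" for a
    using w \<sigma>(1)[of a] by (simp_all add: numeral_2_eq_2)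
  have sT: "\<sigma> y \<in> T" if "y \<in> S" for y using that \<sigma>(2) by blast
  have ds: "(\<lambda>y. \<sigma> y $ a) differentiable (at y within S)" "pd S i (\<lambda>y. \<sigma> y $ a) differentiable (at y within S)" if "y \<in> S" for y a i
    using Cdiff_differentiable[OF s2 that] Cdiff_differentiable[OF Cdiff_pd[OF s2] that] by auto
  have dw: "w differentiable (at y within T)" "pd T i w differentiable (at y within T)" if "y \<in> T" for y i
    using Cdiff_differentiable[OF w2 that] Cdiff_differentiable[OF Cdiff_pd[OF w2] that] by auto
  have 1: "pd S i (\<lambda>z. w (\<sigma> z)) y = (\<Sum>a\<in>UNIV. pd T a w (\<sigma> y) * pd S i (\<lambda>y. \<sigma> y $ a) y)" if "y \<in> S" for y i
    by (rule pd_chain(1)[OF S that ds(1)[OF that] dw(1)[OF sT[OF that]] \<sigma>(2)])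
  have g0: "pd T a w (\<sigma> z) = 0" for a using deg by (simp add: degen_def)
  let ?K = "\<chi> a i. pd S i (\<lambda>y. \<sigma> y $ a) z"
  have 2: "pd S i (pd S j (\<lambda>z. w (\<sigma> z))) z
      = (\<Sum>a\<in>UNIV. (\<Sum>b\<in>UNIV. pd T b (pd T a w) (\<sigma> z) * pd S i (\<lambda>y. \<sigma> y $ b) z) * pd S j (\<lambda>y. \<sigma> y $ a) z)" for i j
  proof -
    have c: "pd S i (\<lambda>y. pd T a w (\<sigma> y)) z = (\<Sum>b\<in>UNIV. pd T b (pd T a w) (\<sigma> z) * pd S i (\<lambda>y. \<sigma> y $ b) z)"
      "(\<lambda>y. pd T a w (\<sigma> y)) differentiable (at z within S)" for a
      by (rule pd_chain[OF S z ds(1)[OF z] dw(2)[OF sT[OF z]] \<sigma>(2)])+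
    have "pd S i (pd S j (\<lambda>z. w (\<sigma> z))) z = pd S i (\<lambda>y. \<Sum>a\<in>UNIV. pd T a w (\<sigma> y) * pd S j (\<lambda>y. \<sigma> y $ a) y) z"
      by (rule pd_cong[OF _ z]) (simp add: 1)
    also have "\<dots> = (\<Sum>a\<in>UNIV. pd S i (\<lambda>y. pd T a w (\<sigma> y) * pd S j (\<lambda>y. \<sigma> y $ a) y) z)"
      by (rule pd_sum[OF S z]) (auto intro!: differentiable_mult c ds z)
    also have "\<dots> = (\<Sum>a\<in>UNIV. pd S i (\<lambda>y. pd T a w (\<sigma> y)) z * pd S j (\<lambda>y. \<sigma> y $ a) z)"
      by (intro sum.cong refl) (subst pd_mult[OF S z c(2) ds(2)[OF z]], simp add: g0)
    finally show ?thesis unfolding c(1) .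
  qed
  have "hess S (\<lambda>z. w (\<sigma> z)) z = transpose ?K ** hess T w (\<sigma> z) ** ?K"
    unfolding hess_def vec_eq_iff matrix_matrix_mult_def transpose_def
    by (simp add: 2 mult.commute)
  moreover have "\<not> invertible (hess T w (\<sigma> z))" using deg by (simp add: degen_def)
  ultimately have "\<not> invertible (hess S (\<lambda>z. w (\<sigma> z)) z)"
    unfolding invertible_det_nz by (simp add: det_mul)
  moreover have "pd S i (\<lambda>z. w (\<sigma> z)) z = 0" for i using 1[OF z] g0 by simp
  ultimately show ?thesis by (simp add: degen_def)
qed

lemma closed_degenerate_jets:
  "closed {(v :: real^'n, H :: real^'n^'n). v = 0 \<and> \<not> invertible H}"
proof -
  have "continuous_on UNIV (\<lambda>p :: (real^'n) \<times> (real^'n^'n). det (snd p))"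
    unfolding det_def by (intro continuous_intros)
  then have "closed {p :: (real^'n) \<times> (real^'n^'n). fst p = 0 \<and> det (snd p) = 0}"
    by (intro closed_Collect_conj closed_Collect_eq continuous_intros)
  moreover have "{(v :: real^'n, H :: real^'n^'n). v = 0 \<and> \<not> invertible H} = {p. fst p = 0 \<and> det (snd p) = 0}"
    by (auto simp: invertible_det_nz)
  ultimately show ?thesis by simp
qed

text \<open>The 2-jets of \<open>w\<close> over the compact set \<open>K\<close> form a compact set
  disjoint from the closed set of degenerate jets. Their positive distance tolerates a uniformly
  small error in the 2-jet.\<close>

lemma not_degen_stable:
  fixes S :: "(real^'n) set"
  assumes S: "corner S" and Q: "Q \<subseteq> K" "compact K" "K \<subseteq> S" and w: "Cdiff 2 S w" "\<forall>\<^sub>F x in F. Cdiff 2 S (v x)"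
    and t: "Ctends 2 Q S (\<lambda>x z. v x z - w z) F" and nd: "\<And>z. z \<in> K \<Longrightarrow> \<not> degen S w z"
  shows "\<forall>\<^sub>F x in F. \<forall>z\<in>Q. \<not> degen S (v x) z"
proof -
  let ?j = "\<lambda>w z. (\<chi> i. pd S i w z, hess S w z)"
  let ?Z = "{(v :: real^'n, H :: real^'n^'n). v = 0 \<and> \<not> invertible H}"
  have c: "continuous_on S (pd S i w)" "continuous_on S (pd S i (pd S j w))" for i j
    using w(1) Cdiff_continuous[of 1 S "pd S i w"] by (auto simp: numeral_2_eq_2)
  have "continuous_on K (?j w)"
    unfolding hess_def using continuous_on_subset[OF c(1) Q(3)] continuous_on_subset[OF c(2) Q(3)]
    by (intro continuous_intros continuous_on_vec_lambda)
  then have comp: "compact (?j w ` K)" using Q(2) compact_continuous_image by blast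
  have "degen S w z" if "?j w z \<in> ?Z" for z using that by (simp add: degen_def vec_eq_iff)
  then have "?j w ` K \<inter> ?Z = {}" using nd by blast
  from separate_compact_closed[OF comp closed_degenerate_jets this]
  obtain \<delta> where \<delta>: "\<delta> > 0" "\<And>z p. z \<in> K \<Longrightarrow> p \<in> ?Z \<Longrightarrow> \<delta> \<le> dist (?j w z) p"
    by blast
  define N where "N = real CARD('n)"
  have N: "N > 0" by (simp add: N_def)
  \<comment> \<open>The gradient has \<open>N\<close> components and the Hessian
    \<open>N * N\<close> entries; errors of size \<eta> in all of them move the jet by less than
    \<delta>.\<close>
  define \<eta> where "\<eta> = \<delta> / (N + N * N)"
  have NN: "N + N * N > 0" using N by (simp add: add_pos_pos)
  then have \<eta>: "\<eta> > 0" using \<delta>(1) by (simp add: \<eta>_def)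
  have "(N + N * N) * \<eta> = \<delta>" using NN by (simp add: \<eta>_def)
  then have \<eta>2: "N * \<eta> + N * (N * \<eta>) = \<delta>" by (simp add: distrib_right mult.assoc)
  have t1: "uniform_limit Q (\<lambda>x. pd S i (\<lambda>z. v x z - w z)) (\<lambda>_. 0) F"
    and t2: "uniform_limit Q (\<lambda>x. pd S i (pd S j (\<lambda>z. v x z - w z))) (\<lambda>_. 0) F" for i j
    using t by (simp_all add: numeral_2_eq_2)
  have e1: "\<forall>\<^sub>F x in F. \<forall>i. \<forall>z\<in>Q. \<bar>pd S i (\<lambda>z. v x z - w z) z\<bar> < \<eta>"
    using t1 \<eta> unfolding uniform_limit_iff by (auto intro!: eventually_all_finite)
  have e2: "\<forall>\<^sub>F x in F. \<forall>i. \<forall>j. \<forall>z\<in>Q. \<bar>pd S i (pd S j (\<lambda>z. v x z - w z)) z\<bar> < \<eta>"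
    using t2 \<eta> unfolding uniform_limit_iff by (auto intro!: eventually_all_finite)
  from w(2) e1 e2 show ?thesis
  proof eventually_elim
    case (elim x)
    have cd: "Cdiff (Suc (Suc 0)) S (v x)" "Cdiff (Suc (Suc 0)) S w"
      using elim(1) w(1) by (simp_all add: numeral_2_eq_2)
    have p1: "pd S i (\<lambda>z. v x z - w z) z = pd S i (v x) z - pd S i w z" if "z \<in> S" for i z
      by (rule pd_diff[OF S that Cdiff_differentiable[OF cd(1) that] Cdiff_differentiable[OF cd(2) that]])
    have p2: "pd S i (pd S j (\<lambda>z. v x z - w z)) z = pd S i (pd S j (v x)) z - pd S i (pd S j w) z" if "z \<in> S" for i j z
    proof -
      have "pd S i (pd S j (\<lambda>z. v x z - w z)) z = pd S i (\<lambda>z. pd S j (v x) z - pd S j w z) z"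
        by (rule pd_cong[OF p1 that])
      then show ?thesis
        using pd_diff[OF S that Cdiff_differentiable[OF Cdiff_pd[OF cd(1)] that] Cdiff_differentiable[OF Cdiff_pd[OF cd(2)] that]] by simp
    qed
    show ?case
    proof (intro ballI notI)
      fix z assume z: "z \<in> Q" and "degen S (v x) z"
      then have "?j (v x) z \<in> ?Z" by (auto simp: degen_def vec_eq_iff)
      moreover have zK: "z \<in> K" "z \<in> S" using z Q by auto
      ultimately have "\<delta> \<le> dist (?j (v x) z) (?j w z)" using \<delta>(2) by (metis dist_commute)
      also have "\<dots> \<le> norm (\<chi> i. pd S i (v x) z - pd S i w z) + norm (hess S (v x) z - hess S w z)"
        unfolding dist_norm by (simp add: norm_Pair_le minus_vec_def)
      also have "norm (\<chi> i. pd S i (v x) z - pd S i w z) \<le> (\<Sum>i\<in>UNIV. \<bar>pd S i (v x) z - pd S i w z\<bar>)"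
        using norm_le_l1_cart[of "\<chi> i. pd S i (v x) z - pd S i w z"] by simp
      also have "\<dots> < (\<Sum>i\<in>(UNIV::'n set). \<eta>)"
        using elim(2)[rule_format, OF z] by (intro sum_strict_mono) (auto simp: p1[OF zK(2)])
      also have "\<dots> = N * \<eta>" by (simp add: N_def)
      also have "norm (hess S (v x) z - hess S w z) \<le> (\<Sum>i\<in>UNIV. norm ((hess S (v x) z - hess S w z) $ i))"
        unfolding norm_vec_def[of "hess S (v x) z - hess S w z"] by (rule L2_set_le_sum) simp
      also have "\<dots> \<le> (\<Sum>i\<in>(UNIV::'n set). N * \<eta>)"
      proof (rule sum_mono)
        fix i
        have "norm ((hess S (v x) z - hess S w z) $ i) \<le> (\<Sum>j\<in>UNIV. \<bar>(hess S (v x) z - hess S w z) $ i $ j\<bar>)"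
          by (rule norm_le_l1_cart)
        also have "\<dots> \<le> (\<Sum>j\<in>(UNIV::'n set). \<eta>)"
          using elim(3)[rule_format, OF z] by (intro sum_mono less_imp_le) (auto simp: hess_def p2[OF zK(2)])
        finally show "norm ((hess S (v x) z - hess S w z) $ i) \<le> N * \<eta>" by (simp add: N_def)
      qed
      finally show False using \<eta>2 by (simp add: N_def)
    qed
  qed
qed

section \<open>The boundary of a half-space\<close>

lemma sum_option: "(\<Sum>k\<in>(UNIV :: 'b::finite option set). f k) = f None + (\<Sum>i\<in>UNIV. f (Some i))"
proof -
  have "(\<Sum>k\<in>(UNIV :: 'b option set). f k) = f None + sum f (range Some)"
    unfolding UNIV_option_conv by (subst sum.insert) auto
  also have "sum f (range Some) = (\<Sum>i\<in>UNIV. f (Some i))" by (subst sum.reindex) auto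
  finally show ?thesis .
qed

lemma bdry_emb_nth [simp]: "bdry_emb z $ None = 0" "bdry_emb z $ Some j = z $ j"
  by (simp_all add: bdry_emb_def)

lemma bdry_proj_nth [simp]: "bdry_proj y $ j = y $ Some j"
  by (simp add: bdry_proj_def)

lemma bdry_proj_emb [simp]: "bdry_proj (bdry_emb z) = z"
  by (simp add: vec_eq_iff)

lemma bdry_emb_proj: "y $ None = 0 \<Longrightarrow> bdry_emb (bdry_proj y) = y"
  unfolding vec_eq_iff
proof
  fix i assume "y $ None = 0"
  then show "bdry_emb (bdry_proj y) $ i = y $ i" by (cases i) auto
qed

lemma bdry_emb_halfspace: "bdry_emb z \<in> halfspace"
  by (simp add: halfspace_def)

lemma bounded_linear_bdry_emb: "bounded_linear bdry_emb"
proof -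
  have "bdry_emb (x + y) $ i = (bdry_emb x + bdry_emb y) $ i" for x y :: "real^'b" and i by (cases i) auto
  moreover have "bdry_emb (c *\<^sub>R x) $ i = (c *\<^sub>R bdry_emb x) $ i" for c and x :: "real^'b" and i by (cases i) auto
  ultimately show ?thesis unfolding linear_conv_bounded_linear[symmetric] by (auto intro!: linearI simp: vec_eq_iff)
qed

lemma bounded_linear_bdry_proj: "bounded_linear bdry_proj"
  unfolding linear_conv_bounded_linear[symmetric] by (auto intro!: linearI simp: vec_eq_iff)

text \<open>Generalizes \<open>bdry_image\<close> from images of charts to overlaps, half-balls and
  members of the cover.\<close>

definition bset :: "(real^('b::finite option)) set \<Rightarrow> (real^'b) set" where
  "bset S = {z. bdry_emb z \<in> S}"

lemma bset_iff [simp]: "z \<in> bset S \<longleftrightarrow> bdry_emb z \<in> S"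
  by (simp add: bset_def)

lemma bdry_image_bset: "bdry_image c = bset (snd c ` fst c)"
  by (simp add: bdry_image_def bset_def)

lemma corner_halfspace_openin: "openin (top_of_set halfspace) S \<Longrightarrow> corner S"
  using corner_openin corner_halfspace by blast

lemma open_bset:
  assumes "openin (top_of_set halfspace) S"
  shows "open (bset S)"
proof -
  obtain W where W: "open W" "S = halfspace \<inter> W" using assms by (auto simp: openin_open)
  have "bset S = bdry_emb -` W" unfolding W bset_def using bdry_emb_halfspace by auto
  then show ?thesis using open_vimage[OF W(1) linear_continuous_on[OF bounded_linear_bdry_emb]] by simp
qed

lemma compact_bset:
  fixes K :: "(real^('b::finite option)) set"
  assumes "compact K"
  shows "compact (bset K)"
proof -
  have "bset K = bdry_proj ` (K \<inter> {y. y $ None = 0})"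
  proof (intro set_eqI iffI)
    fix z assume "z \<in> bset K"
    then have "bdry_emb z \<in> K \<inter> {y. y $ None = 0}" by simp
    then show "z \<in> bdry_proj ` (K \<inter> {y. y $ None = 0})" by (metis bdry_proj_emb imageI)
  next
    fix z assume "z \<in> bdry_proj ` (K \<inter> {y. y $ None = 0})"
    then obtain y where "y \<in> K" "y $ None = 0" "z = bdry_proj y" by auto
    then show "z \<in> bset K" unfolding bset_iff using bdry_emb_proj[of y] by simp
  qed
  moreover have "closed {y :: real^('b option). y $ None = 0}" by (intro closed_Collect_eq continuous_intros)
  then have "compact (K \<inter> {y. y $ None = 0})" using assms by (rule compact_Int_closed[rotated])
  then have "compact (bdry_proj ` (K \<inter> {y. y $ None = 0}))"
    by (rule compact_continuous_image[OF linear_continuous_on[OF bounded_linear_bdry_proj]])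
  ultimately show ?thesis by simp
qed

lemma Cdiff_bdry_emb_nth: "corner \<Omega> \<Longrightarrow> Cdiff k \<Omega> (\<lambda>z. bdry_emb z $ i)"
  by (cases i) (simp_all add: Cdiff_const Cdiff_coord)

lemma pd_emb:
  assumes S: "openin (top_of_set halfspace) S" and z: "bdry_emb z \<in> S"
    and F: "F differentiable (at (bdry_emb z) within S)"
  shows "pd (bset S) i (\<lambda>z. F (bdry_emb z)) z = pd S (Some i) F (bdry_emb z)"
proof -
  note co = corner_open[OF open_bset[OF S]]
  have zb: "z \<in> bset S" and sub: "bdry_emb ` bset S \<subseteq> S" using z by auto
  have d: "(\<lambda>z. bdry_emb z $ a) differentiable (at z within bset S)" for a
    by (rule Cdiff_differentiable[OF Cdiff_bdry_emb_nth[OF co] zb])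
  have 0: "pd (bset S) i (\<lambda>z. bdry_emb z $ None) z = 0"
    using pd_const[OF co zb] by simp
  have 1: "pd (bset S) i (\<lambda>z. bdry_emb z $ Some j) z = (if i = j then 1 else 0)" for j
    using pd_coord[OF co zb] by simp
  have "pd (bset S) i (\<lambda>z. F (bdry_emb z)) z
      = (\<Sum>a\<in>UNIV. pd S a F (bdry_emb z) * pd (bset S) i (\<lambda>z. bdry_emb z $ a) z)"
    by (rule pd_chain(1)[OF co zb d F sub])
  also have "\<dots> = (\<Sum>j\<in>UNIV. pd S (Some j) F (bdry_emb z) * (if i = j then 1 else 0))"
    unfolding sum_option 0 1 by simp
  also have "\<dots> = pd S (Some i) F (bdry_emb z)"
    by (simp add: if_distrib[of "\<lambda>x. _ * x"] cong: if_cong)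
  finally show ?thesis .
qed

lemma Cdiff_emb:
  assumes "openin (top_of_set halfspace) S" "Cdiff k S F"
  shows "Cdiff k (bset S) (\<lambda>z. F (bdry_emb z))"
proof -
  note co = corner_open[OF open_bset[OF assms(1)]]
  show ?thesis
    by (rule Cdiff_chain[OF co Cdiff_bdry_emb_nth[OF co] _ assms(2)]) auto
qed

text \<open>By \<open>pd_emb\<close> the derivatives of the restriction are tangential derivatives
  of the original function, and these converge uniformly by assumption.\<close>

lemma Ctends_emb:
  fixes S :: "(real^('b::finite option)) set" and u :: "'x \<Rightarrow> real^('b option) \<Rightarrow> real"
  assumes S: "openin (top_of_set halfspace) S" and Q: "Q \<subseteq> S"
    and "\<forall>\<^sub>F x in F. Cdiff k S (u x)" "Ctends k Q S u F"
  shows "Ctends k (bset Q) (bset S) (\<lambda>x z. u x (bdry_emb z)) F"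
proof -
  have un: "uniform_limit (bset Q) (\<lambda>x z. u x (bdry_emb z)) (\<lambda>_. 0) F"
    if "uniform_limit Q u (\<lambda>_. 0) F" for u :: "'x \<Rightarrow> real^('b option) \<Rightarrow> real"
    unfolding uniform_limit_iff
  proof (intro allI impI)
    fix e :: real assume "e > 0"
    with that have "\<forall>\<^sub>F x in F. \<forall>y\<in>Q. dist (u x y) 0 < e" unfolding uniform_limit_iff by blast
    then show "\<forall>\<^sub>F x in F. \<forall>z\<in>bset Q. dist (u x (bdry_emb z)) 0 < e" by eventually_elim simp
  qed
  have QS: "bset Q \<subseteq> bset S" using Q by auto
  show ?thesis using assms(3-)
  proof (induction k arbitrary: u)
    case 0
    then show ?case using un by simp
  next
    case (Suc k)
    show ?case
    proof (rule Ctends_SucI)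
      show "uniform_limit (bset Q) (\<lambda>x z. u x (bdry_emb z)) (\<lambda>_. 0) F"
        by (rule un[OF Ctends_uniform[OF Suc.prems(2)]])
      fix i
      have "Ctends k (bset Q) (bset S) (\<lambda>x z. pd S (Some i) (u x) (bdry_emb z)) F"
        using Suc.prems eventually_Cdiff(2) by (intro Suc.IH) auto
      moreover have "\<forall>\<^sub>F x in F. \<forall>z\<in>bset S. pd S (Some i) (u x) (bdry_emb z) = pd (bset S) i (\<lambda>z. u x (bdry_emb z)) z"
        using Suc.prems(1) by eventually_elim (auto simp: pd_emb[OF S] Cdiff_differentiable simp del: Cdiff.simps)
      ultimately show "Ctends k (bset Q) (bset S) (\<lambda>x. pd (bset S) i (\<lambda>z. u x (bdry_emb z))) F"
        by (rule Ctends_cong[OF QS, rotated])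
    qed
  qed
qed


section \<open>Charts\<close>

abbreviation cimg :: "('a, 'b::finite) chart \<Rightarrow> (real^('b option)) set" where
  "cimg c \<equiv> snd c ` fst c"

abbreviation ov :: "('a, 'b::finite) chart \<Rightarrow> ('a, 'b) chart \<Rightarrow> (real^('b option)) set" where
  "ov c c' \<equiv> snd c ` (fst c \<inter> fst c')"

definition tr :: "('a, 'b::finite) chart \<Rightarrow> ('a, 'b) chart \<Rightarrow> real^('b option) \<Rightarrow> real^('b option)" where
  "tr c c' y = snd c' (inv_into (fst c) (snd c) y)"

locale smooth_manifold =
  fixes X :: "'a topology" and A :: "('a, 'b::finite) chart set"
  assumes compact_X: "compact_space X" and Hausdorff_X: "Hausdorff_space X" and atlas: "\<And>k. atlas k X A"
begin

lemma is_chart: "c \<in> A \<Longrightarrow> is_chart X c"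
  using atlas[of 0] by (simp add: atlas_def)

lemma topspace_eq: "(\<Union>c\<in>A. fst c) = topspace X"
  using atlas[of 0] by (simp add: atlas_def)

lemma openin_fst: "c \<in> A \<Longrightarrow> openin X (fst c)"
  using is_chart by (auto simp: is_chart_def)

lemma fst_subset: "c \<in> A \<Longrightarrow> fst c \<subseteq> topspace X"
  using topspace_eq by blast

lemma openin_cimg: "c \<in> A \<Longrightarrow> openin (top_of_set halfspace) (cimg c)"
  using is_chart by (auto simp: is_chart_def)

lemma corner_cimg: "c \<in> A \<Longrightarrow> corner (cimg c)"
  using openin_cimg corner_halfspace_openin by blast

lemma homeo: "c \<in> A \<Longrightarrow> homeomorphic_map (subtopology X (fst c)) (top_of_set (cimg c)) (snd c)"
  using is_chart by (auto simp: is_chart_def)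

lemma inj_chart: "c \<in> A \<Longrightarrow> inj_on (snd c) (fst c)"
  using homeomorphic_imp_injective_map[OF homeo] fst_subset by (simp add: inf.absorb2)

lemma inv_chart [simp]: "c \<in> A \<Longrightarrow> p \<in> fst c \<Longrightarrow> inv_into (fst c) (snd c) (snd c p) = p"
  using inj_chart by (simp add: inv_into_f_f)

lemma coord_rep_snd: "c \<in> A \<Longrightarrow> p \<in> fst c \<Longrightarrow> coord_rep c u (snd c p) = u p"
  by (simp add: coord_rep_def)

lemma open_image:
  assumes "c \<in> A" "openin X U"
  shows "openin (top_of_set (cimg c)) (snd c ` (fst c \<inter> U))"
proof -
  have "openin (subtopology X (fst c)) (fst c \<inter> U)"
    using assms(2) by (simp add: openin_subtopology_Int2)
  then show ?thesis
    using homeomorphic_imp_open_map[OF homeo[OF assms(1)]] by (auto simp: open_map_def)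
qed

lemma open_preimage:
  assumes "c \<in> A" "open W"
  shows "openin X {p \<in> fst c. snd c p \<in> W}"
proof -
  have "continuous_map (subtopology X (fst c)) euclidean (snd c)"
    using homeomorphic_imp_continuous_map[OF homeo[OF assms(1)]] by (simp add: continuous_map_in_subtopology)
  then have "openin (subtopology X (fst c)) {p \<in> topspace (subtopology X (fst c)). snd c p \<in> W}"
    by (rule openin_continuous_map_preimage) (use assms(2) open_openin in blast)
  moreover have "topspace (subtopology X (fst c)) = fst c" using fst_subset[OF assms(1)] by auto
  ultimately have "openin (subtopology X (fst c)) {p \<in> fst c. snd c p \<in> W}" by (simp only:)
  then show ?thesis by (rule openin_trans_full[OF _ openin_fst[OF assms(1)]])
qed

lemma compact_image:
  assumes "c \<in> A" "compactin X K" "K \<subseteq> fst c"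
  shows "compact (snd c ` K)"
proof -
  have "continuous_map (subtopology X (fst c)) euclidean (snd c)"
    using homeomorphic_imp_continuous_map[OF homeo[OF assms(1)]] by (simp add: continuous_map_in_subtopology)
  moreover have "compactin (subtopology X (fst c)) K" using assms by (simp add: compactin_subtopology)
  ultimately have "compactin euclidean (snd c ` K)" by (rule image_compactin[rotated])
  then show ?thesis by simp
qed

text \<open>The preimage is the image of a compact set under the inverse of the chart, and compact
  sets of a Hausdorff space are closed. Extension by zero out of a chart depends on this.\<close>

lemma closed_preimage:
  assumes c: "c \<in> A" and K: "compact K" "K \<subseteq> cimg c"
  shows "closedin X {p \<in> fst c. snd c p \<in> K}"
proof -
  obtain g where g: "homeomorphic_maps (subtopology X (fst c)) (top_of_set (cimg c)) (snd c) g"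
    using homeo[OF c] homeomorphic_map_maps by blast
  have ts: "topspace (subtopology X (fst c)) = fst c" using fst_subset[OF c] by auto
  have "continuous_map (top_of_set (cimg c)) X g"
    using g by (simp add: homeomorphic_maps_def continuous_map_in_subtopology)
  moreover have "compactin (top_of_set (cimg c)) K" using K by (simp add: compactin_subtopology)
  ultimately have "compactin X (g ` K)" by (rule image_compactin[rotated])
  moreover have "g ` K = {p \<in> fst c. snd c p \<in> K}"
  proof -
    have "g (snd c p) = p" if "p \<in> fst c" for p using g that ts by (simp add: homeomorphic_maps_def)
    then show ?thesis using K(2) by force
  qed
  ultimately show ?thesis using compactin_imp_closedin[OF Hausdorff_X] by simp
qed

lemma openin_ov:
  assumes "c \<in> A" "c' \<in> A"
  shows "openin (top_of_set (cimg c)) (ov c c')" "openin (top_of_set halfspace) (ov c c')"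
proof -
  show *: "openin (top_of_set (cimg c)) (ov c c')"
    using open_image[OF assms(1) openin_fst[OF assms(2)]] .
  show "openin (top_of_set halfspace) (ov c c')"
    by (rule openin_trans[OF * openin_cimg[OF assms(1)]])
qed

lemma corner_ov: "c \<in> A \<Longrightarrow> c' \<in> A \<Longrightarrow> corner (ov c c')"
  using openin_ov(2) corner_halfspace_openin by blast

lemma tr_snd: "c \<in> A \<Longrightarrow> p \<in> fst c \<Longrightarrow> tr c c' (snd c p) = snd c' p"
  by (simp add: tr_def)

lemma tr_ov: "c \<in> A \<Longrightarrow> y \<in> ov c c' \<Longrightarrow> tr c c' y \<in> ov c' c"
  by (elim imageE IntE) (simp add: tr_snd)

lemma tr_tr: "c \<in> A \<Longrightarrow> c' \<in> A \<Longrightarrow> y \<in> ov c c' \<Longrightarrow> tr c' c (tr c c' y) = y"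
  by (elim imageE IntE) (simp add: tr_snd)

lemma coord_rep_tr: "c \<in> A \<Longrightarrow> c' \<in> A \<Longrightarrow> y \<in> ov c c' \<Longrightarrow> coord_rep c u y = coord_rep c' u (tr c c' y)"
  by (elim imageE IntE) (simp add: tr_snd coord_rep_snd)

lemma Cdiff_tr:
  assumes "c \<in> A" "c' \<in> A"
  shows "Cdiff k (ov c c') (\<lambda>y. tr c c' y $ i)"
proof -
  have "Cdiff k (ov c c') (coord_rep c (\<lambda>p. snd c' p $ i))" using atlas[of k] assms by (simp add: atlas_def)
  then show ?thesis by (simp add: coord_rep_def tr_def)
qed

lemma differentiable_tr:
  "c \<in> A \<Longrightarrow> c' \<in> A \<Longrightarrow> y \<in> ov c c' \<Longrightarrow> (\<lambda>y. tr c c' y $ i) differentiable (at y within ov c c')"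
  using Cdiff_differentiable[OF Cdiff_tr] by blast

lemma jac_nth: "jac c c' p $ k $ i = pd (ov c c') i (\<lambda>y. tr c c' y $ k) (snd c p)"
  by (simp add: jac_def coord_rep_def tr_def)

lemma jac_inverse:
  assumes c: "c \<in> A" "c' \<in> A" and p: "p \<in> fst c" "p \<in> fst c'"
  shows "jac c' c p ** jac c c' p = mat 1"
proof -
  let ?y = "snd c p"
  have y: "?y \<in> ov c c'" and ty: "tr c c' ?y = snd c' p" using p c tr_snd by auto
  have im: "tr c c' ` ov c c' \<subseteq> ov c' c" using tr_ov[OF c(1)] by blast
  have "(jac c' c p ** jac c c' p) $ k $ i = mat 1 $ k $ i" for k i
  proof -
    have "(jac c' c p ** jac c c' p) $ k $ i
        = (\<Sum>a\<in>UNIV. pd (ov c' c) a (\<lambda>y. tr c' c y $ k) (tr c c' ?y) * pd (ov c c') i (\<lambda>y. tr c c' y $ a) ?y)"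
      by (simp add: matrix_matrix_mult_def jac_nth ty)
    also have "\<dots> = pd (ov c c') i (\<lambda>y. tr c' c (tr c c' y) $ k) ?y"
      by (rule pd_chain(1)[OF corner_ov[OF c] y differentiable_tr[OF c y] differentiable_tr[OF c(2,1) tr_ov[OF c(1) y]] im, symmetric])
    also have "\<dots> = pd (ov c c') i (\<lambda>y. y $ k) ?y"
      by (rule pd_cong[OF _ y]) (simp add: tr_tr[OF c])
    also have "\<dots> = mat 1 $ k $ i" by (simp add: pd_coord[OF corner_ov[OF c] y] mat_def)
    finally show ?thesis .
  qed
  then show ?thesis by (simp add: vec_eq_iff)
qed

section \<open>The boundary and Jacobians along it\<close>

lemma cimg_halfspace: "c \<in> A \<Longrightarrow> p \<in> fst c \<Longrightarrow> snd c p $ None \<ge> 0"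
  using openin_subset[OF openin_cimg[of c]] by (simp add: halfspace_def image_subset_iff)

text \<open>If the point were interior in \<open>c'\<close>, the normal coordinate of
  \<open>c\<close> would attain its minimum \<open>0\<close> there as a function on an open set. Its
  gradient, a row of the Jacobian, would vanish, although the Jacobian is invertible.\<close>

lemma bdry_invariant:
  assumes c: "c \<in> A" "c' \<in> A" and p: "p \<in> fst c" "p \<in> fst c'" and b: "snd c p $ None = 0"
  shows "snd c' p $ None = 0"
proof (rule ccontr)
  assume "snd c' p $ None \<noteq> 0"
  then have pos: "snd c' p $ None > 0" using cimg_halfspace[OF c(2) p(2)] by simp
  let ?S = "ov c' c" and ?y = "snd c' p" and ?F = "\<lambda>y. tr c' c y $ None"
  obtain W where W: "open W" "?S = halfspace \<inter> W" using openin_ov(2)[OF c(2,1)] by (auto simp: openin_open)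
  \<comment> \<open>Off the bounding hyperplane a relatively open subset of the half-space is open
    in the whole space, which the criterion for extrema requires.\<close>
  let ?U = "W \<inter> {y. y $ None > 0}"
  have "open {y :: real^('b option). y $ None > 0}" by (intro open_Collect_less continuous_intros)
  then have U: "open ?U" "?U \<subseteq> ?S" "?y \<in> ?U" using W p pos by (auto simp: halfspace_def)
  have D: "(?F has_derivative (\<lambda>v. \<Sum>i\<in>UNIV. v $ i * pd ?S i ?F ?y)) (at ?y)"
    using has_derivative_pd[OF differentiable_tr[OF c(2,1)], of ?y None] p U
    by (metis (no_types, lifting) IntI at_within_interior imageI interiorI)
  have "(\<lambda>v. \<Sum>i\<in>UNIV. v $ i * pd ?S i ?F ?y) = (\<lambda>v. 0)"
  proof (rule differential_zero_maxmin[OF U(3,1) D])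
    have "?F ?y \<le> ?F y" if "y \<in> ?U" for y
    proof -
      have "tr c' c y \<in> ov c c'" using tr_ov[OF c(2)] that U by blast
      then show ?thesis using cimg_halfspace[OF c(1)] b by (auto simp: tr_snd c p)
    qed
    then show "(\<forall>y\<in>?U. ?F y \<le> ?F ?y) \<or> (\<forall>y\<in>?U. ?F ?y \<le> ?F y)" by blast
  qed
  then have "(\<Sum>i\<in>UNIV. axis k 1 $ i * pd ?S i ?F ?y) = 0" for k by meson
  then have "jac c' c p $ None $ k = 0" for k
    by (simp add: jac_nth axis_def if_distrib[of "\<lambda>x. x * _"] cong: if_cong)
  then have "(jac c' c p ** jac c c' p) $ None $ None = 0" by (simp add: matrix_matrix_mult_def)
  then show False using jac_inverse[OF c p] by (simp add: mat_def)
qed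

lemma bdry_iff: "c \<in> A \<Longrightarrow> p \<in> fst c \<Longrightarrow> p \<in> bdry A \<longleftrightarrow> snd c p $ None = 0"
  using bdry_invariant unfolding bdry_def by blast

lemma compactin_bdry: "compactin X (bdry A)"
proof -
  have eq: "bdry A = topspace X - (\<Union>c\<in>A. {p \<in> fst c. snd c p \<in> {y. y $ None > 0}})"
  proof (intro set_eqI iffI)
    fix p assume p: "p \<in> bdry A"
    then have "p \<in> topspace X" using topspace_eq unfolding bdry_def by blast
    then show "p \<in> topspace X - (\<Union>c\<in>A. {p \<in> fst c. snd c p \<in> {y. y $ None > 0}})"
      using p bdry_iff by auto
  next
    fix p assume p: "p \<in> topspace X - (\<Union>c\<in>A. {p \<in> fst c. snd c p \<in> {y. y $ None > 0}})"
    then obtain c where c: "c \<in> A" "p \<in> fst c" using topspace_eq by blast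
    then have "snd c p $ None = 0" using p cimg_halfspace[OF c] by (metis (no_types, lifting) Diff_iff UN_I antisym_conv2 mem_Collect_eq)
    then show "p \<in> bdry A" using bdry_iff[OF c] by simp
  qed
  have op: "open {y :: real^('b option). y $ None > 0}" by (intro open_Collect_less continuous_intros)
  have "openin X (\<Union>c\<in>A. {p \<in> fst c. snd c p \<in> {y. y $ None > 0}})"
    by (intro openin_Union ballI) (elim imageE, simp only:, rule open_preimage[OF _ op])
  then have "closedin X (bdry A)" unfolding eq by (rule closedin_diff[OF closedin_topspace])
  then show ?thesis using compact_X closedin_compact_space by blast
qed

lemma tr_bdry:
  assumes c: "c \<in> A" "c' \<in> A" and y: "y \<in> ov c c'" "y $ None = 0"
  shows "tr c c' y $ None = 0"
  using y bdry_invariant[OF c] by (auto simp: tr_snd c)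

lemma tr_emb:
  assumes c: "c \<in> A" "c' \<in> A" and z: "bdry_emb z \<in> ov c c'"
  shows "tr c c' (bdry_emb z) = bdry_emb (bdry_proj (tr c c' (bdry_emb z)))"
  using bdry_emb_proj[OF tr_bdry[OF c z]] by simp

text \<open>A tangential derivative only sees the restriction to the bounding hyperplane, by
  \<open>pd_emb\<close>. It is applied to the normal component of a transition map and then to its
  first derivatives.\<close>

lemma tangential_derivative_zero:
  assumes c: "c \<in> A" "c' \<in> A" and F: "\<And>y. y \<in> ov c c' \<Longrightarrow> y $ None = 0 \<Longrightarrow> F y = 0"
    and d: "F differentiable (at y within ov c c')" and y: "y \<in> ov c c'" "y $ None = 0"
  shows "pd (ov c c') (Some i) F y = 0"
proof -
  have e: "bdry_emb (bdry_proj y) = y" using bdry_emb_proj[OF y(2)] .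
  have co: "corner (bset (ov c c'))" using corner_open[OF open_bset[OF openin_ov(2)[OF c]]] .
  have "pd (ov c c') (Some i) F y = pd (bset (ov c c')) i (\<lambda>z. F (bdry_emb z)) (bdry_proj y)"
    using pd_emb[OF openin_ov(2)[OF c], of "bdry_proj y" F i] y(1) d unfolding e by simp
  also have "\<dots> = pd (bset (ov c c')) i (\<lambda>z. 0) (bdry_proj y)"
    by (rule pd_cong) (use F y(1) in \<open>simp_all add: e\<close>)
  also have "\<dots> = 0" by (rule pd_const[OF co]) (use y(1) in \<open>simp add: e\<close>)
  finally show ?thesis .
qed

lemma jac_None_Some:
  assumes c: "c \<in> A" "c' \<in> A" and p: "p \<in> fst c" "p \<in> fst c'" "p \<in> bdry A"
  shows "jac c c' p $ None $ Some i = 0"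
proof -
  have y: "snd c p \<in> ov c c'" "snd c p $ None = 0" using p bdry_iff[OF c(1)] by blast+
  show ?thesis unfolding jac_nth
    by (rule tangential_derivative_zero[OF c tr_bdry[OF c] differentiable_tr[OF c y(1)] y])
qed

text \<open>Removes the inhomogeneous term in the transformation law of the Christoffel symbols once
  these are contracted with the normal, see \<open>raw_ff_chart\<close>.\<close>

lemma jac_None_Some_deriv:
  assumes c: "c \<in> A" "c' \<in> A" and p: "p \<in> fst c" "p \<in> fst c'" "p \<in> bdry A"
  shows "pd (ov c c') (Some i) (pd (ov c c') (Some j) (\<lambda>y. tr c c' y $ None)) (snd c p) = 0"
proof -
  have y: "snd c p \<in> ov c c'" "snd c p $ None = 0" using p bdry_iff[OF c(1)] by blast+
  have 0: "pd (ov c c') (Some j) (\<lambda>y. tr c c' y $ None) y = 0" if "y \<in> ov c c'" "y $ None = 0" for y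
    by (rule tangential_derivative_zero[OF c tr_bdry[OF c] differentiable_tr[OF c that(1)] that])
  have "Cdiff (Suc 0) (ov c c') (pd (ov c c') (Some j) (\<lambda>y. tr c c' y $ None))"
    using Cdiff_tr[OF c] by (rule Cdiff_pd)
  then have d: "pd (ov c c') (Some j) (\<lambda>y. tr c c' y $ None) differentiable (at (snd c p) within ov c c')"
    using y(1) by (rule Cdiff_differentiable)
  show ?thesis by (rule tangential_derivative_zero[OF c 0 d y])
qed

text \<open>Otherwise, by \<open>jac_None_Some\<close>, a whole row of an invertible matrix would
  vanish.\<close>

lemma jac_None_None:
  assumes c: "c \<in> A" "c' \<in> A" and p: "p \<in> fst c" "p \<in> fst c'" "p \<in> bdry A"
  shows "jac c c' p $ None $ None \<noteq> 0"
proof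
  assume "jac c c' p $ None $ None = 0"
  then have "jac c c' p $ None $ k = 0" for k using jac_None_Some[OF c p] by (cases k) auto
  then have "(jac c c' p ** jac c' c p) $ None $ None = 0" by (simp add: matrix_matrix_mult_def)
  then show False using jac_inverse[OF c(2,1) p(2,1)] by (simp add: mat_def)
qed

section \<open>Degenerate critical points in different charts\<close>

lemma degen_chart:
  assumes c: "c \<in> A" "c' \<in> A" and p: "p \<in> fst c" "p \<in> fst c'" "p \<in> bdry A"
    and u: "Cdiff 2 (bdry_image c') (bdry_rep c' u)"
    and deg: "degen (bdry_image c') (bdry_rep c' u) (bdry_proj (snd c' p))"
  shows "degen (bdry_image c) (bdry_rep c u) (bdry_proj (snd c p))"
proof -
  let ?\<Omega> = "bset (ov c c')" and ?z = "bdry_proj (snd c p)" and ?\<sigma> = "\<lambda>z. bdry_proj (tr c c' (bdry_emb z))"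
  have b: "snd c p $ None = 0" "snd c' p $ None = 0" using p bdry_iff[OF c(1)] bdry_iff[OF c(2)] by blast+
  have op: "open ?\<Omega>" by (rule open_bset[OF openin_ov(2)[OF c]])
  have op': "open (bdry_image c')" unfolding bdry_image_bset by (rule open_bset[OF openin_cimg[OF c(2)]])
  have opin: "openin (top_of_set (bdry_image c)) ?\<Omega>"
    using op by (auto simp: bdry_image_bset openin_open intro!: exI[of _ ?\<Omega>])
  have z: "?z \<in> ?\<Omega>" using p by (simp add: bdry_emb_proj[OF b(1)])
  have sub: "?\<sigma> ` ?\<Omega> \<subseteq> bdry_image c'"
  proof (rule image_subsetI)
    fix z assume "z \<in> ?\<Omega>"
    then have "bdry_emb z \<in> ov c c'" by (simp only: bset_iff)
    then have "bdry_emb (?\<sigma> z) \<in> ov c' c" using tr_emb[OF c] tr_ov[OF c(1)] by metis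
    then show "?\<sigma> z \<in> bdry_image c'" unfolding bdry_image_bset bset_iff by blast
  qed
  have Cs: "Cdiff 2 ?\<Omega> (\<lambda>z. ?\<sigma> z $ a)" for a
    using Cdiff_emb[OF openin_ov(2)[OF c] Cdiff_tr[OF c]] by simp
  have sz: "?\<sigma> ?z = bdry_proj (snd c' p)" using p(1) by (simp add: bdry_emb_proj[OF b(1)] tr_snd c)
  have "degen ?\<Omega> (\<lambda>z. bdry_rep c' u (?\<sigma> z)) ?z"
    by (rule degen_chain[OF corner_open[OF op] corner_open[OF op'] Cs sub u z]) (simp only: sz deg)
  moreover have "bdry_rep c' u (?\<sigma> z) = bdry_rep c u z" if "z \<in> ?\<Omega>" for z
    using that coord_rep_tr[OF c, of "bdry_emb z" u] tr_emb[OF c, of z] by (simp add: bdry_rep_def)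
  ultimately have "degen ?\<Omega> (bdry_rep c u) ?z" using degen_cong[OF _ z] by metis
  then show ?thesis using degen_openin[OF opin z] by simp
qed

text \<open>By \<open>degen_chart\<close> a point is degenerate in all charts around it or in none,
  so the universal quantifier over charts in the definition may be replaced by an existential one.
  Openness and density are proved in the latter form, with a chart of convenience at each
  point.\<close>

lemma nondegenerate_iff:
  assumes u: "\<And>c. c \<in> A \<Longrightarrow> Cdiff 2 (bdry_image c) (bdry_rep c u)"
  shows "only_nondegenerate_critical_points A u \<longleftrightarrow>
    (\<forall>p\<in>bdry A. \<exists>c\<in>A. p \<in> fst c \<and> \<not> degen (bdry_image c) (bdry_rep c u) (bdry_proj (snd c p)))"
proof -
  have hess: "hessian c u p = hess (bdry_image c) (bdry_rep c u) (bdry_proj (snd c p))" for c p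
    by (simp add: hessian_def hess_def)
  have all: "degen (bdry_image c') (bdry_rep c' u) (bdry_proj (snd c' p))"
    if "p \<in> bdry A" "c \<in> A" "c' \<in> A" "p \<in> fst c" "p \<in> fst c'" "degen (bdry_image c) (bdry_rep c u) (bdry_proj (snd c p))" for p c c'
    using degen_chart[OF that(3,2,5,4,1) u[OF that(2)] that(6)] .
  have ex: "\<exists>c\<in>A. p \<in> fst c" if "p \<in> bdry A" for p using that unfolding bdry_def by blast
  show ?thesis
  proof
    assume L: "only_nondegenerate_critical_points A u"
    show "\<forall>p\<in>bdry A. \<exists>c\<in>A. p \<in> fst c \<and> \<not> degen (bdry_image c) (bdry_rep c u) (bdry_proj (snd c p))"
    proof (rule ballI, rule ccontr)
      fix p assume p: "p \<in> bdry A" and "\<not> (\<exists>c\<in>A. p \<in> fst c \<and> \<not> degen (bdry_image c) (bdry_rep c u) (bdry_proj (snd c p)))"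
      then have d: "degen (bdry_image c) (bdry_rep c u) (bdry_proj (snd c p))" if "c \<in> A" "p \<in> fst c" for c using that by blast
      then have "critical_point A u p" using p by (auto simp: critical_point_def degen_def)
      moreover obtain c where c: "c \<in> A" "p \<in> fst c" using ex[OF p] by blast
      ultimately have "invertible (hessian c u p)" using L unfolding only_nondegenerate_critical_points_def by blast
      then show False using d[OF c] by (simp add: hess degen_def)
    qed
  next
    assume R: "\<forall>p\<in>bdry A. \<exists>c\<in>A. p \<in> fst c \<and> \<not> degen (bdry_image c) (bdry_rep c u) (bdry_proj (snd c p))"
    show "only_nondegenerate_critical_points A u"
      unfolding only_nondegenerate_critical_points_def
    proof (intro allI impI ballI)
      fix p c assume cp: "critical_point A u p" and c: "c \<in> A" "p \<in> fst c"
      then have p: "p \<in> bdry A" by (simp add: critical_point_def)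
      then obtain c' where c': "c' \<in> A" "p \<in> fst c'" "\<not> degen (bdry_image c') (bdry_rep c' u) (bdry_proj (snd c' p))" using R by blast
      have "\<not> degen (bdry_image c) (bdry_rep c u) (bdry_proj (snd c p))" using all[OF p c(1) c'(1) c(2) c'(2)] c'(3) by blast
      then show "invertible (hessian c u p)" using cp c by (simp add: hess degen_def critical_point_def)
    qed
  qed
qed

end

section \<open>The second fundamental form\<close>

text \<open>Christoffel symbols of the first kind; the index lowered is \<open>l\<close>.\<close>

definition lowchr :: "('a, 'b::finite) tensor \<Rightarrow> ('a, 'b) chart \<Rightarrow> 'a \<Rightarrow> 'b option \<Rightarrow> 'b option \<Rightarrow> 'b option \<Rightarrow> real" where
  "lowchr g c p l i j =
     (let G = (\<lambda>a b. coord_rep c (\<lambda>q. g c q $ a $ b)); D = (\<lambda>a F. pd (cimg c) a F (snd c p))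
      in 1/2 * (D i (G j l) + D j (G i l) - D l (G i j)))"

text \<open>The second fundamental form taken with respect to the gradient of the coordinate \<^term>\<open>None\<close>
  instead of the unit normal, which avoids the square root.\<close>

definition raw_ff :: "('a, 'b::finite) tensor \<Rightarrow> ('a, 'b) chart \<Rightarrow> 'a \<Rightarrow> real^'b^'b" where
  "raw_ff g c p = (\<chi> i j. \<Sum>l\<in>UNIV. lowchr g c p l (Some i) (Some j) * matrix_inv (g c p) $ l $ None)"

text \<open>Derivative along the gradient of the coordinate \<open>None\<close>, a positive multiple
  of the unit normal; as in \<open>raw_ff\<close>, this avoids the square root.\<close>

definition normal_deriv :: "('a, 'b::finite) tensor \<Rightarrow> ('a, 'b) chart \<Rightarrow> ('a \<Rightarrow> real) \<Rightarrow> 'a \<Rightarrow> real" where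
  "normal_deriv g c f p = (\<Sum>l\<in>UNIV. pd (cimg c) l (coord_rep c f) (snd c p) * matrix_inv (g c p) $ l $ None)"

definition conf :: "('a \<Rightarrow> real) \<Rightarrow> ('a, 'b) tensor \<Rightarrow> ('a, 'b::finite) tensor" where
  "conf f g = (\<lambda>c p. exp (2 * f p) *\<^sub>R g c p)"

lemma matrix_mult_entry: "(A ** B) $ i $ j = (\<Sum>k\<in>UNIV. A $ i $ k * B $ k $ j)"
  by (simp add: matrix_matrix_mult_def)

lemma sum_pos_def_inv:
  assumes "pos_def G"
  shows "(\<Sum>l\<in>UNIV. G $ k $ l * matrix_inv G $ l $ n) = (if k = n then 1 else 0)"
  using matrix_inv_right_left(1)[OF pos_def_invertible[OF assms]]
  by (simp add: matrix_mult_entry[symmetric] mat_def)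

lemma christoffel_lowchr: "christoffel g c p k i j = (\<Sum>l\<in>UNIV. matrix_inv (g c p) $ k $ l * lowchr g c p l i j)"
  unfolding christoffel_def lowchr_def Let_def sum_distrib_left by (intro sum.cong refl) simp

text \<open>Lowering the index of the unit normal gives the differential of the coordinate
  \<open>None\<close> up to normalization, so only the Christoffel symbols with upper index
  \<open>None\<close> survive.\<close>

lemma second_ff_raw:
  assumes g: "pos_def (g c p)"
  shows "second_ff g c p $ i $ j = raw_ff g c p $ i $ j / sqrt (matrix_inv (g c p) $ None $ None)"
proof -
  let ?s = "sqrt (matrix_inv (g c p) $ None $ None)" and ?n = "\<lambda>l. matrix_inv (g c p) $ l $ None"
  have "second_ff g c p $ i $ j
      = (\<Sum>k\<in>UNIV. christoffel g c p k (Some i) (Some j) * (\<Sum>l\<in>UNIV. g c p $ k $ l * ?n l) / ?s)"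
    unfolding second_ff_def unit_normal_def vec_lambda_beta sum_distrib_left sum_divide_distrib
    by (intro sum.cong refl) simp
  also have "\<dots> = christoffel g c p None (Some i) (Some j) / ?s"
    unfolding sum_pos_def_inv[OF g] by (simp add: if_distrib[of "\<lambda>x. _ * x"] if_distrib[of "\<lambda>x. x / _"] cong: if_cong)
  also have "christoffel g c p None (Some i) (Some j) = raw_ff g c p $ i $ j"
    unfolding christoffel_lowchr raw_ff_def using pos_def_sym[OF pos_def_matrix_inv[OF g], of None]
    by (simp add: mult.commute)
  finally show ?thesis .
qed

lemma pos_def_bdry_metric:
  fixes g :: "('a, 'b::finite) tensor"
  assumes g: "pos_def (g c p)"
  shows "pos_def (bdry_metric g c p)"
  unfolding pos_def_def
proof (intro conjI allI impI)
  show "transpose (bdry_metric g c p) = bdry_metric g c p"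
    using pos_def_sym[OF g] by (simp add: bdry_metric_def transpose_def vec_eq_iff)
  fix v :: "real^'b" assume "v \<noteq> 0"
  then have "bdry_emb v \<noteq> 0" by (metis bdry_proj_emb bounded_linear_bdry_proj linear_simps(3))
  then have "bdry_emb v \<bullet> (g c p *v bdry_emb v) > 0" using g by (simp add: pos_def_def)
  also have "bdry_emb v \<bullet> (g c p *v bdry_emb v) = v \<bullet> (bdry_metric g c p *v v)"
    unfolding inner_matrix_vector_sum sum_option by (simp add: bdry_metric_def)
  finally show "v \<bullet> (bdry_metric g c p *v v) > 0" .
qed

lemma mean_curvature_raw:
  assumes g: "pos_def (g c p)"
  shows "mean_curvature g c p = (\<Sum>i\<in>UNIV. \<Sum>j\<in>UNIV. matrix_inv (bdry_metric g c p) $ i $ j * raw_ff g c p $ i $ j)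
      / sqrt (matrix_inv (g c p) $ None $ None)"
  unfolding mean_curvature_def second_ff_raw[of g c p, OF g] by (simp add: sum_divide_distrib)

lemma normsq_raw:
  assumes g: "pos_def (g c p)"
  shows "second_ff_normsq_in g c p = (\<Sum>i\<in>UNIV. \<Sum>j\<in>UNIV. \<Sum>k\<in>UNIV. \<Sum>l\<in>UNIV.
      matrix_inv (bdry_metric g c p) $ i $ k * matrix_inv (bdry_metric g c p) $ j $ l * raw_ff g c p $ i $ j * raw_ff g c p $ k $ l)
      / matrix_inv (g c p) $ None $ None"
proof -
  have "matrix_inv (g c p) $ None $ None > 0" by (rule pos_def_diag[OF pos_def_matrix_inv[OF g]])
  then have "x / sqrt (matrix_inv (g c p) $ None $ None) * (y / sqrt (matrix_inv (g c p) $ None $ None))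
      = x * y / matrix_inv (g c p) $ None $ None" for x y by simp
  then show ?thesis
    unfolding second_ff_normsq_in_def Let_def second_ff_raw[of g c p, OF g] sum_divide_distrib
    by (intro sum.cong refl) (simp add: mult.assoc)
qed

lemma normsq_pos:
  assumes g: "pos_def (g c p)" and "second_ff g c p \<noteq> 0"
  shows "second_ff_normsq_in g c p > 0"
  unfolding second_ff_normsq_in_def Let_def
  by (rule pos_def_contraction_pos[OF pos_def_matrix_inv[OF pos_def_bdry_metric[of g c p, OF g]] assms(2)])

text \<open>Turns the fourfold contraction into a trace of a square, whose behaviour under a change
  of basis is plain.\<close>

lemma normsq_trace:
  fixes P B :: "real^'b::finite^'b"
  assumes P: "\<And>i j. P $ i $ j = P $ j $ i" and B: "\<And>i j. B $ i $ j = B $ j $ i"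
  shows "(\<Sum>i\<in>UNIV. \<Sum>j\<in>UNIV. \<Sum>k\<in>UNIV. \<Sum>l\<in>UNIV. P $ i $ k * P $ j $ l * B $ i $ j * B $ k $ l)
    = trace ((P ** B) ** (P ** B))"
proof -
  have "trace ((P ** B) ** (P ** B)) = (\<Sum>i\<in>UNIV. \<Sum>l\<in>UNIV. \<Sum>k\<in>UNIV. \<Sum>j\<in>UNIV. (P $ i $ k * B $ k $ l) * (P $ l $ j * B $ j $ i))"
    by (simp add: trace_def matrix_mult_entry sum_product)
  also have "\<dots> = (\<Sum>i\<in>UNIV. \<Sum>l\<in>UNIV. \<Sum>k\<in>UNIV. \<Sum>j\<in>UNIV. P $ i $ k * P $ j $ l * B $ i $ j * B $ k $ l)"
  proof (intro sum.cong refl)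
    fix i l k j
    show "(P $ i $ k * B $ k $ l) * (P $ l $ j * B $ j $ i) = P $ i $ k * P $ j $ l * B $ i $ j * B $ k $ l"
      unfolding P[of l j] B[of j i] by simp
  qed
  also have "\<dots> = (\<Sum>i\<in>UNIV. \<Sum>l\<in>UNIV. \<Sum>j\<in>UNIV. \<Sum>k\<in>UNIV. P $ i $ k * P $ j $ l * B $ i $ j * B $ k $ l)"
    by (intro sum.cong refl sum.swap)
  also have "\<dots> = (\<Sum>i\<in>UNIV. \<Sum>j\<in>UNIV. \<Sum>l\<in>UNIV. \<Sum>k\<in>UNIV. P $ i $ k * P $ j $ l * B $ i $ j * B $ k $ l)"
    by (intro sum.cong refl sum.swap)
  also have "\<dots> = (\<Sum>i\<in>UNIV. \<Sum>j\<in>UNIV. \<Sum>k\<in>UNIV. \<Sum>l\<in>UNIV. P $ i $ k * P $ j $ l * B $ i $ j * B $ k $ l)"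
    by (intro sum.cong refl sum.swap)
  finally show ?thesis by simp
qed

subsection \<open>Change of charts\<close>

text \<open>Here \<open>J\<close> and \<open>H\<close> are the first and second derivatives of a transition map, \<open>G\<close> the metric in the
  target chart and \<open>D\<close> its derivatives.\<close>

lemma lowchr_transform:
  fixes J :: "'k::finite \<Rightarrow> 'k \<Rightarrow> real"
  assumes H: "\<And>k i j. H k i j = H k j i" and G: "\<And>k l. G k l = G l k"
    and E: "\<And>i a b. E i a b = (\<Sum>k\<in>UNIV. \<Sum>l\<in>UNIV. H k i a * J l b * G k l) + (\<Sum>k\<in>UNIV. \<Sum>l\<in>UNIV. J k a * H l i b * G k l)
        + (\<Sum>k\<in>UNIV. \<Sum>l\<in>UNIV. J k a * J l b * (\<Sum>n\<in>UNIV. D n k l * J n i))"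
  shows "1/2 * (E i j l + E j i l - E l i j) = (\<Sum>k\<in>UNIV. H k i j * (\<Sum>a\<in>UNIV. G k a * J a l))
      + (\<Sum>a\<in>UNIV. \<Sum>b\<in>UNIV. J a i * J b j * (\<Sum>k\<in>UNIV. 1/2 * (D a b k + D b a k - D k a b) * J k l))"
proof -
  \<comment> \<open>\<open>P\<close> collects the terms with second derivatives of the transition
    map, \<open>Q\<close> those with derivatives of the metric.\<close>
  define P where "P i a b = (\<Sum>k\<in>UNIV. \<Sum>l\<in>UNIV. H k i a * J l b * G k l)" for i a b
  define Q where "Q i a b = (\<Sum>k\<in>UNIV. \<Sum>l\<in>UNIV. J k a * J l b * (\<Sum>n\<in>UNIV. D n k l * J n i))" for i a b
  have "(\<Sum>k\<in>UNIV. \<Sum>l\<in>UNIV. J k a * H l i b * G k l) = P i b a" for i a b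
  proof -
    have "(\<Sum>k\<in>UNIV. \<Sum>l\<in>UNIV. J k a * H l i b * G k l) = (\<Sum>l\<in>UNIV. \<Sum>k\<in>UNIV. J k a * H l i b * G k l)"
      by (rule sum.swap)
    also have "\<dots> = (\<Sum>l\<in>UNIV. \<Sum>k\<in>UNIV. H l i b * J k a * G l k)"
    proof (intro sum.cong refl)
      fix l k show "J k a * H l i b * G k l = H l i b * J k a * G l k" unfolding G[of k l] by simp
    qed
    finally show ?thesis unfolding P_def .
  qed
  then have E': "E i a b = P i a b + P i b a + Q i a b" for i a b unfolding E P_def Q_def by simp
  have Ps: "P i a b = P a i b" for i a b unfolding P_def H[of _ i a] ..
  \<comment> \<open>Of the six terms in \<open>P\<close> four cancel by the symmetry
    \<open>Ps\<close>, and the remaining two are equal.\<close>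
  have *: "1/2 * (E i j l + E j i l - E l i j) = P i j l + 1/2 * (Q i j l + Q j i l - Q l i j)"
    unfolding E' using Ps[of i l j] Ps[of j l i] Ps[of i j l] by simp
  have Pl: "P i j l = (\<Sum>k\<in>UNIV. H k i j * (\<Sum>a\<in>UNIV. G k a * J a l))"
    unfolding P_def sum_distrib_left by (intro sum.cong refl) simp
  have Q1: "Q i j l = (\<Sum>a\<in>UNIV. \<Sum>b\<in>UNIV. \<Sum>k\<in>UNIV. J a i * J b j * (D a b k * J k l))"
  proof -
    have "Q i j l = (\<Sum>b\<in>UNIV. \<Sum>k\<in>UNIV. \<Sum>a\<in>UNIV. J a i * J b j * (D a b k * J k l))"
      unfolding Q_def sum_distrib_left by (intro sum.cong refl) simp
    also have "\<dots> = (\<Sum>b\<in>UNIV. \<Sum>a\<in>UNIV. \<Sum>k\<in>UNIV. J a i * J b j * (D a b k * J k l))"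
      by (intro sum.cong refl sum.swap)
    also have "\<dots> = (\<Sum>a\<in>UNIV. \<Sum>b\<in>UNIV. \<Sum>k\<in>UNIV. J a i * J b j * (D a b k * J k l))"
      by (rule sum.swap)
    finally show ?thesis .
  qed
  have Q2: "Q j i l = (\<Sum>a\<in>UNIV. \<Sum>b\<in>UNIV. \<Sum>k\<in>UNIV. J a i * J b j * (D b a k * J k l))"
  proof -
    have "Q j i l = (\<Sum>a\<in>UNIV. \<Sum>k\<in>UNIV. \<Sum>b\<in>UNIV. J a i * J b j * (D b a k * J k l))"
      unfolding Q_def sum_distrib_left by (intro sum.cong refl) simp
    also have "\<dots> = (\<Sum>a\<in>UNIV. \<Sum>b\<in>UNIV. \<Sum>k\<in>UNIV. J a i * J b j * (D b a k * J k l))"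
      by (intro sum.cong refl sum.swap)
    finally show ?thesis .
  qed
  have Q3: "Q l i j = (\<Sum>a\<in>UNIV. \<Sum>b\<in>UNIV. \<Sum>k\<in>UNIV. J a i * J b j * (D k a b * J k l))"
    unfolding Q_def sum_distrib_left ..
  have comb: "1/2 * ((\<Sum>a\<in>UNIV. \<Sum>b\<in>UNIV. \<Sum>k\<in>UNIV. x a b k) + (\<Sum>a\<in>UNIV. \<Sum>b\<in>UNIV. \<Sum>k\<in>UNIV. y a b k)
      - (\<Sum>a\<in>UNIV. \<Sum>b\<in>UNIV. \<Sum>k\<in>UNIV. z a b k))
      = (\<Sum>a\<in>UNIV. \<Sum>b\<in>UNIV. \<Sum>k\<in>UNIV. 1/2 * (x a b k + y a b k - z a b k))" for x y z :: "'k \<Rightarrow> 'k \<Rightarrow> 'k \<Rightarrow> real"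
    by (simp add: sum.distrib sum_subtractf sum_divide_distrib[symmetric])
  have "1/2 * (Q i j l + Q j i l - Q l i j)
      = (\<Sum>a\<in>UNIV. \<Sum>b\<in>UNIV. \<Sum>k\<in>UNIV. 1/2 * (J a i * J b j * (D a b k * J k l) + J a i * J b j * (D b a k * J k l) - J a i * J b j * (D k a b * J k l)))"
    unfolding Q1 Q2 Q3 by (rule comb)
  also have "\<dots> = (\<Sum>a\<in>UNIV. \<Sum>b\<in>UNIV. J a i * J b j * (\<Sum>k\<in>UNIV. 1/2 * (D a b k + D b a k - D k a b) * J k l))"
    unfolding sum_distrib_left by (intro sum.cong refl) (simp add: algebra_simps)
  finally show ?thesis unfolding * Pl by simp
qed

locale riemannian = smooth_manifold X A for X :: "'a topology" and A :: "('a, 'b::finite) chart set" +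
  fixes m :: nat and g :: "('a, 'b) tensor"
  assumes m: "m \<ge> 3" and g: "g \<in> riemannian_metrics m A"
begin

lemma g_tensor: "g \<in> sym_tensors m A"
  using g by (simp add: riemannian_metrics_def)

lemma g_pos_def: "c \<in> A \<Longrightarrow> p \<in> fst c \<Longrightarrow> pos_def (g c p)"
  using g unfolding riemannian_metrics_def sym_tensors_def pos_def_def by blast

lemma g_Cdiff: "c \<in> A \<Longrightarrow> Cdiff m (cimg c) (coord_rep c (\<lambda>p. g c p $ i $ j))"
  using g_tensor unfolding sym_tensors_def by blast

lemma g_jac: "c \<in> A \<Longrightarrow> c' \<in> A \<Longrightarrow> p \<in> fst c \<Longrightarrow> p \<in> fst c' \<Longrightarrow> g c p = transpose (jac c c' p) ** g c' p ** jac c c' p"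
  using g_tensor unfolding sym_tensors_def by blast

lemma g_jac_entry:
  assumes "c \<in> A" "c' \<in> A" "p \<in> fst c" "p \<in> fst c'"
  shows "g c p $ a $ b = (\<Sum>k\<in>UNIV. \<Sum>l\<in>UNIV. jac c c' p $ k $ a * jac c c' p $ l $ b * g c' p $ k $ l)"
proof -
  have "g c p $ a $ b = (\<Sum>l\<in>UNIV. \<Sum>k\<in>UNIV. jac c c' p $ k $ a * jac c c' p $ l $ b * g c' p $ k $ l)"
    unfolding g_jac[OF assms] matrix_mult_entry transpose_def vec_lambda_beta sum_distrib_right
    by (intro sum.cong refl) simp
  also have "\<dots> = (\<Sum>k\<in>UNIV. \<Sum>l\<in>UNIV. jac c c' p $ k $ a * jac c c' p $ l $ b * g c' p $ k $ l)"
    by (rule sum.swap)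
  finally show ?thesis .
qed

text \<open>Along the boundary the gradients of the two coordinates \<open>None\<close> are
  proportional, because the differential of one of them has no tangential part.\<close>

lemma inv_jac_normal:
  assumes c: "c \<in> A" "c' \<in> A" and p: "p \<in> fst c" "p \<in> fst c'" "p \<in> bdry A"
  shows "matrix_inv (g c' p) $ k $ None = jac c c' p $ None $ None * (\<Sum>l\<in>UNIV. jac c c' p $ k $ l * matrix_inv (g c p) $ l $ None)"
proof -
  let ?J = "jac c c' p" and ?K = "jac c' c p"
  have "matrix_inv (g c' p) = ?J ** matrix_inv (g c p) ** transpose ?J"
    unfolding g_jac[OF c(2,1) p(2,1)]
    by (rule matrix_inv_congruence[OF pos_def_invertible[OF g_pos_def[OF c(1) p(1)]] jac_inverse[OF c p(1,2)]])
  then have "matrix_inv (g c' p) $ k $ None = (\<Sum>n\<in>UNIV. (\<Sum>l\<in>UNIV. ?J $ k $ l * matrix_inv (g c p) $ l $ n) * ?J $ None $ n)"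
    by (simp add: matrix_mult_entry transpose_def)
  also have "\<dots> = (\<Sum>l\<in>UNIV. ?J $ k $ l * matrix_inv (g c p) $ l $ None) * ?J $ None $ None"
    unfolding sum_option[of "\<lambda>n. _ n * ?J $ None $ n"] by (simp add: jac_None_Some[OF c p])
  finally show ?thesis by (simp add: mult.commute)
qed

text \<open>Chain rule together with \<open>inv_jac_normal\<close>; it transports the vanishing of a
  normal derivative from one chart to another.\<close>

lemma normal_deriv_chart:
  assumes c: "c \<in> A" "c' \<in> A" and p: "p \<in> fst c" "p \<in> fst c'" "p \<in> bdry A" and f: "f \<in> Cfun m A"
  shows "normal_deriv g c' f p = jac c c' p $ None $ None * normal_deriv g c f p"
proof -
  let ?y = "snd c p" and ?J = "jac c c' p" and ?f = "coord_rep c' f"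
  have y: "?y \<in> ov c c'" using p by blast
  have ty: "tr c c' ?y = snd c' p" using tr_snd[OF c(1) p(1)] .
  have im: "tr c c' ` ov c c' \<subseteq> cimg c'" using tr_ov[OF c(1)] by blast
  obtain m' where m': "m = Suc m'" using m by (cases m) auto
  have "Cdiff (Suc m') (cimg c') ?f" using f c(2) m' unfolding Cfun_def by blast
  then have df: "?f differentiable (at (tr c c' ?y) within cimg c')"
    unfolding ty using p by (intro Cdiff_differentiable) auto
  have "pd (cimg c) l (coord_rep c f) ?y = (\<Sum>k\<in>UNIV. pd (cimg c') k ?f (snd c' p) * ?J $ k $ l)" for l
  proof -
    have "pd (cimg c) l (coord_rep c f) ?y = pd (ov c c') l (coord_rep c f) ?y"
      using pd_subset[OF openin_ov(1)[OF c] y] by simp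
    also have "\<dots> = pd (ov c c') l (\<lambda>y. ?f (tr c c' y)) ?y"
      by (rule pd_cong[OF _ y]) (rule coord_rep_tr[OF c])
    also have "\<dots> = (\<Sum>k\<in>UNIV. pd (cimg c') k ?f (tr c c' ?y) * pd (ov c c') l (\<lambda>y. tr c c' y $ k) ?y)"
      by (rule pd_chain(1)[OF corner_ov[OF c] y differentiable_tr[OF c y] df im])
    finally show ?thesis unfolding ty jac_nth .
  qed
  then have "normal_deriv g c f p = (\<Sum>l\<in>UNIV. \<Sum>k\<in>UNIV. pd (cimg c') k ?f (snd c' p) * (?J $ k $ l * matrix_inv (g c p) $ l $ None))"
    by (simp add: normal_deriv_def sum_distrib_right mult.assoc)
  also have "\<dots> = (\<Sum>k\<in>UNIV. pd (cimg c') k ?f (snd c' p) * (\<Sum>l\<in>UNIV. ?J $ k $ l * matrix_inv (g c p) $ l $ None))"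
    unfolding sum_distrib_left by (rule sum.swap)
  finally show ?thesis
    unfolding normal_deriv_def[of g c'] inv_jac_normal[OF c p] by (simp add: sum_distrib_left mult_ac)
qed

lemma lowchr_chart:
  assumes c: "c \<in> A" "c' \<in> A" and p: "p \<in> fst c" "p \<in> fst c'"
  shows "lowchr g c p l i j =
      (\<Sum>k\<in>UNIV. pd (ov c c') i (pd (ov c c') j (\<lambda>y. tr c c' y $ k)) (snd c p) * (\<Sum>a\<in>UNIV. g c' p $ k $ a * jac c c' p $ a $ l))
      + (\<Sum>a\<in>UNIV. \<Sum>b\<in>UNIV. jac c c' p $ a $ i * jac c c' p $ b $ j * (\<Sum>k\<in>UNIV. lowchr g c' p k a b * jac c c' p $ k $ l))"
proof -
  let ?U = "ov c c'" and ?y = "snd c p"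
  let ?J = "\<lambda>k a. pd ?U a (\<lambda>y. tr c c' y $ k)"
  let ?H = "\<lambda>k i a. pd ?U i (?J k a) ?y"
  let ?G = "\<lambda>k l. coord_rep c' (\<lambda>q. g c' q $ k $ l)"
  let ?D = "\<lambda>n k l. pd (cimg c') n (?G k l) (snd c' p)"
  have y: "?y \<in> ?U" using p by blast
  have ty: "tr c c' ?y = snd c' p" using tr_snd[OF c(1) p(1)] .
  have Gy: "?G k l (tr c c' ?y) = g c' p $ k $ l" for k l unfolding ty using coord_rep_snd[OF c(2) p(2)] .
  have im: "tr c c' ` ?U \<subseteq> cimg c'" using tr_ov[OF c(1)] by blast
  note co = corner_ov[OF c]
  obtain m' where m': "m = Suc m'" using m by (cases m) auto
  have "Cdiff (Suc m') (cimg c') (?G k l)" for k l using g_Cdiff[OF c(2)] m' by simp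
  then have dG: "?G k l differentiable (at (tr c c' ?y) within cimg c')" for k l
    unfolding ty using p by (intro Cdiff_differentiable) auto
  have CJ: "Cdiff (Suc 0) ?U (?J k a)" for k a by (rule Cdiff_pd[OF Cdiff_tr[OF c]])
  have dJ: "?J k a differentiable (at ?y within ?U)" for k a by (rule Cdiff_differentiable[OF CJ y])
  have chain: "pd ?U i (\<lambda>y. ?G k l (tr c c' y)) ?y = (\<Sum>n\<in>UNIV. ?D n k l * ?J n i ?y)"
    "(\<lambda>y. ?G k l (tr c c' y)) differentiable (at ?y within ?U)" for i k l
    using pd_chain[OF co y differentiable_tr[OF c y] dG im] unfolding ty by auto
  \<comment> \<open>The product rule applied to the transformation law of the metric; the three sums
    come from the two Jacobian factors and from the metric itself.\<close>
  have E: "pd (cimg c) i (coord_rep c (\<lambda>q. g c q $ a $ b)) ?y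
      = (\<Sum>k\<in>UNIV. \<Sum>l\<in>UNIV. ?H k i a * ?J l b ?y * g c' p $ k $ l) + (\<Sum>k\<in>UNIV. \<Sum>l\<in>UNIV. ?J k a ?y * ?H l i b * g c' p $ k $ l)
        + (\<Sum>k\<in>UNIV. \<Sum>l\<in>UNIV. ?J k a ?y * ?J l b ?y * (\<Sum>n\<in>UNIV. ?D n k l * ?J n i ?y))" for i a b
  proof -
    have d1: "(\<lambda>y. ?J k a y * ?J l b y) differentiable (at ?y within ?U)" for k l
      by (intro differentiable_mult dJ)
    have d2: "(\<lambda>y. ?J k a y * ?J l b y * ?G k l (tr c c' y)) differentiable (at ?y within ?U)" for k l
      by (intro differentiable_mult d1 chain(2))
    have d3: "(\<lambda>y. \<Sum>l\<in>UNIV. ?J k a y * ?J l b y * ?G k l (tr c c' y)) differentiable (at ?y within ?U)" for k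
      by (intro differentiable_sum finite d2 ballI)
    have "pd (cimg c) i (coord_rep c (\<lambda>q. g c q $ a $ b)) ?y = pd ?U i (coord_rep c (\<lambda>q. g c q $ a $ b)) ?y"
      using pd_subset[OF openin_ov(1)[OF c] y] by simp
    also have "\<dots> = pd ?U i (\<lambda>y. \<Sum>k\<in>UNIV. \<Sum>l\<in>UNIV. ?J k a y * ?J l b y * ?G k l (tr c c' y)) ?y"
    proof (rule pd_cong[OF _ y])
      fix x assume "x \<in> ?U"
      then obtain q where q: "q \<in> fst c" "q \<in> fst c'" "x = snd c q" by blast
      show "coord_rep c (\<lambda>q. g c q $ a $ b) x = (\<Sum>k\<in>UNIV. \<Sum>l\<in>UNIV. ?J k a x * ?J l b x * ?G k l (tr c c' x))"
        unfolding q(3) coord_rep_snd[OF c(1) q(1)] tr_snd[OF c(1) q(1)] coord_rep_snd[OF c(2) q(2)]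
          g_jac_entry[OF c q(1,2)] jac_nth ..
    qed
    also have "\<dots> = (\<Sum>k\<in>UNIV. \<Sum>l\<in>UNIV. pd ?U i (\<lambda>y. ?J k a y * ?J l b y * ?G k l (tr c c' y)) ?y)"
      by (subst pd_sum[OF co y d3], intro sum.cong refl, rule pd_sum[OF co y d2])
    also have "\<dots> = (\<Sum>k\<in>UNIV. \<Sum>l\<in>UNIV. ?H k i a * ?J l b ?y * g c' p $ k $ l + ?J k a ?y * ?H l i b * g c' p $ k $ l
        + ?J k a ?y * ?J l b ?y * (\<Sum>n\<in>UNIV. ?D n k l * ?J n i ?y))"
      by (intro sum.cong refl) (simp add: pd_mult[OF co y d1 chain(2)] pd_mult[OF co y dJ dJ] chain(1) Gy distrib_right)
    finally show ?thesis by (simp only: sum.distrib)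
  qed
  have H: "?H k i j = ?H k j i" for k i j by (rule pd_swap[OF co Cdiff_tr[OF c] y])
  have "lowchr g c p l i j = (\<Sum>k\<in>UNIV. ?H k i j * (\<Sum>a\<in>UNIV. g c' p $ k $ a * ?J a l ?y))
      + (\<Sum>a\<in>UNIV. \<Sum>b\<in>UNIV. ?J a i ?y * ?J b j ?y * (\<Sum>k\<in>UNIV. 1/2 * (?D a b k + ?D b a k - ?D k a b) * ?J k l ?y))"
    unfolding lowchr_def Let_def
    by (rule lowchr_transform[OF H pos_def_sym[OF g_pos_def[OF c(2) p(2)]] E])
  then show ?thesis unfolding lowchr_def[of g c'] Let_def jac_nth .
qed

lemma lowchr_sym:
  assumes c: "c \<in> A" and p: "p \<in> fst c"
  shows "lowchr g c p l i j = lowchr g c p l j i"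
proof -
  have "pd (cimg c) n (coord_rep c (\<lambda>q. g c q $ i $ j)) (snd c p) = pd (cimg c) n (coord_rep c (\<lambda>q. g c q $ j $ i)) (snd c p)" for n
  proof (rule pd_cong)
    fix x assume "x \<in> cimg c"
    then obtain q where q: "q \<in> fst c" "x = snd c q" by blast
    show "coord_rep c (\<lambda>q. g c q $ i $ j) x = coord_rep c (\<lambda>q. g c q $ j $ i) x"
      unfolding q(2) coord_rep_snd[OF c q(1)] by (rule pos_def_sym[OF g_pos_def[OF c q(1)]])
  qed (use p in blast)
  then show ?thesis by (simp add: lowchr_def)
qed

text \<open>Contracted with the normal, the inhomogeneous term of \<open>lowchr_chart\<close>
  becomes a second tangential derivative of the normal coordinate and vanishes. What remains is
  tensorial up to the factor that rescales the normal.\<close>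

lemma raw_ff_chart:
  assumes c: "c \<in> A" "c' \<in> A" and p: "p \<in> fst c" "p \<in> fst c'" "p \<in> bdry A"
  shows "jac c c' p $ None $ None * raw_ff g c p $ i $ j =
    (\<Sum>a\<in>UNIV. \<Sum>b\<in>UNIV. jac c c' p $ Some a $ Some i * jac c c' p $ Some b $ Some j * raw_ff g c' p $ a $ b)"
proof -
  let ?J = "jac c c' p" and ?n = "\<lambda>l. matrix_inv (g c p) $ l $ None" and ?n' = "\<lambda>l. matrix_inv (g c' p) $ l $ None"
  let ?H = "\<lambda>k. pd (ov c c') (Some i) (pd (ov c c') (Some j) (\<lambda>y. tr c c' y $ k)) (snd c p)"
  have "?J $ None $ None * raw_ff g c p $ i $ j = (\<Sum>l\<in>UNIV. lowchr g c p l (Some i) (Some j) * (?J $ None $ None * ?n l))"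
    by (simp add: raw_ff_def sum_distrib_left mult_ac)
  also have "\<dots> = (\<Sum>l\<in>UNIV. \<Sum>k\<in>UNIV. \<Sum>a\<in>UNIV. ?H k * g c' p $ k $ a * (?J $ None $ None * (?J $ a $ l * ?n l)))
     + (\<Sum>l\<in>UNIV. \<Sum>a\<in>UNIV. \<Sum>b\<in>UNIV. \<Sum>k\<in>UNIV. ?J $ a $ Some i * ?J $ b $ Some j * lowchr g c' p k a b * (?J $ None $ None * (?J $ k $ l * ?n l)))"
    unfolding lowchr_chart[OF c p(1,2)] distrib_right sum.distrib sum_distrib_right sum_distrib_left
    by (intro arg_cong2[where f = "(+)"] sum.cong refl) simp_all
  also have "(\<Sum>l\<in>UNIV. \<Sum>k\<in>UNIV. \<Sum>a\<in>UNIV. ?H k * g c' p $ k $ a * (?J $ None $ None * (?J $ a $ l * ?n l)))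
      = (\<Sum>k\<in>UNIV. \<Sum>a\<in>UNIV. \<Sum>l\<in>UNIV. ?H k * g c' p $ k $ a * (?J $ None $ None * (?J $ a $ l * ?n l)))"
    by (rule trans, rule sum.swap, rule sum.cong[OF refl], rule sum.swap)
  also have "\<dots> = (\<Sum>k\<in>UNIV. ?H k * (\<Sum>a\<in>UNIV. g c' p $ k $ a * ?n' a))"
    unfolding inv_jac_normal[OF c p] by (simp add: sum_distrib_left mult_ac)
  \<comment> \<open>The metric contracted with the column \<open>None\<close> of its inverse selects
    the component \<open>None\<close>.\<close>
  also have "\<dots> = ?H None"
    unfolding sum_pos_def_inv[OF g_pos_def[OF c(2) p(2)]] by (simp add: if_distrib[of "\<lambda>x. _ * x"] cong: if_cong)
  also have "\<dots> = 0" by (rule jac_None_Some_deriv[OF c p])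
  also have "(\<Sum>l\<in>UNIV. \<Sum>a\<in>UNIV. \<Sum>b\<in>UNIV. \<Sum>k\<in>UNIV. ?J $ a $ Some i * ?J $ b $ Some j * lowchr g c' p k a b * (?J $ None $ None * (?J $ k $ l * ?n l)))
      = (\<Sum>a\<in>UNIV. \<Sum>b\<in>UNIV. \<Sum>k\<in>UNIV. \<Sum>l\<in>UNIV. ?J $ a $ Some i * ?J $ b $ Some j * lowchr g c' p k a b * (?J $ None $ None * (?J $ k $ l * ?n l)))"
    by (rule trans, rule sum.swap, rule sum.cong[OF refl], rule trans, rule sum.swap, rule sum.cong[OF refl], rule sum.swap)
  also have "\<dots> = (\<Sum>a\<in>UNIV. \<Sum>b\<in>UNIV. ?J $ a $ Some i * ?J $ b $ Some j * (\<Sum>k\<in>UNIV. lowchr g c' p k a b * ?n' k))"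
    unfolding inv_jac_normal[OF c p] by (simp add: sum_distrib_left mult_ac)
  also have "\<dots> = (\<Sum>a\<in>UNIV. \<Sum>b\<in>UNIV. ?J $ Some a $ Some i * ?J $ b $ Some j * (\<Sum>k\<in>UNIV. lowchr g c' p k (Some a) b * ?n' k))"
    by (subst sum_option) (simp add: jac_None_Some[OF c p])
  also have "\<dots> = (\<Sum>a\<in>UNIV. \<Sum>b\<in>UNIV. ?J $ Some a $ Some i * ?J $ Some b $ Some j * raw_ff g c' p $ a $ b)"
    by (rule sum.cong[OF refl], subst sum_option) (simp add: jac_None_Some[OF c p] raw_ff_def)
  finally show ?thesis by simp
qed

text \<open>\<open>second_ff_normsq\<close> uses a chart chosen by \<open>SOME\<close>; this makes
  the choice harmless. The factor by which the raw form is rescaled enters the trace squared, and so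
  does it enter the normalization of the normal.\<close>

lemma normsq_chart:
  assumes c: "c \<in> A" "c' \<in> A" and p: "p \<in> fst c" "p \<in> fst c'" "p \<in> bdry A"
  shows "second_ff_normsq_in g c p = second_ff_normsq_in g c' p"
proof -
  let ?J = "jac c c' p" and ?K = "jac c' c p"
  let ?\<gamma> = "bdry_metric g c p" and ?\<gamma>' = "bdry_metric g c' p"
  let ?B = "raw_ff g c p" and ?B' = "raw_ff g c' p" and ?r = "?J $ None $ None"
  define Jt :: "real^'b^'b" where "Jt = (\<chi> a i. ?J $ Some a $ Some i)"
  define Kt :: "real^'b^'b" where "Kt = (\<chi> a i. ?K $ Some a $ Some i)"
  note gp = g_pos_def[OF c(1) p(1)] and gp' = g_pos_def[OF c(2) p(2)]
  have r: "?r \<noteq> 0" by (rule jac_None_None[OF c p])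
  have JK: "Jt ** Kt = mat 1"
  proof -
    have "(Jt ** Kt) $ i $ j = mat 1 $ i $ j" for i j
    proof -
      have "(?J ** ?K) $ Some i $ Some j = mat 1 $ Some i $ Some j" using jac_inverse[OF c(2,1) p(2,1)] by simp
      moreover have "(?J ** ?K) $ Some i $ Some j = (Jt ** Kt) $ i $ j"
        unfolding matrix_mult_entry sum_option by (simp add: jac_None_Some[OF c(2,1) p(2,1,3)] Jt_def Kt_def)
      ultimately show ?thesis by (simp add: mat_def)
    qed
    then show ?thesis by (simp add: vec_eq_iff)
  qed
  then have KJ: "Kt ** Jt = mat 1" using matrix_left_right_inverse by blast
  have tKJ: "transpose Kt ** transpose Jt = mat 1" using JK by (simp add: matrix_transpose_mul[symmetric] transpose_mat)
  have \<gamma>: "?\<gamma> = transpose Jt ** ?\<gamma>' ** Jt"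
  proof -
    have "?\<gamma> $ i $ j = (transpose Jt ** ?\<gamma>' ** Jt) $ i $ j" for i j
    proof -
      have "?\<gamma> $ i $ j = (\<Sum>k\<in>UNIV. \<Sum>l\<in>UNIV. ?J $ k $ Some i * ?J $ l $ Some j * g c' p $ k $ l)"
        unfolding bdry_metric_def using g_jac_entry[OF c p(1,2)] by simp
      also have "\<dots> = (\<Sum>k\<in>UNIV. \<Sum>l\<in>UNIV. ?J $ Some k $ Some i * ?J $ l $ Some j * g c' p $ Some k $ l)"
        by (subst sum_option) (simp add: jac_None_Some[OF c p])
      also have "\<dots> = (\<Sum>k\<in>UNIV. \<Sum>l\<in>UNIV. ?J $ Some k $ Some i * ?J $ Some l $ Some j * g c' p $ Some k $ Some l)"
        by (rule sum.cong[OF refl], subst sum_option) (simp add: jac_None_Some[OF c p])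
      also have "\<dots> = (\<Sum>l\<in>UNIV. \<Sum>k\<in>UNIV. ?J $ Some k $ Some i * ?J $ Some l $ Some j * g c' p $ Some k $ Some l)"
        by (rule sum.swap)
      also have "\<dots> = (transpose Jt ** ?\<gamma>' ** Jt) $ i $ j"
        unfolding matrix_mult_entry sum_distrib_right by (intro sum.cong refl) (simp add: Jt_def transpose_def bdry_metric_def)
      finally show ?thesis .
    qed
    then show ?thesis by (simp add: vec_eq_iff)
  qed
  have rB: "?r *\<^sub>R ?B = transpose Jt ** ?B' ** Jt"
  proof -
    have "(?r *\<^sub>R ?B) $ i $ j = (transpose Jt ** ?B' ** Jt) $ i $ j" for i j
    proof -
      have "(?r *\<^sub>R ?B) $ i $ j = (\<Sum>a\<in>UNIV. \<Sum>b\<in>UNIV. ?J $ Some a $ Some i * ?J $ Some b $ Some j * ?B' $ a $ b)"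
        using raw_ff_chart[OF c p, of i j] by simp
      also have "\<dots> = (\<Sum>b\<in>UNIV. \<Sum>a\<in>UNIV. ?J $ Some a $ Some i * ?J $ Some b $ Some j * ?B' $ a $ b)"
        by (rule sum.swap)
      also have "\<dots> = (transpose Jt ** ?B' ** Jt) $ i $ j"
        unfolding matrix_mult_entry sum_distrib_right by (intro sum.cong refl) (simp add: Jt_def transpose_def)
      finally show ?thesis .
    qed
    then show ?thesis by (simp add: vec_eq_iff)
  qed
  \<comment> \<open>The shape operator up to normalization. Between charts it changes by conjugation
    and a scalar factor.\<close>
  let ?W = "matrix_inv ?\<gamma> ** ?B" and ?W' = "matrix_inv ?\<gamma>' ** ?B'"
  have rW: "?r *\<^sub>R ?W = Kt ** ?W' ** Jt"
  proof -
    have "?r *\<^sub>R ?W = matrix_inv ?\<gamma> ** (?r *\<^sub>R ?B)" by (simp add: matrix_scalar_ac scalar_matrix_assoc)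
    also have "\<dots> = Kt ** matrix_inv ?\<gamma>' ** ((transpose Kt ** transpose Jt) ** ?B' ** Jt)"
      unfolding rB unfolding \<gamma> matrix_inv_congruence[OF pos_def_invertible[OF pos_def_bdry_metric[of g c' p, OF gp']] JK]
      by (simp only: matrix_mul_assoc)
    also have "\<dots> = Kt ** ?W' ** Jt" unfolding tKJ by (simp add: matrix_mul_assoc)
    finally show ?thesis .
  qed
  have "?r * ?r * trace (?W ** ?W) = trace ((?r *\<^sub>R ?W) ** (?r *\<^sub>R ?W))"
    by (simp add: matrix_scalar_ac scalar_matrix_assoc[symmetric] trace_def sum_distrib_left mult.assoc)
  also have "\<dots> = trace (Kt ** ?W' ** (Jt ** Kt) ** ?W' ** Jt)" unfolding rW by (simp only: matrix_mul_assoc)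
  also have "\<dots> = trace (Kt ** (?W' ** ?W' ** Jt))" unfolding JK by (simp only: matrix_mul_rid matrix_mul_assoc)
  also have "\<dots> = trace (?W' ** ?W' ** (Jt ** Kt))" by (subst trace_mul_sym) (simp only: matrix_mul_assoc)
  also have "\<dots> = trace (?W' ** ?W')" unfolding JK by simp
  finally have tr: "?r * ?r * trace (?W ** ?W) = trace (?W' ** ?W')" .
  have nn: "matrix_inv (g c' p) $ None $ None = ?r * ?r * matrix_inv (g c p) $ None $ None"
    unfolding inv_jac_normal[OF c p] sum_option by (simp add: jac_None_Some[OF c p])
  have sB: "raw_ff g c p $ i $ j = raw_ff g c p $ j $ i" if "c \<in> A" "p \<in> fst c" for c i j
    unfolding raw_ff_def using lowchr_sym[OF that] by simp
  have ns: "second_ff_normsq_in g c p = trace ((matrix_inv (bdry_metric g c p) ** raw_ff g c p) ** (matrix_inv (bdry_metric g c p) ** raw_ff g c p))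
      / matrix_inv (g c p) $ None $ None" if "c \<in> A" "p \<in> fst c" for c
    unfolding normsq_raw[of g c p, OF g_pos_def[OF that]]
    by (subst normsq_trace[OF pos_def_sym[OF pos_def_matrix_inv[OF pos_def_bdry_metric[of g c p, OF g_pos_def[OF that]]]] sB[OF that]]) simp
  show ?thesis unfolding ns[OF c(1) p(1)] ns[OF c(2) p(2)] nn tr[symmetric] using r by simp
qed

end

section \<open>Conformal changes\<close>

context riemannian
begin

lemma Cfun_Cdiff: "f \<in> Cfun m A \<Longrightarrow> c \<in> A \<Longrightarrow> Cdiff m (cimg c) (coord_rep c f)"
  by (simp add: Cfun_def)

lemma m_Suc: obtains k where "m = Suc k" "2 \<le> k"
  using m by (cases m) auto

lemma Cfun_differentiable:
  assumes "f \<in> Cfun m A" "c \<in> A" "y \<in> cimg c"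
  shows "coord_rep c f differentiable (at y within cimg c)"
  using m_Suc Cdiff_differentiable[OF _ assms(3)] Cfun_Cdiff[OF assms(1,2)] by metis

lemma g_differentiable:
  assumes "c \<in> A" "y \<in> cimg c"
  shows "coord_rep c (\<lambda>q. g c q $ i $ j) differentiable (at y within cimg c)"
  using m_Suc Cdiff_differentiable[OF _ assms(2)] g_Cdiff[OF assms(1)] by metis

lemma conf_coord_rep:
  "coord_rep c (\<lambda>q. conf f g c q $ i $ j) = (\<lambda>y. exp (2 * coord_rep c f y) * coord_rep c (\<lambda>q. g c q $ i $ j) y)"
  by (simp add: coord_rep_def conf_def)

lemma conf_lowchr:
  assumes f: "f \<in> Cfun m A" and c: "c \<in> A" and p: "p \<in> fst c"
  defines "F \<equiv> \<lambda>a. pd (cimg c) a (coord_rep c f) (snd c p)"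
  shows "lowchr (conf f g) c p l i j
    = exp (2 * f p) * (lowchr g c p l i j + F i * g c p $ j $ l + F j * g c p $ i $ l - F l * g c p $ i $ j)"
proof -
  let ?S = "cimg c" and ?y = "snd c p"
  have y: "?y \<in> ?S" using p by blast
  note co = corner_cimg[OF c]
  have e: "((\<lambda>t. exp (2 * t)) has_real_derivative 2 * exp (2 * t)) (at t)" for t :: real
    by (auto intro!: derivative_eq_intros)
  note ed = pd_compose[OF co y Cfun_differentiable[OF f c y] e]
  have "pd ?S a (coord_rep c (\<lambda>q. conf f g c q $ i $ j)) ?y
      = exp (2 * f p) * (pd ?S a (coord_rep c (\<lambda>q. g c q $ i $ j)) ?y + 2 * F a * g c p $ i $ j)" for a i j
    unfolding conf_coord_rep pd_mult[OF co y ed(2) g_differentiable[OF c y]] ed(1) coord_rep_snd[OF c p] F_def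
    by (simp add: algebra_simps)
  then show ?thesis unfolding lowchr_def Let_def by (simp add: algebra_simps)
qed

lemma conf_pos_def: "c \<in> A \<Longrightarrow> p \<in> fst c \<Longrightarrow> pos_def (conf f g c p)"
  using g_pos_def[of c p] unfolding pos_def_def conf_def
  by (simp add: transpose_def vec_eq_iff scaleR_matrix_vector_assoc[symmetric])

lemma conf_inv: "c \<in> A \<Longrightarrow> p \<in> fst c \<Longrightarrow> matrix_inv (conf f g c p) = inverse (exp (2 * f p)) *\<^sub>R matrix_inv (g c p)"
  unfolding conf_def by (intro matrix_inv_scaleR pos_def_invertible g_pos_def) auto

lemma conf_bdry_metric: "bdry_metric (conf f g) c p = exp (2 * f p) *\<^sub>R bdry_metric g c p"
  by (simp add: bdry_metric_def conf_def vec_eq_iff)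

lemma conf_bdry_inv:
  assumes "c \<in> A" "p \<in> fst c"
  shows "matrix_inv (bdry_metric (conf f g) c p) = inverse (exp (2 * f p)) *\<^sub>R matrix_inv (bdry_metric g c p)"
  unfolding conf_bdry_metric
  by (intro matrix_inv_scaleR pos_def_invertible pos_def_bdry_metric g_pos_def assms) auto

text \<open>The exponential factors of the lowered Christoffel symbols and of the inverse metric
  cancel. The terms with tangential derivatives of \<open>f\<close> are contracted to an
  off-diagonal entry of the identity and vanish; the last term gives the normal derivative.\<close>

lemma conf_raw_ff:
  assumes f: "f \<in> Cfun m A" and c: "c \<in> A" and p: "p \<in> fst c"
  shows "raw_ff (conf f g) c p $ i $ j = raw_ff g c p $ i $ j - normal_deriv g c f p * bdry_metric g c p $ i $ j"
proof -
  let ?n = "\<lambda>l. matrix_inv (g c p) $ l $ None" and ?F = "\<lambda>a. pd (cimg c) a (coord_rep c f) (snd c p)"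
  have "raw_ff (conf f g) c p $ i $ j = (\<Sum>l\<in>UNIV. (lowchr g c p l (Some i) (Some j) + ?F (Some i) * g c p $ Some j $ l
      + ?F (Some j) * g c p $ Some i $ l - ?F l * g c p $ Some i $ Some j) * ?n l)"
    unfolding raw_ff_def vec_lambda_beta conf_lowchr[OF f c p] conf_inv[OF c p]
    by (intro sum.cong refl) simp
  also have "\<dots> = (\<Sum>l\<in>UNIV. lowchr g c p l (Some i) (Some j) * ?n l) + ?F (Some i) * (\<Sum>l\<in>UNIV. g c p $ Some j $ l * ?n l)
      + ?F (Some j) * (\<Sum>l\<in>UNIV. g c p $ Some i $ l * ?n l) - (\<Sum>l\<in>UNIV. ?F l * ?n l) * g c p $ Some i $ Some j"
    unfolding sum_distrib_left sum_distrib_right sum.distrib[symmetric] sum_subtractf[symmetric]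
    by (intro sum.cong refl) (simp add: algebra_simps)
  finally show ?thesis
    unfolding sum_pos_def_inv[OF g_pos_def[OF c p]] by (simp add: raw_ff_def normal_deriv_def bdry_metric_def)
qed

text \<open>The trace of the boundary metric is the dimension of the boundary, which is nonzero;
  hence the trace of the correction in \<open>conf_raw_ff\<close> vanishes only together with the
  normal derivative.\<close>

lemma conf_mean_curvature:
  assumes f: "f \<in> Cfun m A" and c: "c \<in> A" and p: "p \<in> fst c" and H: "mean_curvature g c p = 0"
  shows "mean_curvature (conf f g) c p = 0 \<longleftrightarrow> normal_deriv g c f p = 0"
proof -
  let ?P = "matrix_inv (bdry_metric g c p)" and ?s = "matrix_inv (g c p) $ None $ None" and ?N = "normal_deriv g c f p"
  note gp = g_pos_def[OF c p]
  have s: "?s > 0" by (rule pos_def_diag[OF pos_def_matrix_inv[OF gp]])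
  have t: "(\<Sum>i\<in>UNIV. \<Sum>j\<in>UNIV. ?P $ i $ j * bdry_metric g c p $ i $ j) = real CARD('b)"
  proof -
    have "(\<Sum>j\<in>UNIV. ?P $ i $ j * bdry_metric g c p $ i $ j) = (\<Sum>j\<in>UNIV. bdry_metric g c p $ i $ j * ?P $ j $ i)" for i
    proof (intro sum.cong refl)
      fix j show "?P $ i $ j * bdry_metric g c p $ i $ j = bdry_metric g c p $ i $ j * ?P $ j $ i"
        unfolding pos_def_sym[OF pos_def_matrix_inv[OF pos_def_bdry_metric[of g c p, OF gp]], of i j] by simp
    qed
    then show ?thesis unfolding sum_pos_def_inv[OF pos_def_bdry_metric[of g c p, OF gp]] by simp
  qed
  have H0: "(\<Sum>i\<in>UNIV. \<Sum>j\<in>UNIV. ?P $ i $ j * raw_ff g c p $ i $ j) = 0"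
    using H s unfolding mean_curvature_raw[of g c p, OF gp] by simp
  have "(\<Sum>i\<in>UNIV. \<Sum>j\<in>UNIV. matrix_inv (bdry_metric (conf f g) c p) $ i $ j * raw_ff (conf f g) c p $ i $ j)
      = (\<Sum>i\<in>UNIV. \<Sum>j\<in>UNIV. inverse (exp (2 * f p)) * (?P $ i $ j * raw_ff g c p $ i $ j - ?N * (?P $ i $ j * bdry_metric g c p $ i $ j)))"
    unfolding conf_bdry_inv[OF c p] conf_raw_ff[OF f c p] by (simp add: algebra_simps)
  also have "\<dots> = inverse (exp (2 * f p)) * (0 - ?N * real CARD('b))"
    unfolding sum_distrib_left[symmetric] sum_subtractf H0 t ..
  finally show ?thesis
    using s unfolding mean_curvature_raw[of "conf f g" c p, OF conf_pos_def[OF c p]] conf_inv[OF c p] by simp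
qed

text \<open>The raw form is unchanged. Two inverse boundary metrics contribute
  \<open>exp (- 4 * f p)\<close>, and dividing by the rescaled normalization returns
  \<open>exp (2 * f p)\<close>.\<close>

lemma conf_normsq:
  assumes f: "f \<in> Cfun m A" and c: "c \<in> A" and p: "p \<in> fst c" and N: "normal_deriv g c f p = 0"
  shows "second_ff_normsq_in (conf f g) c p = exp (- 2 * f p) * second_ff_normsq_in g c p"
proof -
  let ?P = "matrix_inv (bdry_metric g c p)" and ?B = "raw_ff g c p" and ?e = "inverse (exp (2 * f p))"
  have B: "raw_ff (conf f g) c p = ?B" using conf_raw_ff[OF f c p] N by (simp add: vec_eq_iff)
  have "(\<Sum>i\<in>UNIV. \<Sum>j\<in>UNIV. \<Sum>k\<in>UNIV. \<Sum>l\<in>UNIV. (?e *\<^sub>R ?P) $ i $ k * (?e *\<^sub>R ?P) $ j $ l * ?B $ i $ j * ?B $ k $ l)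
     = ?e * ?e * (\<Sum>i\<in>UNIV. \<Sum>j\<in>UNIV. \<Sum>k\<in>UNIV. \<Sum>l\<in>UNIV. ?P $ i $ k * ?P $ j $ l * ?B $ i $ j * ?B $ k $ l)"
    unfolding sum_distrib_left by (intro sum.cong refl) simp
  moreover have "?e = exp (- 2 * f p)" by (simp add: exp_minus)
  ultimately show ?thesis
    unfolding normsq_raw[of "conf f g" c p, OF conf_pos_def[OF c p]] normsq_raw[of g c p, OF g_pos_def[OF c p]]
      conf_bdry_inv[OF c p] B conf_inv[OF c p] by simp
qed

lemma conf_sym_tensors:
  assumes f: "f \<in> Cfun m A"
  shows "conf f g \<in> sym_tensors m A"
  unfolding sym_tensors_def mem_Collect_eq
proof (intro conjI allI ballI impI)
  fix c p
  show "conf f g c p = 0" if "c \<notin> A \<or> p \<notin> fst c"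
  proof -
    have "g c p = 0" using that g_tensor unfolding sym_tensors_def by blast
    then show ?thesis by (simp add: conf_def)
  qed
next
  fix c p assume "c \<in> A" "p \<in> fst c"
  then show "transpose (conf f g c p) = conf f g c p" using conf_pos_def pos_def_def by blast
next
  fix c c' p assume c: "c \<in> A" "c' \<in> A" and p: "p \<in> fst c \<inter> fst c'"
  then have "g c p = transpose (jac c c' p) ** g c' p ** jac c c' p" using g_jac by blast
  then show "conf f g c p = transpose (jac c c' p) ** conf f g c' p ** jac c c' p"
    unfolding conf_def matrix_scalar_ac by (simp add: scalar_matrix_assoc)
next
  fix c i j assume c: "c \<in> A"
  show "Cdiff m (cimg c) (coord_rep c (\<lambda>p. conf f g c p $ i $ j))"
    unfolding conf_coord_rep
    by (intro Cdiff_mult Cdiff_exp Cdiff_cmult corner_cimg c g_Cdiff Cfun_Cdiff f)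
qed

section \<open>Regularity of the geometric quantities in a chart\<close>

lemma inv_fst: "c \<in> A \<Longrightarrow> y \<in> cimg c \<Longrightarrow> inv_into (fst c) (snd c) y \<in> fst c"
  by (rule inv_into_into)

lemma snd_inv: "c \<in> A \<Longrightarrow> y \<in> cimg c \<Longrightarrow> snd c (inv_into (fst c) (snd c) y) = y"
  by (rule f_inv_into_f)

lemma Cdiff_ginv:
  assumes c: "c \<in> A"
  shows "Cdiff m (cimg c) (coord_rep c (\<lambda>p. matrix_inv (g c p) $ a $ b))"
  unfolding coord_rep_def
proof (rule Cdiff_matrix_inv[OF corner_cimg[OF c]])
  show "Cdiff m (cimg c) (\<lambda>y. g c (inv_into (fst c) (snd c) y) $ i $ j)" for i j
    using g_Cdiff[OF c] by (simp add: coord_rep_def)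
qed (rule pos_def_invertible[OF g_pos_def[OF c inv_fst[OF c]]])

lemma Cdiff_bdry_inv:
  assumes c: "c \<in> A"
  shows "Cdiff m (cimg c) (coord_rep c (\<lambda>p. matrix_inv (bdry_metric g c p) $ a $ b))"
  unfolding coord_rep_def
proof (rule Cdiff_matrix_inv[OF corner_cimg[OF c]])
  show "Cdiff m (cimg c) (\<lambda>y. bdry_metric g c (inv_into (fst c) (snd c) y) $ i $ j)" for i j
    using g_Cdiff[OF c] by (simp add: coord_rep_def bdry_metric_def)
qed (rule pos_def_invertible[OF pos_def_bdry_metric[where g = g and c = c, OF g_pos_def[OF c inv_fst[OF c]]]])

lemma Cdiff_lowchr:
  assumes c: "c \<in> A"
  shows "Cdiff 2 (cimg c) (coord_rep c (\<lambda>p. lowchr g c p l i j))"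
proof -
  let ?S = "cimg c"
  note co = corner_cimg[OF c]
  \<comment> \<open>Here three derivatives of the metric are used: one for the Christoffel symbols,
    and two more for the Hessian of the squared norm.\<close>
  have "Cdiff (Suc 2) ?S (coord_rep c (\<lambda>q. g c q $ i $ j))" for i j
    by (rule Cdiff_mono[OF g_Cdiff[OF c]]) (use m in simp)
  then have D: "Cdiff 2 ?S (pd ?S a (coord_rep c (\<lambda>q. g c q $ i $ j)))" for a i j
    by (rule Cdiff_pd)
  have "Cdiff 2 ?S (\<lambda>y. 1/2 * (pd ?S i (coord_rep c (\<lambda>q. g c q $ j $ l)) y + pd ?S j (coord_rep c (\<lambda>q. g c q $ i $ l)) y
      - pd ?S l (coord_rep c (\<lambda>q. g c q $ i $ j)) y))"
    by (intro Cdiff_cmult Cdiff_diff Cdiff_add D co)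
  then show ?thesis
  proof (rule Cdiff_cong[THEN iffD1, rotated])
    fix y assume y: "y \<in> cimg c"
    show "1/2 * (pd ?S i (coord_rep c (\<lambda>q. g c q $ j $ l)) y + pd ?S j (coord_rep c (\<lambda>q. g c q $ i $ l)) y
      - pd ?S l (coord_rep c (\<lambda>q. g c q $ i $ j)) y) = coord_rep c (\<lambda>p. lowchr g c p l i j) y"
      unfolding coord_rep_def[of c "\<lambda>p. lowchr g c p l i j"] by (simp add: lowchr_def snd_inv[OF c y])
  qed
qed

lemma Cdiff_raw_ff:
  assumes c: "c \<in> A"
  shows "Cdiff 2 (cimg c) (coord_rep c (\<lambda>p. raw_ff g c p $ i $ j))"
proof -
  have "Cdiff 2 (cimg c) (\<lambda>y. \<Sum>l\<in>UNIV. coord_rep c (\<lambda>p. lowchr g c p l (Some i) (Some j)) y * coord_rep c (\<lambda>p. matrix_inv (g c p) $ l $ None) y)"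
    by (intro Cdiff_sum Cdiff_mult corner_cimg c Cdiff_lowchr Cdiff_mono[OF Cdiff_ginv[OF c]]) (use m in simp)
  then show ?thesis by (simp add: raw_ff_def coord_rep_def)
qed

lemma Cdiff_normsq:
  assumes c: "c \<in> A"
  shows "Cdiff 2 (cimg c) (coord_rep c (\<lambda>p. second_ff_normsq_in g c p))"
proof -
  let ?P = "\<lambda>i j. coord_rep c (\<lambda>p. matrix_inv (bdry_metric g c p) $ i $ j)" and ?B = "\<lambda>i j. coord_rep c (\<lambda>p. raw_ff g c p $ i $ j)"
  let ?s = "coord_rep c (\<lambda>p. matrix_inv (g c p) $ None $ None)"
  have m2: "2 \<le> m" using m by simp
  have "Cdiff 2 (cimg c) (\<lambda>y. (\<Sum>i\<in>UNIV. \<Sum>j\<in>UNIV. \<Sum>k\<in>UNIV. \<Sum>l\<in>UNIV. ?P i k y * ?P j l y * ?B i j y * ?B k l y) / ?s y)"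
  proof (rule Cdiff_divide[OF corner_cimg[OF c]])
    show "?s y \<noteq> 0" if "y \<in> cimg c" for y
      using pos_def_diag[OF pos_def_matrix_inv[OF g_pos_def[OF c inv_fst[OF c that]]], of None] by (simp add: coord_rep_def)
    show "Cdiff 2 (cimg c) ?s" by (rule Cdiff_mono[OF Cdiff_ginv[OF c] m2])
    show "Cdiff 2 (cimg c) (\<lambda>y. \<Sum>i\<in>UNIV. \<Sum>j\<in>UNIV. \<Sum>k\<in>UNIV. \<Sum>l\<in>UNIV. ?P i k y * ?P j l y * ?B i j y * ?B k l y)"
      by (intro Cdiff_sum Cdiff_mult corner_cimg c Cdiff_raw_ff Cdiff_mono[OF Cdiff_bdry_inv[OF c] m2])
  qed
  then show ?thesis
    by (rule Cdiff_cong[THEN iffD1, rotated])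
       (simp add: coord_rep_def normsq_raw[of g c, OF g_pos_def[OF c inv_fst[OF c]]])
qed

end

section \<open>Conformal factors keeping the boundary minimal, and their potentials\<close>

locale minimal_riemannian = riemannian +
  assumes minimal: "minimal_boundary A g" and ff_nonzero: "second_ff_nonzero A g"
begin

abbreviation \<phi> :: "'a \<Rightarrow> real" where "\<phi> \<equiv> second_ff_normsq A g"

text \<open>By \<open>minimal_conf\<close> these are the exponents \<open>f\<close> for which
  \<open>conf f g\<close> has minimal boundary.\<close>

definition adm :: "('a \<Rightarrow> real) set" where
  "adm = {f \<in> Cfun m A. \<forall>c\<in>A. \<forall>p\<in>fst c \<inter> bdry A. normal_deriv g c f p = 0}"

text \<open>On the boundary this is minus the logarithm of the squared norm for
  \<open>conf f g\<close>, see \<open>normsq_conf\<close>. It is affine in \<open>f\<close>.\<close>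

definition pot :: "('a \<Rightarrow> real) \<Rightarrow> 'a \<Rightarrow> real" where
  "pot f p = 2 * f p - ln (\<phi> p)"

lemma adm_Cfun: "f \<in> adm \<Longrightarrow> f \<in> Cfun m A"
  by (simp add: adm_def)

lemma minimal_conf: "f \<in> Cfun m A \<Longrightarrow> minimal_boundary A (conf f g) \<longleftrightarrow> f \<in> adm"
  using minimal conf_mean_curvature unfolding minimal_boundary_def adm_def by (simp only: mem_Collect_eq) blast

lemma SOME_chart:
  assumes "p \<in> bdry A"
  shows "(SOME c. c \<in> A \<and> p \<in> fst c) \<in> A" "p \<in> fst (SOME c. c \<in> A \<and> p \<in> fst c)"
proof -
  have "\<exists>c. c \<in> A \<and> p \<in> fst c" using assms by (auto simp: bdry_def)
  then show "(SOME c. c \<in> A \<and> p \<in> fst c) \<in> A" "p \<in> fst (SOME c. c \<in> A \<and> p \<in> fst c)"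
    by (metis (mono_tags, lifting) someI_ex)+
qed

lemma \<phi>_chart:
  assumes "c \<in> A" "p \<in> fst c" "p \<in> bdry A"
  shows "\<phi> p = second_ff_normsq_in g c p"
  unfolding second_ff_normsq_def using normsq_chart SOME_chart[OF assms(3)] assms by blast

lemma \<phi>_pos:
  assumes "p \<in> bdry A"
  shows "\<phi> p > 0"
  unfolding second_ff_normsq_def
  using normsq_pos[where g = g and p = p, OF g_pos_def[OF SOME_chart[OF assms]]] ff_nonzero SOME_chart[OF assms] assms
  unfolding second_ff_nonzero_def by blast

lemma normsq_conf:
  assumes "f \<in> adm" "p \<in> bdry A"
  shows "second_ff_normsq A (conf f g) p = exp (- 1 * pot f p)"
proof -
  have "second_ff_normsq A (conf f g) p = exp (- 2 * f p) * \<phi> p"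
    unfolding second_ff_normsq_def
    using assms SOME_chart[OF assms(2)] by (intro conf_normsq) (auto simp: adm_def)
  then show ?thesis using \<phi>_pos[OF assms(2)] by (simp add: pot_def exp_diff exp_minus field_simps)
qed

lemma bdry_image_bdry:
  assumes "c \<in> A" "z \<in> bdry_image c"
  shows "inv_into (fst c) (snd c) (bdry_emb z) \<in> bdry A" "inv_into (fst c) (snd c) (bdry_emb z) \<in> fst c"
    "bdry_emb z \<in> cimg c"
proof -
  show z: "bdry_emb z \<in> cimg c" using assms by (simp add: bdry_image_def)
  show f: "inv_into (fst c) (snd c) (bdry_emb z) \<in> fst c" by (rule inv_fst[OF assms(1) z])
  show "inv_into (fst c) (snd c) (bdry_emb z) \<in> bdry A"
    using bdry_iff[OF assms(1) f] snd_inv[OF assms(1) z] by simp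
qed

lemma open_bdry_image: "c \<in> A \<Longrightarrow> open (bdry_image c)"
  unfolding bdry_image_bset by (rule open_bset[OF openin_cimg])

lemma Cdiff_bdry_rep:
  assumes "c \<in> A" "Cdiff k (cimg c) (coord_rep c u)"
  shows "Cdiff k (bdry_image c) (bdry_rep c u)"
  unfolding bdry_image_bset bdry_rep_def by (rule Cdiff_emb[OF openin_cimg[OF assms(1)] assms(2)])

lemma Cdiff_\<phi>:
  assumes c: "c \<in> A"
  shows "Cdiff 2 (bdry_image c) (bdry_rep c \<phi>)"
proof -
  have "bdry_rep c \<phi> z = bdry_rep c (\<lambda>p. second_ff_normsq_in g c p) z" if "z \<in> bdry_image c" for z
    unfolding bdry_rep_def coord_rep_def using \<phi>_chart[OF c] bdry_image_bdry[OF c that] by blast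
  then show ?thesis using Cdiff_bdry_rep[OF c Cdiff_normsq[OF c]] Cdiff_cong by metis
qed

lemma \<phi>_rep_pos: "c \<in> A \<Longrightarrow> z \<in> bdry_image c \<Longrightarrow> bdry_rep c \<phi> z > 0"
  unfolding bdry_rep_def coord_rep_def by (rule \<phi>_pos[OF bdry_image_bdry(1)])

lemma pot_rep: "bdry_rep c (pot f) z = 2 * bdry_rep c f z - ln (bdry_rep c \<phi> z)"
  by (simp add: bdry_rep_def coord_rep_def pot_def)

lemma Cdiff_pot:
  assumes c: "c \<in> A" and f: "f \<in> Cfun m A"
  shows "Cdiff 2 (bdry_image c) (bdry_rep c (pot f))"
proof -
  note co = corner_open[OF open_bdry_image[OF c]]
  have "Cdiff 2 (bdry_image c) (\<lambda>z. 2 * bdry_rep c f z - ln (bdry_rep c \<phi> z))"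
    using m by (intro Cdiff_diff Cdiff_cmult Cdiff_ln co Cdiff_bdry_rep c Cdiff_\<phi> \<phi>_rep_pos Cdiff_mono[OF Cfun_Cdiff[OF f c]]) auto
  then show ?thesis by (simp add: pot_rep[abs_def])
qed

text \<open>The exponential relating the squared norm to the potential is removed by
  \<open>degen_exp\<close>, one chart at a time.\<close>

lemma morse_iff:
  assumes f: "f \<in> adm"
  shows "only_nondegenerate_critical_points A (second_ff_normsq A (conf f g)) \<longleftrightarrow>
    (\<forall>p\<in>bdry A. \<exists>c\<in>A. p \<in> fst c \<and> \<not> degen (bdry_image c) (bdry_rep c (pot f)) (bdry_proj (snd c p)))"
proof -
  let ?\<psi> = "second_ff_normsq A (conf f g)"
  have eq: "bdry_rep c ?\<psi> z = exp (- 1 * bdry_rep c (pot f) z)" if "c \<in> A" "z \<in> bdry_image c" for c z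
    unfolding bdry_rep_def coord_rep_def by (rule normsq_conf[OF f bdry_image_bdry(1)[OF that]])
  note co = corner_open[OF open_bdry_image]
  have C: "Cdiff 2 (bdry_image c) (bdry_rep c ?\<psi>)" if "c \<in> A" for c
  proof (rule Cdiff_cong[THEN iffD2])
    show "Cdiff 2 (bdry_image c) (\<lambda>z. exp (- 1 * bdry_rep c (pot f) z))"
      by (rule Cdiff_exp[OF co[OF that] Cdiff_cmult[OF co[OF that] Cdiff_pot[OF that adm_Cfun[OF f]]]])
  qed (rule eq[OF that])
  have d: "degen (bdry_image c) (bdry_rep c ?\<psi>) (bdry_proj (snd c p)) \<longleftrightarrow> degen (bdry_image c) (bdry_rep c (pot f)) (bdry_proj (snd c p))"
    if "c \<in> A" "p \<in> fst c" "p \<in> bdry A" for c p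
  proof -
    have z: "bdry_proj (snd c p) \<in> bdry_image c"
      using that bdry_iff[OF that(1,2)] by (simp add: bdry_image_def bdry_emb_proj)
    have "degen (bdry_image c) (bdry_rep c ?\<psi>) (bdry_proj (snd c p))
        \<longleftrightarrow> degen (bdry_image c) (\<lambda>z. exp (- 1 * bdry_rep c (pot f) z)) (bdry_proj (snd c p))"
      by (rule degen_cong[OF _ z]) (rule eq[OF that(1)])
    also have "\<dots> \<longleftrightarrow> degen (bdry_image c) (bdry_rep c (pot f)) (bdry_proj (snd c p))"
      by (rule degen_exp[OF co[OF that(1)] Cdiff_pot[OF that(1) adm_Cfun[OF f]] z]) simp
    finally show ?thesis .
  qed
  have "only_nondegenerate_critical_points A ?\<psi> \<longleftrightarrow>
    (\<forall>p\<in>bdry A. \<exists>c\<in>A. p \<in> fst c \<and> \<not> degen (bdry_image c) (bdry_rep c ?\<psi>) (bdry_proj (snd c p)))"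
    by (rule nondegenerate_iff) (rule C)
  also have "\<dots> \<longleftrightarrow> (\<forall>p\<in>bdry A. \<exists>c\<in>A. p \<in> fst c \<and> \<not> degen (bdry_image c) (bdry_rep c (pot f)) (bdry_proj (snd c p)))"
    by (rule ball_cong[OF refl], rule bex_cong[OF refl], rule conj_cong[OF refl]) (simp only: d)
  finally show ?thesis .
qed

end

section \<open>The norm of order \<open>m\<close>\<close>

text \<open>A sum over an infinite index set is \<open>0\<close> by convention, so without
  finiteness \<open>Cnorm\<close> would not dominate its terms.\<close>

lemma finite_multiindices: "finite {\<alpha> :: 'k::finite \<Rightarrow> nat. sum \<alpha> UNIV \<le> m}"
proof (rule finite_subset)
  show "{\<alpha> :: 'k \<Rightarrow> nat. sum \<alpha> UNIV \<le> m} \<subseteq> PiE UNIV (\<lambda>_. {..m})"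
  proof
    fix \<alpha> :: "'k \<Rightarrow> nat" assume "\<alpha> \<in> {\<alpha>. sum \<alpha> UNIV \<le> m}"
    then have "\<alpha> i \<le> m" for i using member_le_sum[of i UNIV \<alpha>] by simp
    then show "\<alpha> \<in> PiE UNIV (\<lambda>_. {..m})" by (simp add: PiE_UNIV_domain)
  qed
qed (intro finite_PiE, auto)

definition component :: "('a, 'b::finite) tensor \<Rightarrow> ('a, 'b) chart \<Rightarrow> 'b option \<Rightarrow> 'b option \<Rightarrow> real^('b option) \<Rightarrow> real" where
  "component k c i j = coord_rep c (\<lambda>q. k c q $ i $ j)"

lemma component_minus: "component (k - k') c i j = (\<lambda>y. component k c i j y - component k' c i j y)"
  by (simp add: component_def coord_rep_def)

locale covered_manifold = smooth_manifold X A for X :: "'a topology" and A :: "('a, 'b::finite) chart set" +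
  fixes m :: nat and L :: "'l set" and V :: "'l \<Rightarrow> 'a set" and ch :: "'l \<Rightarrow> ('a, 'b) chart"
  assumes cover: "admissible_cover X A L V ch"
begin

abbreviation Q :: "'l \<Rightarrow> (real^('b option)) set" where "Q l \<equiv> snd (ch l) ` V l"
abbreviation K :: "'l \<Rightarrow> (real^('b option)) set" where "K l \<equiv> snd (ch l) ` (X closure_of V l)"
abbreviation S :: "'l \<Rightarrow> (real^('b option)) set" where "S l \<equiv> cimg (ch l)"

definition semi :: "('a, 'b) tensor \<Rightarrow> 'l \<Rightarrow> ('b option \<Rightarrow> nat) \<Rightarrow> 'b option \<Rightarrow> 'b option \<Rightarrow> real" where
  "semi k l \<alpha> i j = Sup (insert 0 ((\<lambda>y. \<bar>mpd (S l) \<alpha> (component k (ch l) i j) y\<bar>) ` Q l))"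

lemma Cnorm_semi: "Cnorm m L V ch k = (\<Sum>l\<in>L. \<Sum>\<alpha> | sum \<alpha> UNIV \<le> m. \<Sum>i\<in>UNIV. \<Sum>j\<in>UNIV. semi k l \<alpha> i j)"
  unfolding Cnorm_def semi_def component_def by (simp add: image_image)

lemma finite_L: "finite L"
  using cover by (simp add: admissible_cover_def)

lemma ch_A: "l \<in> L \<Longrightarrow> ch l \<in> A"
  using cover by (simp add: admissible_cover_def)

lemma closure_V: "l \<in> L \<Longrightarrow> X closure_of V l \<subseteq> fst (ch l)"
  using cover by (simp add: admissible_cover_def)

lemma V_closure: "l \<in> L \<Longrightarrow> V l \<subseteq> X closure_of V l"
  using cover by (intro closure_of_subset) (auto simp: admissible_cover_def)

lemma V_fst: "l \<in> L \<Longrightarrow> V l \<subseteq> fst (ch l)"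
  using V_closure closure_V by blast

lemma Q_K: "l \<in> L \<Longrightarrow> Q l \<subseteq> K l"
  using V_closure by (intro image_mono)

lemma K_S: "l \<in> L \<Longrightarrow> K l \<subseteq> S l"
  using closure_V by (intro image_mono)

lemma Q_S: "l \<in> L \<Longrightarrow> Q l \<subseteq> S l"
  using Q_K K_S by blast

lemma compact_K: "l \<in> L \<Longrightarrow> compact (K l)"
  using compact_image[OF ch_A _ closure_V] closedin_compact_space[OF compact_X closedin_closure_of] by blast

lemma component_Cdiff: "k \<in> sym_tensors m A \<Longrightarrow> c \<in> A \<Longrightarrow> Cdiff m (cimg c) (component k c i j)"
  unfolding sym_tensors_def component_def by blast

lemma component_minus_Cdiff:
  "k \<in> sym_tensors m A \<Longrightarrow> k' \<in> sym_tensors m A \<Longrightarrow> c \<in> A \<Longrightarrow> Cdiff m (cimg c) (component (k - k') c i j)"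
  unfolding component_minus by (intro Cdiff_diff corner_cimg component_Cdiff)

text \<open>A derivative of order at most \<open>m\<close> is continuous on the compact image of the
  closure of \<open>V l\<close>. Boundedness is needed for \<open>Sup\<close> to be an upper
  bound.\<close>

lemma semi_bdd:
  assumes l: "l \<in> L" and k: "Cdiff m (S l) (component k (ch l) i j)" and \<alpha>: "sum \<alpha> UNIV \<le> m"
  shows "bdd_above (insert 0 ((\<lambda>y. \<bar>mpd (S l) \<alpha> (component k (ch l) i j) y\<bar>) ` Q l))"
proof -
  have "continuous_on (K l) (\<lambda>y. \<bar>mpd (S l) \<alpha> (component k (ch l) i j) y\<bar>)"
    using continuous_on_subset[OF Cdiff_mpd[OF k \<alpha>] K_S[OF l]] by (intro continuous_intros)
  then have "compact ((\<lambda>y. \<bar>mpd (S l) \<alpha> (component k (ch l) i j) y\<bar>) ` K l)"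
    using compact_K[OF l] by (rule compact_continuous_image)
  then have "bdd_above ((\<lambda>y. \<bar>mpd (S l) \<alpha> (component k (ch l) i j) y\<bar>) ` K l)"
    by (intro bounded_imp_bdd_above compact_imp_bounded)
  then have "bdd_above ((\<lambda>y. \<bar>mpd (S l) \<alpha> (component k (ch l) i j) y\<bar>) ` Q l)"
    by (rule bdd_above_mono) (intro image_mono Q_K l)
  then show ?thesis by simp
qed

lemma semi_upper:
  assumes "l \<in> L" "Cdiff m (S l) (component k (ch l) i j)" "sum \<alpha> UNIV \<le> m" "y \<in> Q l"
  shows "\<bar>mpd (S l) \<alpha> (component k (ch l) i j) y\<bar> \<le> semi k l \<alpha> i j"
  unfolding semi_def by (rule cSup_upper[OF _ semi_bdd[OF assms(1-3)]]) (use assms(4) in blast)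

lemma semi_nonneg:
  assumes "l \<in> L" "Cdiff m (S l) (component k (ch l) i j)" "sum \<alpha> UNIV \<le> m"
  shows "0 \<le> semi k l \<alpha> i j"
  unfolding semi_def by (rule cSup_upper[OF _ semi_bdd[OF assms(1-3)]]) simp

lemma semi_least:
  assumes "0 \<le> e" "\<And>y. y \<in> Q l \<Longrightarrow> \<bar>mpd (S l) \<alpha> (component k (ch l) i j) y\<bar> \<le> e"
  shows "semi k l \<alpha> i j \<le> e"
  unfolding semi_def by (rule cSup_least) (use assms in auto)

lemma semi_le_Cnorm:
  assumes l: "l \<in> L" and k: "\<And>l i j. l \<in> L \<Longrightarrow> Cdiff m (S l) (component k (ch l) i j)" and \<alpha>: "sum \<alpha> UNIV \<le> m"
  shows "semi k l \<alpha> i j \<le> Cnorm m L V ch k"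
proof -
  have nn: "0 \<le> semi k l \<alpha> i j" if "l \<in> L" "\<alpha> \<in> {\<alpha>. sum \<alpha> UNIV \<le> m}" for l \<alpha> i j
    using semi_nonneg[OF that(1) k[OF that(1)]] that(2) by simp
  have "semi k l \<alpha> i j \<le> (\<Sum>j\<in>UNIV. semi k l \<alpha> i j)"
    by (rule member_le_sum) (use nn l \<alpha> in auto)
  also have "\<dots> \<le> (\<Sum>i\<in>UNIV. \<Sum>j\<in>UNIV. semi k l \<alpha> i j)"
    by (rule member_le_sum) (use nn l \<alpha> in \<open>auto intro!: sum_nonneg\<close>)
  also have "\<dots> \<le> (\<Sum>\<alpha> | sum \<alpha> UNIV \<le> m. \<Sum>i\<in>UNIV. \<Sum>j\<in>UNIV. semi k l \<alpha> i j)"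
    by (rule member_le_sum[where f = "\<lambda>\<alpha>. \<Sum>i\<in>UNIV. \<Sum>j\<in>UNIV. semi k l \<alpha> i j"])
       (use nn l \<alpha> finite_multiindices in \<open>auto intro!: sum_nonneg\<close>)
  also have "\<dots> \<le> (\<Sum>l\<in>L. \<Sum>\<alpha> | sum \<alpha> UNIV \<le> m. \<Sum>i\<in>UNIV. \<Sum>j\<in>UNIV. semi k l \<alpha> i j)"
    by (rule member_le_sum[where f = "\<lambda>l. \<Sum>\<alpha> | sum \<alpha> UNIV \<le> m. \<Sum>i\<in>UNIV. \<Sum>j\<in>UNIV. semi k l \<alpha> i j"])
       (use nn l finite_L in \<open>auto intro!: sum_nonneg\<close>)
  finally show ?thesis unfolding Cnorm_semi .
qed

lemma Cnorm_triangle: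
  assumes "a \<in> sym_tensors m A" "b \<in> sym_tensors m A" "d \<in> sym_tensors m A"
  shows "Cnorm m L V ch (a - d) \<le> Cnorm m L V ch (a - b) + Cnorm m L V ch (b - d)"
proof -
  have "semi (a - d) l \<alpha> i j \<le> semi (a - b) l \<alpha> i j + semi (b - d) l \<alpha> i j"
    if l: "l \<in> L" and \<alpha>: "\<alpha> \<in> {\<alpha>. sum \<alpha> UNIV \<le> m}" for l \<alpha> i j
  proof -
    have \<alpha>': "sum \<alpha> UNIV \<le> m" using \<alpha> by simp
    note ab = component_minus_Cdiff[OF assms(1,2) ch_A[OF l], of i j] and bd = component_minus_Cdiff[OF assms(2,3) ch_A[OF l], of i j]
    show ?thesis
    proof (rule semi_least)
      show "0 \<le> semi (a - b) l \<alpha> i j + semi (b - d) l \<alpha> i j"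
        using semi_nonneg[OF l ab \<alpha>'] semi_nonneg[OF l bd \<alpha>'] by simp
      fix y assume y: "y \<in> Q l"
      then have yS: "y \<in> S l" using Q_S[OF l] by blast
      have "component (a - d) (ch l) i j = (\<lambda>y. component (a - b) (ch l) i j y + component (b - d) (ch l) i j y)"
        by (simp add: component_minus)
      then have "mpd (S l) \<alpha> (component (a - d) (ch l) i j) y
          = mpd (S l) \<alpha> (component (a - b) (ch l) i j) y + mpd (S l) \<alpha> (component (b - d) (ch l) i j) y"
        using mpd_add[OF corner_cimg[OF ch_A[OF l]] ab bd \<alpha>' yS] by simp
      then show "\<bar>mpd (S l) \<alpha> (component (a - d) (ch l) i j) y\<bar> \<le> semi (a - b) l \<alpha> i j + semi (b - d) l \<alpha> i j"
        using semi_upper[OF l ab \<alpha>' y] semi_upper[OF l bd \<alpha>' y] by linarith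
    qed
  qed
  then show ?thesis unfolding Cnorm_semi sum.distrib[symmetric] by (intro sum_mono)
qed

lemma Cnorm_tendsto_0:
  assumes "\<And>l i j. l \<in> L \<Longrightarrow> Ctends m (Q l) (S l) (\<lambda>x. component (k x) (ch l) i j) F"
  shows "((\<lambda>x. Cnorm m L V ch (k x)) \<longlongrightarrow> 0) F"
  unfolding Cnorm_semi
proof (intro tendsto_null_sum)
  fix l i j and \<alpha> :: "'b option \<Rightarrow> nat" assume l: "l \<in> L" and "\<alpha> \<in> {\<alpha>. sum \<alpha> UNIV \<le> m}"
  then have "uniform_limit (Q l) (\<lambda>x. mpd (S l) \<alpha> (component (k x) (ch l) i j)) (\<lambda>_. 0) F"
    using Ctends_mpd[OF assms[OF l]] by simp
  note lim = this[unfolded uniform_limit_iff]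
  show "((\<lambda>x. semi (k x) l \<alpha> i j) \<longlongrightarrow> 0) F"
  proof (rule tendstoI)
    fix e :: real assume e: "e > 0"
    then have "\<forall>\<^sub>F x in F. \<forall>y\<in>Q l. dist (mpd (S l) \<alpha> (component (k x) (ch l) i j) y) 0 < e / 2"
      using lim by (meson half_gt_zero)
    then show "\<forall>\<^sub>F x in F. dist (semi (k x) l \<alpha> i j) 0 < e"
    proof eventually_elim
      case (elim x)
      then have b: "\<bar>mpd (S l) \<alpha> (component (k x) (ch l) i j) y\<bar> \<le> e / 2" if "y \<in> Q l" for y
        using that by (auto simp: dist_real_def intro: less_imp_le)
      have "semi (k x) l \<alpha> i j \<le> e / 2" by (rule semi_least) (use e b in auto)
      moreover have "0 \<le> semi (k x) l \<alpha> i j"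
        unfolding semi_def
        by (rule cSup_upper) (use b e in \<open>auto intro!: bdd_aboveI[of _ "e / 2"]\<close>)
      ultimately show ?case using e by simp
    qed
  qed
qed

text \<open>A constant sequence whose components vanish; the value is its limit.\<close>

lemma Cnorm_self: "Cnorm m L V ch (k - k) = 0"
proof -
  have "Ctends m (Q l) (S l) (\<lambda>x::nat. component (k - k) (ch l) i j) sequentially" if "l \<in> L" for l i j
    using Ctends_zero[OF corner_cimg[OF ch_A[OF that]] Q_S[OF that]] by (simp add: component_minus)
  then have "(\<lambda>x::nat. Cnorm m L V ch (k - k)) \<longlonglongrightarrow> 0"
    by (intro Cnorm_tendsto_0)
  then show ?thesis by (simp add: LIMSEQ_const_iff)
qed

section \<open>Open and dense sets in the topology of the norm\<close>

lemma openin_Cball: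
  assumes k: "k \<in> sym_tensors m A"
  shows "openin (Ctopology m A L V ch) {h \<in> sym_tensors m A. Cnorm m L V ch (h - k) < e}"
  unfolding openin_Ctopology
proof (intro conjI ballI)
  fix h assume h: "h \<in> {h \<in> sym_tensors m A. Cnorm m L V ch (h - k) < e}"
  show "\<exists>d>0. \<forall>l\<in>sym_tensors m A. Cnorm m L V ch (l - h) < d \<longrightarrow> l \<in> {h \<in> sym_tensors m A. Cnorm m L V ch (h - k) < e}"
  proof (intro exI[of _ "e - Cnorm m L V ch (h - k)"] conjI ballI impI)
    fix l assume l: "l \<in> sym_tensors m A" "Cnorm m L V ch (l - h) < e - Cnorm m L V ch (h - k)"
    then show "l \<in> {h \<in> sym_tensors m A. Cnorm m L V ch (h - k) < e}"
      using Cnorm_triangle[OF l(1) _ k, of h] h by simp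
  qed (use h in simp)
qed auto

lemma openin_subtopology_Ctopology:
  assumes M: "M \<subseteq> sym_tensors m A" and B: "B \<subseteq> M"
    and e: "\<And>k. k \<in> B \<Longrightarrow> \<exists>e>0. \<forall>h\<in>M. Cnorm m L V ch (h - k) < e \<longrightarrow> h \<in> B"
  shows "openin (subtopology (Ctopology m A L V ch) M) B"
proof -
  obtain r where r: "\<And>k. k \<in> B \<Longrightarrow> r k > 0" "\<And>k h. k \<in> B \<Longrightarrow> h \<in> M \<Longrightarrow> Cnorm m L V ch (h - k) < r k \<Longrightarrow> h \<in> B"
    using e by metis
  let ?U = "\<Union>k\<in>B. {h \<in> sym_tensors m A. Cnorm m L V ch (h - k) < r k}"
  have "openin (Ctopology m A L V ch) ?U"
    using openin_Cball M B by (intro openin_Union) blast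
  moreover have "B = ?U \<inter> M"
  proof (intro set_eqI iffI)
    fix k assume k: "k \<in> B"
    then have "Cnorm m L V ch (k - k) < r k" using r(1) Cnorm_self by simp
    then show "k \<in> ?U \<inter> M" using k M B by blast
  qed (use r(2) in blast)
  ultimately show ?thesis unfolding openin_subtopology by blast
qed

lemma dense_Ctopology:
  assumes M: "M \<subseteq> sym_tensors m A" and B: "B \<subseteq> M"
    and e: "\<And>k e. k \<in> M \<Longrightarrow> e > 0 \<Longrightarrow> \<exists>h\<in>B. Cnorm m L V ch (h - k) < e"
  shows "subtopology (Ctopology m A L V ch) M closure_of B = M"
proof -
  have "openin (Ctopology m A L V ch) (sym_tensors m A)"
    unfolding openin_Ctopology by (auto intro: exI[of _ 1])
  from openin_subset[OF this] have ts: "topspace (Ctopology m A L V ch) = sym_tensors m A"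
    using openin_topspace[of "Ctopology m A L V ch"] openin_Ctopology[of m A L V ch "topspace (Ctopology m A L V ch)"]
    by (intro subset_antisym) simp_all
  show ?thesis
  proof (intro subset_antisym)
    show "subtopology (Ctopology m A L V ch) M closure_of B \<subseteq> M"
      using closure_of_subset_topspace by fastforce
    show "M \<subseteq> subtopology (Ctopology m A L V ch) M closure_of B"
    proof
      fix k assume k: "k \<in> M"
      have "\<exists>y. y \<in> B \<and> y \<in> T" if T: "k \<in> T" "openin (subtopology (Ctopology m A L V ch) M) T" for T
      proof -
        obtain U where U: "openin (Ctopology m A L V ch) U" "T = U \<inter> M" using T(2) unfolding openin_subtopology by blast
        then have "k \<in> U" using T(1) by blast
        then obtain e where "e > 0" "\<And>l. l \<in> sym_tensors m A \<Longrightarrow> Cnorm m L V ch (l - k) < e \<Longrightarrow> l \<in> U"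
          using U(1) unfolding openin_Ctopology by blast
        moreover obtain h where "h \<in> B" "Cnorm m L V ch (h - k) < e" using \<open>e > 0\<close> assms(3)[OF k] by blast
        ultimately show ?thesis using B M U(2) by blast
      qed
      then show "k \<in> subtopology (Ctopology m A L V ch) M closure_of B"
        unfolding in_closure_of using k M by (simp add: ts subset_iff)
    qed
  qed
qed

end


section \<open>Openness\<close>

locale conformal_setting = minimal_riemannian X A m g + covered_manifold X A m L V ch
  for X :: "'a topology" and A :: "('a, 'b::finite) chart set" and m g and L :: "'l set" and V ch
begin

lemma pot_degen_chart:
  assumes f: "f \<in> adm" and c: "c \<in> A" "c' \<in> A" "p \<in> fst c" "p \<in> fst c'" "p \<in> bdry A"
    and "\<not> degen (bdry_image c) (bdry_rep c (pot f)) (bdry_proj (snd c p))"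
  shows "\<not> degen (bdry_image c') (bdry_rep c' (pot f)) (bdry_proj (snd c' p))"
  using degen_chart[OF c(1,2,3,4,5) Cdiff_pot[OF c(2) adm_Cfun[OF f]]] assms(7) by blast

text \<open>The reciprocal of \<^term>\<open>second_ff_normsq A h\<close> is used because, for \<open>h\<close> conformal to \<open>g\<close>, it is linear
  in \<open>h\<close>; it has the same critical points.\<close>

lemma morse_open:
  assumes f0: "f0 \<in> adm"
    and nd: "\<And>c p. c \<in> A \<Longrightarrow> p \<in> fst c \<Longrightarrow> p \<in> bdry A \<Longrightarrow> \<not> degen (bdry_image c) (bdry_rep c (pot f0)) (bdry_proj (snd c p))"
  shows "\<exists>e>0. \<forall>f\<in>adm. Cnorm m L V ch (conf f g - conf f0 g) < e \<longrightarrow>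
    (\<forall>p\<in>bdry A. \<exists>c\<in>A. p \<in> fst c \<and> \<not> degen (bdry_image c) (bdry_rep c (pot f)) (bdry_proj (snd c p)))"
proof -
  let ?N = "\<lambda>f. Cnorm m L V ch (conf f g - conf f0 g)"
  \<comment> \<open>The filter of admissible exponents along which the conformal metrics approach
    that of \<open>f0\<close> in norm. The exponents themselves are not assumed to converge in any
    sense.\<close>
  define F where "F = inf (filtercomap ?N (nhds 0)) (principal adm)"
  have N0: "(?N \<longlongrightarrow> 0) F" unfolding F_def by (rule filterlim_mono[OF filterlim_filtercomap order_refl inf_le1])
  have adm: "\<forall>\<^sub>F f in F. f \<in> adm" unfolding F_def by (simp add: eventually_inf_principal)
  have st: "conf f g \<in> sym_tensors m A" if "f \<in> adm" for f using conf_sym_tensors[OF adm_Cfun[OF that]] .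
  have main: "\<forall>\<^sub>F f in F. \<forall>z\<in>bset (Q l). \<not> degen (bdry_image (ch l)) (bdry_rep (ch l) (pot f)) z" if l: "l \<in> L" for l
  proof -
    let ?c = "ch l" and ?\<Omega> = "bdry_image (ch l)"
    have c: "?c \<in> A" by (rule ch_A[OF l])
    have \<Omega>: "?\<Omega> = bset (S l)" by (rule bdry_image_bset)
    note co = corner_cimg[OF c] and coO = corner_open[OF open_bdry_image[OF c]]
    \<comment> \<open>One diagonal component is enough: for the fixed metric it is positive, so it
      determines the conformal factor.\<close>
    let ?D = "\<lambda>f. component (conf f g - conf f0 g) ?c None None"
    have CD: "Cdiff m (S l) (component (conf f g - conf f0 g) ?c i j)" if "f \<in> adm" for f i j
      by (rule component_minus_Cdiff[OF st[OF that] st[OF f0] c])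
    have CD2: "\<forall>\<^sub>F f in F. Cdiff 2 (S l) (?D f)"
      using adm by eventually_elim (rule Cdiff_mono[OF CD], use m in auto)
    have "Ctends 2 (Q l) (S l) ?D F"
    proof (rule Ctends_2_mpd[OF co Q_S[OF l] CD2])
      fix \<alpha> :: "'b option \<Rightarrow> nat" assume "sum \<alpha> UNIV \<le> 2"
      then have \<alpha>: "sum \<alpha> UNIV \<le> m" using m by simp
      show "uniform_limit (Q l) (\<lambda>f. mpd (S l) \<alpha> (?D f)) (\<lambda>_. 0) F"
        unfolding uniform_limit_iff
      proof (intro allI impI)
        fix e :: real assume "e > 0"
        then have "\<forall>\<^sub>F f in F. dist (?N f) 0 < e" using N0 unfolding tendsto_iff by blast
        with adm show "\<forall>\<^sub>F f in F. \<forall>y\<in>Q l. dist (mpd (S l) \<alpha> (?D f) y) 0 < e"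
        proof eventually_elim
          case (elim f)
          show ?case
          proof
            fix y assume y: "y \<in> Q l"
            have "\<bar>mpd (S l) \<alpha> (?D f) y\<bar> \<le> semi (conf f g - conf f0 g) l \<alpha> None None"
              by (rule semi_upper[OF l CD[OF elim(1)] \<alpha> y])
            also have "\<dots> \<le> ?N f"
              by (rule semi_le_Cnorm[OF l _ \<alpha>]) (rule component_minus_Cdiff[OF st[OF elim(1)] st[OF f0] ch_A])
            finally show "dist (mpd (S l) \<alpha> (?D f) y) 0 < e" using elim(2) by simp
          qed
        qed
      qed
    qed
    then have t: "Ctends 2 (bset (Q l)) ?\<Omega> (\<lambda>f z. ?D f (bdry_emb z)) F"
      unfolding \<Omega> using Ctends_emb[OF openin_cimg[OF c] Q_S[OF l] CD2] by simp
    \<comment> \<open>Chosen so that multiplying a component of \<open>conf f g\<close> by it yields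
      the exponential of the potential, the reciprocal of the squared norm. It does not depend on
      \<open>f\<close>.\<close>
    let ?\<eta> = "\<lambda>z. inverse (component g ?c None None (bdry_emb z) * bdry_rep ?c \<phi> z)"
    let ?\<theta> = "\<lambda>f z. ?\<eta> z * component (conf f g) ?c None None (bdry_emb z)"
    have gpos: "component g ?c None None (bdry_emb z) > 0" if "z \<in> ?\<Omega>" for z
      unfolding component_def coord_rep_def
      by (rule pos_def_diag[OF g_pos_def[OF c bdry_image_bdry(2)[OF c that]]])
    have C2: "Cdiff 2 ?\<Omega> (\<lambda>z. component k ?c None None (bdry_emb z))" if "k \<in> sym_tensors m A" for k
      unfolding \<Omega> by (rule Cdiff_emb[OF openin_cimg[OF c] Cdiff_mono[OF component_Cdiff[OF that c]]]) (use m in simp)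
    have C\<eta>: "Cdiff 2 ?\<Omega> ?\<eta>"
    proof (rule Cdiff_inverse[OF coO])
      show "component g ?c None None (bdry_emb z) * bdry_rep ?c \<phi> z \<noteq> 0" if "z \<in> ?\<Omega>" for z
        using gpos[OF that] \<phi>_rep_pos[OF c that] by simp
    qed (intro Cdiff_mult coO C2 g_tensor Cdiff_\<phi> c)
    have sub: "bset (Q l) \<subseteq> bset (K l)" "bset (K l) \<subseteq> ?\<Omega>"
      unfolding \<Omega> using Q_K[OF l] K_S[OF l] by (auto simp: bset_def)
    have CDO: "\<forall>\<^sub>F f in F. Cdiff 2 ?\<Omega> (\<lambda>z. ?D f (bdry_emb z))"
      using CD2 unfolding \<Omega> by eventually_elim (rule Cdiff_emb[OF openin_cimg[OF c]])
    have "Ctends 2 (bset (Q l)) ?\<Omega> (\<lambda>f z. ?\<eta> z * ?D f (bdry_emb z)) F"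
      by (rule Ctends_mult_fixed[OF coO sub(1) compact_bset[OF compact_K[OF l]] sub(2) C\<eta> CDO t])
    then have t\<theta>: "Ctends 2 (bset (Q l)) ?\<Omega> (\<lambda>f z. ?\<theta> f z - ?\<theta> f0 z) F"
      by (simp add: component_minus right_diff_distrib)
    have C\<theta>: "Cdiff 2 ?\<Omega> (?\<theta> f)" if "f \<in> adm" for f
      by (intro Cdiff_mult coO C\<eta> C2 st that)
    have \<theta>: "?\<theta> f z = exp (1 * bdry_rep ?c (pot f) z)" if "z \<in> ?\<Omega>" for f z
      using gpos[OF that] \<phi>_rep_pos[OF c that]
      by (simp add: component_def conf_coord_rep pot_rep exp_diff bdry_rep_def[of _ f] field_simps)
    have deg: "degen ?\<Omega> (?\<theta> f) z \<longleftrightarrow> degen ?\<Omega> (bdry_rep ?c (pot f)) z" if f: "f \<in> adm" and z: "z \<in> ?\<Omega>" for f z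
    proof -
      have "degen ?\<Omega> (?\<theta> f) z \<longleftrightarrow> degen ?\<Omega> (\<lambda>z. exp (1 * bdry_rep ?c (pot f) z)) z"
        by (rule degen_cong[OF _ z]) (rule \<theta>)
      also have "\<dots> \<longleftrightarrow> degen ?\<Omega> (bdry_rep ?c (pot f)) z"
        by (rule degen_exp[OF coO Cdiff_pot[OF c adm_Cfun[OF f]] z]) simp
      finally show ?thesis .
    qed
    have nd0: "\<not> degen ?\<Omega> (?\<theta> f0) z" if "z \<in> bset (K l)" for z
    proof -
      have z: "z \<in> ?\<Omega>" using that sub(2) by blast
      note b = bdry_image_bdry[OF c z]
      have "bdry_proj (snd ?c (inv_into (fst ?c) (snd ?c) (bdry_emb z))) = z" using snd_inv[OF c b(3)] by simp
      then show ?thesis using nd[OF c b(2,1)] deg[OF f0 z] by simp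
    qed
    have C\<theta>F: "\<forall>\<^sub>F f in F. Cdiff 2 ?\<Omega> (?\<theta> f)" using adm by eventually_elim (rule C\<theta>)
    have "\<forall>\<^sub>F f in F. \<forall>z\<in>bset (Q l). \<not> degen ?\<Omega> (?\<theta> f) z"
      by (rule not_degen_stable[OF coO sub(1) compact_bset[OF compact_K[OF l]] sub(2) C\<theta>[OF f0] C\<theta>F t\<theta> nd0])
    with adm show ?thesis by eventually_elim (use deg sub in blast)
  qed
  have "\<forall>\<^sub>F f in F. \<forall>l\<in>L. \<forall>z\<in>bset (Q l). \<not> degen (bdry_image (ch l)) (bdry_rep (ch l) (pot f)) z"
    using main finite_L by (simp add: eventually_ball_finite)
  then obtain P where P: "\<forall>\<^sub>F x in nhds 0. P x"
    "\<And>f. P (?N f) \<Longrightarrow> f \<in> adm \<Longrightarrow> \<forall>l\<in>L. \<forall>z\<in>bset (Q l). \<not> degen (bdry_image (ch l)) (bdry_rep (ch l) (pot f)) z"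
    unfolding F_def eventually_inf_principal eventually_filtercomap by blast
  obtain e where e: "e > 0" "\<And>x. dist x 0 < e \<Longrightarrow> P x" using P(1) unfolding eventually_nhds_metric by blast
  show ?thesis
  proof (intro exI[of _ e] conjI ballI impI e(1))
    fix f p assume f: "f \<in> adm" and N: "?N f < e" and p: "p \<in> bdry A"
    have pX: "p \<in> topspace X" using p topspace_eq unfolding bdry_def by blast
    then obtain l where l: "l \<in> L" "p \<in> V l" using cover unfolding admissible_cover_def by blast
    \<comment> \<open>The norm has to be seen to be non-negative, since \<open>e(2)\<close> asks for
      a bound on its distance from \<open>0\<close>.\<close>
    have "0 \<le> semi (conf f g - conf f0 g) l (\<lambda>_. 0) None None"
      by (rule semi_nonneg[OF l(1) component_minus_Cdiff[OF st[OF f] st[OF f0] ch_A[OF l(1)]]]) simp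
    also have "\<dots> \<le> ?N f"
      by (rule semi_le_Cnorm[OF l(1)]) (auto intro: component_minus_Cdiff[OF st[OF f] st[OF f0] ch_A])
    finally have "P (?N f)" using N e(2) by simp
    moreover have pc: "p \<in> fst (ch l)" using l V_fst by blast
    moreover have "bdry_proj (snd (ch l) p) \<in> bset (Q l)"
      using l(2) bdry_iff[OF ch_A[OF l(1)] pc] p by (simp add: bdry_emb_proj)
    ultimately show "\<exists>c\<in>A. p \<in> fst c \<and> \<not> degen (bdry_image c) (bdry_rep c (pot f)) (bdry_proj (snd c p))"
      using P(2)[OF _ f] l(1) ch_A[OF l(1)] by blast
  qed
qed

end

section \<open>Bump functions\<close>

text \<open>Away from \<open>0\<close> the function is locally a power or zero; at \<open>0\<close>
  the difference quotient is bounded by the \<open>n\<close>-th power of the absolute increment,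
  which tends to \<open>0\<close> since \<open>n\<close> is positive.\<close>

lemma DERIV_max_power:
  assumes n: "n \<ge> 1"
  shows "((\<lambda>t::real. max 0 t ^ Suc n) has_real_derivative real (Suc n) * max 0 t ^ n) (at t)"
proof -
  consider "t > 0" | "t < 0" | "t = 0" by linarith
  then show ?thesis
  proof cases
    case 1
    have "((\<lambda>t::real. t ^ Suc n) has_real_derivative real (Suc n) * t ^ n) (at t)"
      using DERIV_pow[of "Suc n" t] by simp
    then have "((\<lambda>t. max 0 t ^ Suc n) has_real_derivative real (Suc n) * t ^ n) (at t)"
      by (rule has_field_derivative_transform_within_open[of _ _ _ "{0<..}"]) (use 1 in simp_all)
    moreover have "max 0 t = t" using 1 by simp
    ultimately show ?thesis by (simp only:)
  next
    case 2
    have "((\<lambda>t::real. 0) has_real_derivative 0) (at t)" by simp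
    then have "((\<lambda>t. max 0 t ^ Suc n) has_real_derivative 0) (at t)"
      by (rule has_field_derivative_transform_within_open[of _ _ _ "{..<0}"]) (use 2 in simp_all)
    moreover have "real (Suc n) * max 0 t ^ n = 0" using 2 n by simp
    ultimately show ?thesis by (simp only:)
  next
    case 3
    have "((\<lambda>h::real. max 0 h ^ Suc n / h) \<longlongrightarrow> 0) (at 0)"
    proof (rule Lim_null_comparison)
      have "norm (max 0 h ^ Suc n / h) \<le> \<bar>h\<bar> ^ n" for h :: real
        by (cases "h \<le> 0") (auto simp: max_def abs_mult)
      then show "\<forall>\<^sub>F h in at 0. norm (max 0 h ^ Suc n / h) \<le> \<bar>h::real\<bar> ^ n" by (rule always_eventually[OF allI])
      show "((\<lambda>h::real. \<bar>h\<bar> ^ n) \<longlongrightarrow> 0) (at 0)"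
        using n by (auto intro!: tendsto_eq_intros)
    qed
    moreover have z: "(0::real) ^ n = 0" using n by (intro zero_power) simp
    ultimately show ?thesis using 3 by (simp add: DERIV_def z)
  qed
qed

text \<open>Each differentiation lowers the exponent by one, so an exponent above \<open>k\<close>
  survives \<open>k\<close> of them as a positive power.\<close>

lemma Cdiff_max_power:
  assumes S: "corner S" and u: "Cdiff k S u" and n: "k < n"
  shows "Cdiff k S (\<lambda>y. max 0 (u y) ^ n)"
  using u n
proof (induction k arbitrary: n)
  case 0 then show ?case by (auto intro!: continuous_intros)
next
  case (Suc k)
  then obtain n' where n': "n = Suc n'" "n' \<ge> 1" "k < n'" by (cases n) auto
  show ?case unfolding n'(1)
  proof (rule Cdiff_SucI[where h = "\<lambda>i y. real (Suc n') * max 0 (u y) ^ n' * pd S i u y"])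
    show "Cdiff k S (\<lambda>y. real (Suc n') * max 0 (u y) ^ n' * pd S i u y)" for i
      by (intro Cdiff_mult Cdiff_cmult S Suc.IH n'(3) Cdiff_SucD[OF Suc.prems(1)] Cdiff_pd[OF Suc.prems(1)])
    fix y assume y: "y \<in> S"
    note D = pd_compose[OF S y Cdiff_differentiable[OF Suc.prems(1) y] DERIV_max_power[OF n'(2)]]
    show "(\<lambda>y. max 0 (u y) ^ Suc n') differentiable (at y within S)" by (rule D(2))
    show "pd S i (\<lambda>y. max 0 (u y) ^ Suc n') y = real (Suc n') * max 0 (u y) ^ n' * pd S i u y" for i
      by (rule D(1))
  qed
qed

text \<open>Powers of positive parts give regularity of the finite order \<open>k\<close>, which
  suffices here. The squared distance is a polynomial, and since \<open>r / 2 < r\<close> the two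
  parts in the denominator never vanish together.\<close>

definition bump :: "nat \<Rightarrow> real^'n \<Rightarrow> real \<Rightarrow> real^'n \<Rightarrow> real" where
  "bump k x r y = (let t = (\<Sum>i\<in>UNIV. (y $ i - x $ i)\<^sup>2)
     in max 0 (r\<^sup>2 - t) ^ Suc k / (max 0 (r\<^sup>2 - t) ^ Suc k + max 0 (t - (r/2)\<^sup>2) ^ Suc k))"

lemma sum_squares_dist: "(\<Sum>i\<in>UNIV. (y $ i - x $ i)\<^sup>2) = (dist y x)\<^sup>2"
  by (simp add: dist_norm norm_vec_def L2_set_def sum_nonneg)

lemma Cdiff_bump:
  assumes S: "corner S" and r: "r > 0"
  shows "Cdiff k S (bump k x r)"
  unfolding bump_def Let_def
proof (intro Cdiff_divide S Cdiff_add Cdiff_max_power Cdiff_diff Cdiff_const Cdiff_sum Cdiff_power Cdiff_coord)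
  fix y
  let ?t = "\<Sum>i\<in>UNIV. (y $ i - x $ i)\<^sup>2"
  have "(r/2)\<^sup>2 < r\<^sup>2" using r by (intro power_strict_mono) auto
  then have "r\<^sup>2 - ?t > 0 \<or> ?t - (r/2)\<^sup>2 > 0" by linarith
  then have "max 0 (r\<^sup>2 - ?t) ^ Suc k > 0 \<or> max 0 (?t - (r/2)\<^sup>2) ^ Suc k > 0" by auto
  moreover have "max 0 (r\<^sup>2 - ?t) ^ Suc k \<ge> 0" "max 0 (?t - (r/2)\<^sup>2) ^ Suc k \<ge> 0" by auto
  ultimately show "max 0 (r\<^sup>2 - ?t) ^ Suc k + max 0 (?t - (r/2)\<^sup>2) ^ Suc k \<noteq> 0" by linarith
qed auto

lemma bump_one:
  assumes "r > 0" "dist y x \<le> r / 2"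
  shows "bump k x r y = 1"
proof -
  have t: "(dist y x)\<^sup>2 \<le> (r/2)\<^sup>2" using assms by (intro power_mono) auto
  moreover have "(r/2)\<^sup>2 < r\<^sup>2" using assms by (intro power_strict_mono) auto
  ultimately show ?thesis by (simp add: bump_def sum_squares_dist)
qed

lemma bump_zero:
  assumes "r > 0" "dist y x \<ge> r"
  shows "bump k x r y = 0"
proof -
  have "r\<^sup>2 \<le> (dist y x)\<^sup>2" using assms by (intro power_mono) auto
  then show ?thesis by (simp add: bump_def sum_squares_dist)
qed

lemma degen_add_linear:
  assumes S: "corner S" and w: "Cdiff 2 S w" and z: "z \<in> S"
  shows "degen S (\<lambda>z. w z - (\<Sum>k\<in>UNIV. a $ k * z $ k)) z \<longleftrightarrow> (\<forall>i. pd S i w z = a $ i) \<and> \<not> invertible (hess S w z)"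
proof -
  have w2: "Cdiff (Suc (Suc 0)) S w" using w by (simp add: numeral_2_eq_2)
  have dl: "(\<lambda>z. a $ k * z $ k) differentiable (at y within S)" for y k
    by (intro differentiable_mult differentiable_coord differentiable_const)
  have l: "pd S i (\<lambda>z. \<Sum>k\<in>UNIV. a $ k * z $ k) y = a $ i" if "y \<in> S" for i y
  proof -
    have "pd S i (\<lambda>z. \<Sum>k\<in>UNIV. a $ k * z $ k) y = (\<Sum>k\<in>UNIV. pd S i (\<lambda>z. a $ k * z $ k) y)"
      by (rule pd_sum[OF S that dl])
    also have "\<dots> = (\<Sum>k\<in>UNIV. if i = k then a $ k else 0)"
      by (intro sum.cong refl, subst pd_mult[OF S that differentiable_const differentiable_coord])
         (simp add: pd_const[OF S that] pd_coord[OF S that])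
    finally show ?thesis by simp
  qed
  have dsum: "(\<lambda>z. \<Sum>k\<in>UNIV. a $ k * z $ k) differentiable (at y within S)" for y
    by (intro differentiable_sum finite ballI dl)
  have 1: "pd S i (\<lambda>z. w z - (\<Sum>k\<in>UNIV. a $ k * z $ k)) y = pd S i w y - a $ i" if "y \<in> S" for i y
    using pd_diff[OF S that Cdiff_differentiable[OF w2 that] dsum, of i] l[OF that] by simp
  have "pd S i (pd S j (\<lambda>z. w z - (\<Sum>k\<in>UNIV. a $ k * z $ k))) z = pd S i (pd S j w) z" for i j
  proof -
    have "pd S i (pd S j (\<lambda>z. w z - (\<Sum>k\<in>UNIV. a $ k * z $ k))) z = pd S i (\<lambda>y. pd S j w y - a $ j) z"
      by (rule pd_cong[OF 1 z])
    also have "\<dots> = pd S i (pd S j w) z - pd S i (\<lambda>_. a $ j) z"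
      by (rule pd_diff[OF S z Cdiff_differentiable[OF Cdiff_pd[OF w2] z] differentiable_const])
    finally show ?thesis by (simp add: pd_const[OF S z])
  qed
  then have "hess S (\<lambda>z. w z - (\<Sum>k\<in>UNIV. a $ k * z $ k)) z = hess S w z" by (simp add: hess_def)
  then show ?thesis by (simp add: degen_def 1[OF z])
qed


section \<open>Density\<close>

context minimal_riemannian
begin

section \<open>Extension by zero from a chart\<close>

definition extend :: "('a, 'b) chart \<Rightarrow> (real^('b option) \<Rightarrow> real) \<Rightarrow> 'a \<Rightarrow> real" where
  "extend c E p = (if p \<in> fst c then E (snd c p) else 0)"

lemma extend_coord_rep: "c \<in> A \<Longrightarrow> y \<in> cimg c \<Longrightarrow> coord_rep c (extend c E) y = E y"
  by (simp add: coord_rep_def extend_def inv_fst snd_inv)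

text \<open>The compact set that carries \<open>E\<close> has a closed preimage in the manifold, so
  its complement is a neighbourhood of the point outside the chart on which the extension
  vanishes.\<close>

lemma extend_zero_near:
  assumes c: "c \<in> A" and K: "compact K" "K \<subseteq> cimg c" "\<forall>y\<in>cimg c - K. E y = 0"
    and c': "c' \<in> A" "p \<in> fst c'" "p \<notin> fst c"
  shows "\<exists>U. openin (top_of_set (cimg c')) U \<and> snd c' p \<in> U \<and> (\<forall>y\<in>U. coord_rep c' (extend c E) y = 0)"
proof -
  let ?Z = "{p \<in> fst c. snd c p \<in> K}"
  have "openin X (topspace X - ?Z)" using closed_preimage[OF c K(1,2)] by blast
  from open_image[OF c'(1) this]
  have "openin (top_of_set (cimg c')) (snd c' ` (fst c' \<inter> (topspace X - ?Z)))" .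
  moreover have "snd c' p \<in> snd c' ` (fst c' \<inter> (topspace X - ?Z))"
    using c' fst_subset[OF c'(1)] by blast
  moreover have "coord_rep c' (extend c E) y = 0" if y: "y \<in> snd c' ` (fst c' \<inter> (topspace X - ?Z))" for y
  proof -
    obtain q where q: "q \<in> fst c'" "q \<notin> ?Z" "y = snd c' q" using y by blast
    have "extend c E q = 0" using K(3) q(2) by (simp add: extend_def)
    then show ?thesis using coord_rep_snd[OF c'(1) q(1), of "extend c E"] q(3) by simp
  qed
  ultimately show ?thesis by blast
qed

lemma extend_Cfun:
  assumes c: "c \<in> A" and K: "compact K" "K \<subseteq> cimg c" "\<forall>y\<in>cimg c - K. E y = 0"
    and E: "Cdiff m (cimg c) E"
  shows "extend c E \<in> Cfun m A"
  unfolding Cfun_def mem_Collect_eq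
proof
  fix c' assume c': "c' \<in> A"
  show "Cdiff m (cimg c') (coord_rep c' (extend c E))"
  proof (rule Cdiff_local)
    fix y assume "y \<in> cimg c'"
    then obtain p where p: "p \<in> fst c'" "y = snd c' p" by blast
    show "\<exists>U. openin (top_of_set (cimg c')) U \<and> y \<in> U \<and> Cdiff m U (coord_rep c' (extend c E))"
    proof (cases "p \<in> fst c")
      case True
      have "Cdiff m (ov c' c) (\<lambda>y. E (tr c' c y))"
        by (rule Cdiff_chain[OF corner_ov[OF c' c] Cdiff_tr[OF c' c] _ E]) (use tr_ov[OF c', of _ c] in blast)
      moreover have "coord_rep c' (extend c E) y = E (tr c' c y)" if "y \<in> ov c' c" for y
      proof -
        have "tr c' c y \<in> cimg c" using tr_ov[OF c' that] by blast
        then show ?thesis using coord_rep_tr[OF c' c that, of "extend c E"] extend_coord_rep[OF c] by simp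
      qed
      ultimately have "Cdiff m (ov c' c) (coord_rep c' (extend c E))"
        by (rule Cdiff_cong[THEN iffD2, rotated])
      then show ?thesis using openin_ov(1)[OF c' c] True p by blast
    next
      case False
      obtain U where U: "openin (top_of_set (cimg c')) U" "snd c' p \<in> U" "\<forall>y\<in>U. coord_rep c' (extend c E) y = 0"
        using extend_zero_near[OF c K c' p(1) False] by (elim exE conjE)
      have "Cdiff m U (\<lambda>_. 0)" by (rule Cdiff_const[OF corner_openin[OF corner_cimg[OF c'] U(1)]])
      then have "Cdiff m U (coord_rep c' (extend c E))"
        by (rule Cdiff_cong[THEN iffD2, rotated]) (rule U(3)[rule_format])
      then show ?thesis using U(1,2) p(2) by blast
    qed
  qed
qed

text \<open>The normal derivative is controlled in the chart \<open>c\<close> only;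
  \<open>normal_deriv_chart\<close> carries this to other charts, and outside the domain of
  \<open>c\<close> the extension vanishes locally.\<close>

lemma extend_adm:
  assumes c: "c \<in> A" and K: "compact K" "K \<subseteq> cimg c" "\<forall>y\<in>cimg c - K. E y = 0"
    and E: "Cdiff m (cimg c) E"
    and N: "\<And>p. p \<in> fst c \<Longrightarrow> p \<in> bdry A \<Longrightarrow> (\<Sum>l\<in>UNIV. pd (cimg c) l E (snd c p) * matrix_inv (g c p) $ l $ None) = 0"
  shows "extend c E \<in> adm"
  unfolding adm_def mem_Collect_eq
proof (intro conjI ballI)
  show F: "extend c E \<in> Cfun m A" by (rule extend_Cfun[OF c K E])
  fix c' p assume c': "c' \<in> A" and p: "p \<in> fst c' \<inter> bdry A"
  show "normal_deriv g c' (extend c E) p = 0"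
  proof (cases "p \<in> fst c")
    case True
    have "pd (cimg c) l (coord_rep c (extend c E)) (snd c p) = pd (cimg c) l E (snd c p)" for l
      by (rule pd_cong) (use extend_coord_rep[OF c] True in auto)
    then have "normal_deriv g c (extend c E) p = 0"
      using N[OF True] p by (simp add: normal_deriv_def)
    then show ?thesis using normal_deriv_chart[OF c c' True _ _ F] p by simp
  next
    case False
    have p': "p \<in> fst c'" using p by blast
    obtain U where U: "openin (top_of_set (cimg c')) U" "snd c' p \<in> U" "\<forall>y\<in>U. coord_rep c' (extend c E) y = 0"
      using extend_zero_near[OF c K c' p' False] by (elim exE conjE)
    have "pd (cimg c') l (coord_rep c' (extend c E)) (snd c' p) = 0" for l
    proof -
      have "pd (cimg c') l (coord_rep c' (extend c E)) (snd c' p) = pd U l (coord_rep c' (extend c E)) (snd c' p)"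
        by (rule pd_subset[OF U(1,2), symmetric])
      also have "\<dots> = pd U l (\<lambda>_. 0) (snd c' p)" by (rule pd_cong[OF U(3)[rule_format] U(2)])
      also have "\<dots> = 0" by (rule pd_const[OF corner_openin[OF corner_cimg[OF c'] U(1)] U(2)])
      finally show ?thesis .
    qed
    then show ?thesis by (simp add: normal_deriv_def)
  qed
qed

text \<open>Three concentric half-balls are in play: the one of radius \<open>r\<close> carries the
  perturbation, on that of radius \<open>r / 2\<close> its boundary values are exactly a coordinate,
  and that of radius \<open>r / 3\<close> is to be freed of degenerate critical points.\<close>

definition piece :: "('a, 'b) chart \<times> (real^('b option)) \<times> real \<Rightarrow> bool" where
  "piece = (\<lambda>(c, x, r). c \<in> A \<and> r > 0 \<and> cball x r \<inter> halfspace \<subseteq> cimg c)"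

text \<open>The second summand removes the normal derivative along the boundary, without changing the values
  on the boundary.\<close>

definition pert_rep :: "('a, 'b) chart \<Rightarrow> real^('b option) \<Rightarrow> real \<Rightarrow> 'b \<Rightarrow> real^('b option) \<Rightarrow> real" where
  "pert_rep c x r k = (let \<psi> = (\<lambda>y. bump (Suc m) x r y * y $ Some k) in
     (\<lambda>y. \<psi> y - y $ None * (\<Sum>l\<in>UNIV. pd (cimg c) l \<psi> y * coord_rep c (\<lambda>p. matrix_inv (g c p) $ l $ None) y)
        / coord_rep c (\<lambda>p. matrix_inv (g c p) $ None $ None) y))"

lemma pert_rep_bdry:
  assumes "r > 0" "y $ None = 0" "dist y x \<le> r / 2"
  shows "pert_rep c x r k y = y $ Some k"
  using assms by (simp add: pert_rep_def bump_one)

lemma pert_adm: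
  assumes c: "c \<in> A" and r: "r > 0" and x: "cball x r \<inter> halfspace \<subseteq> cimg c"
  shows "extend c (pert_rep c x r k) \<in> adm"
proof -
  let ?S = "cimg c" and ?\<psi> = "\<lambda>y. bump (Suc m) x r y * y $ Some k"
  let ?n = "\<lambda>l. coord_rep c (\<lambda>p. matrix_inv (g c p) $ l $ None)"
  let ?w = "\<lambda>y. (\<Sum>l\<in>UNIV. pd ?S l ?\<psi> y * ?n l y) / ?n None y"
  have E: "pert_rep c x r k = (\<lambda>y. ?\<psi> y - y $ None * ?w y)" by (simp add: pert_rep_def Let_def)
  note co = corner_cimg[OF c]
  \<comment> \<open>One order more than \<open>m\<close>, because the correction term contains a
    derivative of \<psi>.\<close>
  have C\<psi>: "Cdiff (Suc m) ?S ?\<psi>" by (intro Cdiff_mult co Cdiff_bump Cdiff_coord r)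
  have n0: "?n None y > 0" if "y \<in> ?S" for y
    using pos_def_diag[OF pos_def_matrix_inv[OF g_pos_def[OF c inv_fst[OF c that]]], of None] by (simp add: coord_rep_def)
  have Cw: "Cdiff m ?S ?w"
  proof (rule Cdiff_divide[OF co _ Cdiff_ginv[OF c]])
    show "?n None y \<noteq> 0" if "y \<in> ?S" for y using n0[OF that] by simp
  qed (intro Cdiff_sum Cdiff_mult co Cdiff_ginv c Cdiff_pd[OF C\<psi>])
  have CE: "Cdiff m ?S (pert_rep c x r k)"
    unfolding E by (intro Cdiff_diff Cdiff_mult Cdiff_coord co Cw) (rule Cdiff_SucD[OF Cdiff_bump[OF co r]])
  show ?thesis
  proof (rule extend_adm[OF c _ x _ CE])
    have "closed (halfspace :: (real^('b option)) set)"
      unfolding halfspace_def by (intro closed_Collect_le continuous_intros)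
    then show "compact (cball x r \<inter> halfspace)" by (intro compact_Int_closed) auto
  next
    show "\<forall>y\<in>?S - cball x r \<inter> halfspace. pert_rep c x r k y = 0"
  proof
    fix y assume "y \<in> ?S - cball x r \<inter> halfspace"
    then have y: "y \<in> ?S" "y \<notin> cball x r \<inter> halfspace" by blast+
    then have "y \<in> halfspace" using openin_subset[OF openin_cimg[OF c]] by auto
    then have yr: "y \<in> ?S \<inter> - cball x r" using y by blast
    have U: "openin (top_of_set ?S) (?S \<inter> - cball x r)" by (intro openin_open_Int) auto
    have z: "?\<psi> y = 0" if "y \<in> ?S \<inter> - cball x r" for y
    proof -
      have "bump (Suc m) x r y = 0" by (rule bump_zero[OF r]) (use that in \<open>simp add: dist_commute\<close>)
      then show ?thesis by simp
    qed
    have "pd ?S l ?\<psi> y = 0" for l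
    proof -
      have "pd ?S l ?\<psi> y = pd (?S \<inter> - cball x r) l ?\<psi> y" by (rule pd_subset[OF U yr, symmetric])
      also have "\<dots> = pd (?S \<inter> - cball x r) l (\<lambda>_. 0) y" by (rule pd_cong[OF z yr])
      also have "\<dots> = 0" by (rule pd_const[OF corner_openin[OF co U] yr])
      finally show ?thesis .
    qed
    then show "pert_rep c x r k y = 0" unfolding E using z[OF yr] by simp
  qed
  next
    fix p assume p: "p \<in> fst c" "p \<in> bdry A"
    let ?y = "snd c p"
    have y: "?y \<in> ?S" "?y $ None = 0" using p bdry_iff[OF c p(1)] by auto
    obtain m' where m': "m = Suc m'" using m by (cases m) auto
    have dw: "?w differentiable (at ?y within ?S)" using Cw y(1) unfolding m' by (rule Cdiff_differentiable)
    have d\<psi>: "?\<psi> differentiable (at ?y within ?S)" using C\<psi> y(1) by (rule Cdiff_differentiable)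
    have dN: "(\<lambda>y. y $ None * ?w y) differentiable (at ?y within ?S)"
      by (rule differentiable_mult[OF differentiable_coord dw])
    \<comment> \<open>Where the coordinate \<open>None\<close> vanishes, the correction contributes
      only to the derivative in direction \<open>None\<close>. Its quotient is normalized so that
      contraction with the normal cancels the normal derivative of \<psi>.\<close>
    have "pd ?S l (pert_rep c x r k) ?y = pd ?S l ?\<psi> ?y - (if l = None then ?w ?y else 0)" for l
      unfolding E pd_diff[OF co y(1) d\<psi> dN] pd_mult[OF co y(1) differentiable_coord dw] pd_coord[OF co y(1)]
      using y(2) by simp
    then have "(\<Sum>l\<in>UNIV. pd ?S l (pert_rep c x r k) ?y * ?n l ?y)
        = (\<Sum>l\<in>UNIV. pd ?S l ?\<psi> ?y * ?n l ?y) - ?w ?y * ?n None ?y"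
      by (simp add: left_diff_distrib sum_subtractf if_distrib[of "\<lambda>x. x * _"] cong: if_cong)
    also have "\<dots> = 0" using n0[OF y(1)] by simp
    finally show "(\<Sum>l\<in>UNIV. pd ?S l (pert_rep c x r k) ?y * matrix_inv (g c p) $ l $ None) = 0"
      by (simp add: coord_rep_snd[OF c p(1)])
  qed
qed

definition pert :: "('a, 'b) chart \<times> (real^('b option)) \<times> real \<Rightarrow> 'b \<Rightarrow> 'a \<Rightarrow> real" where
  "pert = (\<lambda>(c, x, r) k. extend c (pert_rep c x r k))"

lemma adm_add_sum:
  fixes a :: "real^'b"
  assumes f: "f \<in> adm" and F: "\<And>k. F k \<in> adm"
  shows "(\<lambda>p. f p + (\<Sum>k\<in>UNIV. a $ k * F k p)) \<in> adm"
  unfolding adm_def mem_Collect_eq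
proof (intro conjI ballI)
  let ?f = "\<lambda>p. f p + (\<Sum>k\<in>UNIV. a $ k * F k p)"
  have cr: "coord_rep c ?f = (\<lambda>y. coord_rep c f y + (\<Sum>k\<in>UNIV. a $ k * coord_rep c (F k) y))" for c :: "('a, 'b) chart"
    by (simp add: coord_rep_def)
  show "?f \<in> Cfun m A"
    unfolding Cfun_def mem_Collect_eq cr
    by (intro ballI Cdiff_add Cdiff_sum Cdiff_cmult corner_cimg Cfun_Cdiff adm_Cfun f F)
  fix c p assume c: "c \<in> A" and p: "p \<in> fst c \<inter> bdry A"
  let ?S = "cimg c" and ?y = "snd c p"
  note co = corner_cimg[OF c]
  have y: "?y \<in> ?S" using p by blast
  have dF: "coord_rep c (F k) differentiable (at ?y within ?S)" for k by (rule Cfun_differentiable[OF adm_Cfun[OF F] c y])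
  have df: "coord_rep c f differentiable (at ?y within ?S)" by (rule Cfun_differentiable[OF adm_Cfun[OF f] c y])
  have daF: "(\<lambda>y. a $ k * coord_rep c (F k) y) differentiable (at ?y within ?S)" for k
    by (intro differentiable_mult dF differentiable_const)
  have ds: "(\<lambda>y. \<Sum>k\<in>UNIV. a $ k * coord_rep c (F k) y) differentiable (at ?y within ?S)"
    by (intro differentiable_sum finite ballI daF)
  have "pd ?S l (\<lambda>y. a $ k * coord_rep c (F k) y) ?y = a $ k * pd ?S l (coord_rep c (F k)) ?y" for k l
    by (subst pd_mult[OF co y differentiable_const dF]) (simp add: pd_const[OF co y])
  then have "pd ?S l (coord_rep c ?f) ?y = pd ?S l (coord_rep c f) ?y + (\<Sum>k\<in>UNIV. a $ k * pd ?S l (coord_rep c (F k)) ?y)" for l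
    unfolding cr pd_add[OF co y df ds] pd_sum[OF co y daF] by simp
  then have "normal_deriv g c ?f p = normal_deriv g c f p
      + (\<Sum>l\<in>UNIV. \<Sum>k\<in>UNIV. a $ k * (pd ?S l (coord_rep c (F k)) ?y * matrix_inv (g c p) $ l $ None))"
    by (simp add: normal_deriv_def distrib_right sum.distrib sum_distrib_right mult.assoc)
  also have "(\<Sum>l\<in>UNIV. \<Sum>k\<in>UNIV. a $ k * (pd ?S l (coord_rep c (F k)) ?y * matrix_inv (g c p) $ l $ None))
      = (\<Sum>k\<in>UNIV. a $ k * normal_deriv g c (F k) p)"
    unfolding normal_deriv_def sum_distrib_left by (rule sum.swap)
  finally show "normal_deriv g c ?f p = 0" using f F c p by (simp add: adm_def)
qed

end

section \<open>Removing degenerate critical points by small perturbations\<close>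

context conformal_setting
begin

text \<open>The difference of the two metrics is the fixed metric \<open>conf f g\<close> times
  \<open>exp u - 1\<close>, where the exponent \<open>u\<close> is linear in \<open>a\<close> with
  coefficients of class C^m.\<close>

lemma conf_pert_tendsto:
  assumes f: "f \<in> adm" and F: "\<And>k. F k \<in> adm"
  shows "((\<lambda>a :: real^'b. Cnorm m L V ch (conf (\<lambda>p. f p + (\<Sum>k\<in>UNIV. a $ k * F k p)) g - conf f g)) \<longlongrightarrow> 0) (nhds 0)"
proof (rule Cnorm_tendsto_0)
  fix l i j assume l: "l \<in> L"
  have c: "ch l \<in> A" by (rule ch_A[OF l])
  note co = corner_cimg[OF c]
  let ?u = "\<lambda>(a :: real^'b) y. \<Sum>k\<in>UNIV. 2 * a $ k * coord_rep (ch l) (F k) y"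
  have CF: "Cdiff m (S l) (coord_rep (ch l) (F k))" for k by (rule Cfun_Cdiff[OF adm_Cfun[OF F] c])
  have a0: "((\<lambda>a :: real^'b. 2 * a $ k) \<longlongrightarrow> 0) (nhds 0)" for k
    by (auto intro!: tendsto_eq_intros filterlim_ident)
  have Cu: "Cdiff m (S l) (?u a)" for a by (intro Cdiff_sum Cdiff_cmult co CF)
  have tu: "Ctends m (Q l) (S l) ?u (nhds 0)"
  proof (rule Ctends_sum[OF co Q_S[OF l] finite])
    show "Ctends m (Q l) (S l) (\<lambda>a y. 2 * a $ k * coord_rep (ch l) (F k) y) (nhds 0)" for k
      by (rule Ctends_cmult[OF co Q_K[OF l] compact_K[OF l] K_S[OF l] CF a0])
  qed (intro Cdiff_cmult co CF)
  have te: "Ctends m (Q l) (S l) (\<lambda>a y. exp (?u a y) - 1) (nhds 0)"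
    by (rule Ctends_exp[OF co Q_S[OF l] always_eventually[OF allI[OF Cu]] tu])
  have Ce: "\<forall>\<^sub>F a in nhds 0. Cdiff m (S l) (\<lambda>y. exp (?u a y) - 1)"
    by (intro always_eventually allI Cdiff_diff Cdiff_exp Cdiff_const co Cu)
  have "Ctends m (Q l) (S l) (\<lambda>a y. component (conf f g) (ch l) i j y * (exp (?u a y) - 1)) (nhds 0)"
    by (rule Ctends_mult_fixed[OF co Q_K[OF l] compact_K[OF l] K_S[OF l] component_Cdiff[OF conf_sym_tensors[OF adm_Cfun[OF f]] c] Ce te])
  moreover have "component (conf f g) (ch l) i j y * (exp (?u a y) - 1)
      = component (conf (\<lambda>p. f p + (\<Sum>k\<in>UNIV. a $ k * F k p)) g - conf f g) (ch l) i j y" for a y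
  proof -
    have "2 * coord_rep (ch l) (\<lambda>p. f p + (\<Sum>k\<in>UNIV. a $ k * F k p)) y = 2 * coord_rep (ch l) f y + ?u a y"
      by (simp add: coord_rep_def sum_distrib_left mult.assoc)
    then have e: "exp (2 * coord_rep (ch l) (\<lambda>p. f p + (\<Sum>k\<in>UNIV. a $ k * F k p)) y) = exp (2 * coord_rep (ch l) f y) * exp (?u a y)"
      by (simp only: exp_add)
    show ?thesis unfolding component_minus unfolding component_def conf_coord_rep e by (simp add: right_diff_distrib)
  qed
  ultimately show "Ctends m (Q l) (S l) (\<lambda>a. component (conf (\<lambda>p. f p + (\<Sum>k\<in>UNIV. a $ k * F k p)) g - conf f g) (ch l) i j) (nhds 0)"
    by simp
qed

definition good :: "('a \<Rightarrow> real) \<Rightarrow> ('a, 'b) chart \<times> (real^('b option)) \<times> real \<Rightarrow> bool" where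
  "good f = (\<lambda>(c, x, r). \<forall>z\<in>bset (cball x (r / 3)). \<not> degen (bdry_image c) (bdry_rep c (pot f)) z)"

lemma piece_bset:
  assumes "cball x r \<inter> halfspace \<subseteq> cimg c" "r > 0"
  shows "bset (cball x (r / 3)) \<subseteq> bdry_image c"
proof
  fix z assume "z \<in> bset (cball x (r / 3))"
  then have "bdry_emb z \<in> cball x r \<inter> halfspace" using assms(2) bdry_emb_halfspace by auto
  then show "z \<in> bdry_image c" using assms(1) by (auto simp: bdry_image_def)
qed

lemma pot_pert_rep:
  "bdry_rep c (pot (\<lambda>p. f p + (\<Sum>k\<in>UNIV. a $ k * F k p))) z
    = bdry_rep c (pot f) z + (\<Sum>k\<in>UNIV. 2 * a $ k * bdry_rep c (F k) z)"
  unfolding pot_rep by (simp add: bdry_rep_def coord_rep_def sum_distrib_left mult.assoc)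

text \<open>The potential depends on \<open>a\<close> through a linear combination of fixed
  functions, so its 2-jet converges uniformly on the closed half-ball, which is compact.\<close>

lemma good_stable:
  assumes f: "f \<in> adm" and F: "\<And>k. F k \<in> adm" and \<pi>: "piece \<pi>" "good f \<pi>"
  shows "\<forall>\<^sub>F a :: real^'b in nhds 0. good (\<lambda>p. f p + (\<Sum>k\<in>UNIV. a $ k * F k p)) \<pi>"
proof -
  obtain c x r where pi: "\<pi> = (c, x, r)" by (cases \<pi>) auto
  have c: "c \<in> A" and r: "r > 0" and x: "cball x r \<inter> halfspace \<subseteq> cimg c" using \<pi>(1) by (auto simp: pi piece_def)
  let ?\<Omega> = "bdry_image c" and ?K = "bset (cball x (r / 3))"
  let ?f = "\<lambda>(a :: real^'b) p. f p + (\<Sum>k\<in>UNIV. a $ k * F k p)"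
  note co = corner_open[OF open_bdry_image[OF c]]
  have K: "compact ?K" "?K \<subseteq> ?\<Omega>" using compact_bset[OF compact_cball] piece_bset[OF x r] by blast+
  have CF: "Cdiff 2 ?\<Omega> (bdry_rep c (F k))" for k
    using m by (intro Cdiff_bdry_rep c Cdiff_mono[OF Cfun_Cdiff[OF adm_Cfun[OF F] c]]) simp
  have a0: "((\<lambda>a :: real^'b. 2 * a $ k) \<longlongrightarrow> 0) (nhds 0)" for k
    by (auto intro!: tendsto_eq_intros filterlim_ident)
  have t: "Ctends 2 ?K ?\<Omega> (\<lambda>a z. \<Sum>k\<in>UNIV. 2 * a $ k * bdry_rep c (F k) z) (nhds 0)"
  proof (rule Ctends_sum[OF co K(2) finite])
    show "Ctends 2 ?K ?\<Omega> (\<lambda>a z. 2 * a $ k * bdry_rep c (F k) z) (nhds 0)" for k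
      by (rule Ctends_cmult[OF co order_refl K CF a0])
  qed (intro Cdiff_cmult co CF)
  have "\<forall>\<^sub>F a in nhds 0. \<forall>z\<in>?K. \<not> degen ?\<Omega> (bdry_rep c (pot (?f a))) z"
  proof (rule not_degen_stable[OF co order_refl K Cdiff_pot[OF c adm_Cfun[OF f]]])
    show "\<forall>\<^sub>F a in nhds 0. Cdiff 2 ?\<Omega> (bdry_rep c (pot (?f a)))"
      by (intro always_eventually allI Cdiff_pot[OF c adm_Cfun[OF adm_add_sum[OF f F]]])
    show "Ctends 2 ?K ?\<Omega> (\<lambda>a z. bdry_rep c (pot (?f a)) z - bdry_rep c (pot f) z) (nhds 0)"
      unfolding pot_pert_rep using t by simp
    show "\<not> degen ?\<Omega> (bdry_rep c (pot f)) z" if "z \<in> ?K" for z using \<pi>(2) that by (auto simp: good_def pi)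
  qed
  then show ?thesis by (simp add: good_def pi)
qed

lemma good_perturbation:
  assumes f: "f \<in> adm" and \<pi>: "piece \<pi>" and \<delta>: "\<delta> > 0"
  obtains a :: "real^'b" where "norm a < \<delta>" "good (\<lambda>p. f p + (\<Sum>k\<in>UNIV. a $ k * pert \<pi> k p)) \<pi>"
proof -
  obtain c x r where pi: "\<pi> = (c, x, r)" by (cases \<pi>) auto
  have c: "c \<in> A" and r: "r > 0" and x: "cball x r \<inter> halfspace \<subseteq> cimg c" using \<pi> by (auto simp: pi piece_def)
  let ?\<Omega> = "bdry_image c" and ?w = "bdry_rep c (pot f)"
  \<comment> \<open>Open, so that Sard's theorem applies, and within the region where the
    perturbation is exactly linear on the boundary.\<close>
  let ?U = "bset (ball x (r / 2) \<inter> halfspace)"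
  have op: "open ?U" by (rule open_bset) (auto simp: openin_open)
  have U: "?U \<subseteq> ?\<Omega>"
  proof
    fix z assume "z \<in> ?U"
    then have "bdry_emb z \<in> cball x r \<inter> halfspace" using r by auto
    then show "z \<in> ?\<Omega>" using x by (auto simp: bdry_image_def)
  qed
  have opin: "openin (top_of_set ?\<Omega>) ?U" using op U by (auto simp: openin_open intro!: exI[of _ ?U])
  note co = corner_open[OF op]
  have Cw: "Cdiff 2 ?U ?w" by (rule Cdiff_openin[OF opin Cdiff_pot[OF c adm_Cfun[OF f]]])
  obtain b :: "real^'b" where b: "norm b < \<delta>" "\<forall>z\<in>?U. (\<forall>i. pd ?U i ?w z = b $ i) \<longrightarrow> invertible (hess ?U ?w z)"
    by (rule ex_small_regular_gradient[OF op Cw \<delta>]) blast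
  \<comment> \<open>The potential contains \<open>2 * f\<close>, and the linear form with
    coefficients \<open>b\<close> is to be subtracted from it.\<close>
  define a where "a = (- 1 / 2) *\<^sub>R b"
  let ?f = "\<lambda>p. f p + (\<Sum>k\<in>UNIV. a $ k * pert \<pi> k p)"
  have rep: "bdry_rep c (pot ?f) z = ?w z - (\<Sum>k\<in>UNIV. b $ k * z $ k)" if z: "z \<in> ?U" for z
  proof -
    have "bdry_rep c (pert \<pi> k) z = z $ k" for k
    proof -
      have "bdry_emb z \<in> cimg c" using z U by (auto simp: bdry_image_def)
      then have "bdry_rep c (pert \<pi> k) z = pert_rep c x r k (bdry_emb z)"
        by (simp add: bdry_rep_def pert_def pi extend_coord_rep[OF c])
      also have "\<dots> = z $ k" using z by (subst pert_rep_bdry[OF r]) (auto simp: dist_commute)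
      finally show ?thesis .
    qed
    then show ?thesis unfolding pot_pert_rep by (simp add: a_def sum_negf)
  qed
  have "\<not> degen ?\<Omega> (bdry_rep c (pot ?f)) z" if "z \<in> bset (cball x (r / 3))" for z
  proof -
    have z: "z \<in> ?U" using that r bdry_emb_halfspace by auto
    have "\<not> degen ?U (\<lambda>z. ?w z - (\<Sum>k\<in>UNIV. b $ k * z $ k)) z"
      using degen_add_linear[OF co Cw z] b(2) z by blast
    then have "\<not> degen ?U (bdry_rep c (pot ?f)) z" using degen_cong[OF rep z] by simp
    then show ?thesis using degen_openin[OF opin z] by simp
  qed
  then have "good ?f \<pi>" by (simp add: good_def pi)
  moreover have "norm a < \<delta>" using b(1) by (simp add: a_def) (use norm_ge_zero[of b] in linarith)
  ultimately show ?thesis using that by blast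
qed

lemma good_dense:
  assumes "finite P" "\<And>\<pi>. \<pi> \<in> P \<Longrightarrow> piece \<pi>" "f \<in> adm" "e > 0"
  shows "\<exists>f'\<in>adm. Cnorm m L V ch (conf f' g - conf f g) < e \<and> (\<forall>\<pi>\<in>P. good f' \<pi>)"
  using assms
proof (induction P arbitrary: e)
  case empty
  have "Cnorm m L V ch (conf f g - conf f g) < e" unfolding Cnorm_self by (rule empty.prems(3))
  then show ?case using empty.prems(2) by blast
next
  case (insert \<pi> P)
  obtain f1 where f1: "f1 \<in> adm" "Cnorm m L V ch (conf f1 g - conf f g) < e / 2" "\<And>\<pi>. \<pi> \<in> P \<Longrightarrow> good f1 \<pi>"
  proof -
    have "\<exists>f'\<in>adm. Cnorm m L V ch (conf f' g - conf f g) < e / 2 \<and> (\<forall>\<pi>\<in>P. good f' \<pi>)"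
      by (rule insert.IH) (use insert.prems in simp_all)
    then show ?thesis using that by blast
  qed
  have pi: "piece \<pi>" using insert.prems by simp
  have F: "pert \<pi> k \<in> adm" for k
    using pi pert_adm by (cases \<pi>) (auto simp: piece_def pert_def)
  let ?f = "\<lambda>(a :: real^'b) p. f1 p + (\<Sum>k\<in>UNIV. a $ k * pert \<pi> k p)"
  have "\<forall>\<^sub>F a in nhds 0. \<forall>\<pi>'\<in>P. good (?f a) \<pi>'"
    using insert.hyps(1) insert.prems(1) f1(3) by (intro eventually_ball_finite ballI good_stable[OF f1(1) F]) auto
  moreover have "\<forall>\<^sub>F a in nhds 0. dist (Cnorm m L V ch (conf (?f a) g - conf f1 g)) 0 < e / 2"
    by (rule tendstoD[OF conf_pert_tendsto[where F = "pert \<pi>", OF f1(1) F]]) (use insert.prems(3) in simp)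
  ultimately have "\<forall>\<^sub>F a in nhds 0. (\<forall>\<pi>'\<in>P. good (?f a) \<pi>') \<and> Cnorm m L V ch (conf (?f a) g - conf f1 g) < e / 2"
    by eventually_elim auto
  \<comment> \<open>The smallness threshold is fixed before \<open>good_perturbation\<close> selects
    \<open>a\<close>. It preserves the other half-balls and keeps the second half of the error
    budget \<open>e\<close>.\<close>
  then obtain \<delta> where \<delta>: "\<delta> > 0" "\<And>a. dist a 0 < \<delta> \<Longrightarrow> (\<forall>\<pi>'\<in>P. good (?f a) \<pi>') \<and> Cnorm m L V ch (conf (?f a) g - conf f1 g) < e / 2"
    unfolding eventually_nhds_metric by blast
  obtain a :: "real^'b" where a: "norm a < \<delta>" "good (?f a) \<pi>" by (rule good_perturbation[OF f1(1) pi \<delta>(1)])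
  have adm: "?f a \<in> adm" by (rule adm_add_sum[OF f1(1) F])
  have a': "\<forall>\<pi>'\<in>P. good (?f a) \<pi>'" "Cnorm m L V ch (conf (?f a) g - conf f1 g) < e / 2"
    using \<delta>(2)[of a] a(1) by simp_all
  have "Cnorm m L V ch (conf (?f a) g - conf f g) \<le> Cnorm m L V ch (conf (?f a) g - conf f1 g) + Cnorm m L V ch (conf f1 g - conf f g)"
    by (intro Cnorm_triangle conf_sym_tensors adm_Cfun adm f1 insert.prems)
  then have "Cnorm m L V ch (conf (?f a) g - conf f g) < e" using a'(2) f1(2) by linarith
  moreover have "\<forall>\<pi>'\<in>insert \<pi> P. good (?f a) \<pi>'" using a(2) a'(1) by blast
  ultimately show ?case by (intro bexI[OF _ adm] conjI)
qed

lemma ex_pieces: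
  obtains P where "finite P" "\<And>\<pi>. \<pi> \<in> P \<Longrightarrow> piece \<pi>"
    "\<And>p. p \<in> bdry A \<Longrightarrow> \<exists>(c, x, r)\<in>P. p \<in> fst c \<and> dist x (snd c p) < r / 3"
proof -
  let ?U = "\<lambda>(c :: ('a, 'b) chart, x, r). {p \<in> fst c. snd c p \<in> ball x (r / 3)}"
  have "\<exists>\<F>. finite \<F> \<and> \<F> \<subseteq> ?U ` Collect piece \<and> bdry A \<subseteq> \<Union>\<F>"
  proof (rule compactin_bdry[unfolded compactin_def, THEN conjunct2, rule_format], intro conjI ballI)
    fix W assume "W \<in> ?U ` Collect piece"
    then obtain c x r where "piece (c, x, r)" "W = {p \<in> fst c. snd c p \<in> ball x (r / 3)}" by auto
    moreover from this have "openin X {p \<in> fst c. snd c p \<in> ball x (r / 3)}"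
      by (intro open_preimage) (simp_all add: piece_def)
    ultimately show "openin X W" by (simp only:)
  next
    show "bdry A \<subseteq> \<Union> (?U ` Collect piece)"
    proof
      fix p assume "p \<in> bdry A"
      then obtain c where c: "c \<in> A" "p \<in> fst c" by (auto simp: bdry_def)
      obtain W where W: "open W" "cimg c = halfspace \<inter> W" using openin_cimg[OF c(1)] by (auto simp: openin_open)
      have "snd c p \<in> W" using c(2) W(2) by blast
      then obtain r where r: "r > 0" "cball (snd c p) r \<subseteq> W" using W(1) open_contains_cball by blast
      have "piece (c, snd c p, r)" unfolding piece_def using c r W(2) by blast
      moreover have "p \<in> ?U (c, snd c p, r)" using c r by simp
      ultimately show "p \<in> \<Union> (?U ` Collect piece)" by blast
    qed
  qed
  then obtain \<F> where \<F>: "finite \<F>" "\<F> \<subseteq> ?U ` Collect piece" "bdry A \<subseteq> \<Union>\<F>" by blast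
  from finite_subset_image[OF \<F>(1,2)]
  obtain P where P: "P \<subseteq> Collect piece" "finite P" "\<F> = ?U ` P" by blast
  show ?thesis
  proof (rule that[OF P(2)])
    show "piece \<pi>" if "\<pi> \<in> P" for \<pi> using that P(1) by blast
    fix p assume "p \<in> bdry A"
    then have "p \<in> \<Union> (?U ` P)" using \<F>(3) unfolding P(3) by (rule rev_subsetD)
    then obtain \<pi> where \<pi>: "\<pi> \<in> P" "p \<in> ?U \<pi>" by (elim UN_E)
    obtain c x r where "\<pi> = (c, x, r)" by (cases \<pi>) auto
    then show "\<exists>(c, x, r)\<in>P. p \<in> fst c \<and> dist x (snd c p) < r / 3" using \<pi> by auto
  qed
qed

lemma morse_dense:
  assumes f: "f \<in> adm" and e: "e > 0"
  shows "\<exists>f'\<in>adm. Cnorm m L V ch (conf f' g - conf f g) < e \<and>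
    (\<forall>p\<in>bdry A. \<exists>c\<in>A. p \<in> fst c \<and> \<not> degen (bdry_image c) (bdry_rep c (pot f')) (bdry_proj (snd c p)))"
proof -
  obtain P where P: "finite P" "\<And>\<pi>. \<pi> \<in> P \<Longrightarrow> piece \<pi>"
    "\<And>p. p \<in> bdry A \<Longrightarrow> \<exists>(c, x, r)\<in>P. p \<in> fst c \<and> dist x (snd c p) < r / 3"
    by (rule ex_pieces) blast
  obtain f' where f': "f' \<in> adm" "Cnorm m L V ch (conf f' g - conf f g) < e" "\<And>\<pi>. \<pi> \<in> P \<Longrightarrow> good f' \<pi>"
    using good_dense[OF P(1,2) f e] by blast
  have "\<exists>c\<in>A. p \<in> fst c \<and> \<not> degen (bdry_image c) (bdry_rep c (pot f')) (bdry_proj (snd c p))" if p: "p \<in> bdry A" for p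
  proof -
    obtain c x r where \<pi>: "(c, x, r) \<in> P" "p \<in> fst c" "dist x (snd c p) < r / 3" using P(3)[OF p] by auto
    have c: "c \<in> A" using P(2)[OF \<pi>(1)] by (simp add: piece_def)
    have "bdry_emb (bdry_proj (snd c p)) = snd c p" using bdry_emb_proj bdry_iff[OF c \<pi>(2)] p by blast
    then have "bdry_proj (snd c p) \<in> bset (cball x (r / 3))" using \<pi>(3) by simp
    then show ?thesis using f'(3)[OF \<pi>(1)] c \<pi>(2) unfolding good_def by blast
  qed
  then show ?thesis using f'(1,2) by blast
qed

end

theorem theorem1p2:
  fixes m :: nat
    and X :: "'a topology"
    and C A :: "('a, 'b::finite) chart set"
    and L :: "'l set" and V :: "'l \<Rightarrow> 'a set" and ch :: "'l \<Rightarrow> ('a, 'b) chart"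
    and gbar :: "('a, 'b) tensor"
  defines "\<M> \<equiv> {g \<in> conformal_class m A gbar. minimal_boundary A g}"
    and "\<B> \<equiv> {g \<in> conformal_class m A gbar. minimal_boundary A g \<and>
                 only_nondegenerate_critical_points A (second_ff_normsq A g)}"
  assumes "CARD('b option) \<ge> 3" and "m \<ge> 3"
    and "compact_space X"
    and "manifold_with_boundary m X C"
    and "compatible_smooth_atlas m X C A"
    and "admissible_cover X A L V ch"
    and "gbar \<in> riemannian_metrics m A"
    and "minimal_boundary A gbar"
    and "second_ff_nonzero A gbar"
  shows "openin (subtopology (Ctopology m A L V ch) \<M>) \<B> \<and>
         subtopology (Ctopology m A L V ch) \<M> closure_of \<B> = \<M>"
proof -
  interpret conformal_setting X A m gbar L V ch
    by unfold_locales
      (use assms(4-) in \<open>auto simp: manifold_with_boundary_def compatible_smooth_atlas_def\<close>)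
  have M: "\<M> = (\<lambda>f. conf f gbar) ` adm"
    unfolding \<M>_def conformal_class_def conf_def[symmetric] using minimal_conf adm_Cfun by blast
  define morse where "morse f \<longleftrightarrow> (\<forall>p\<in>bdry A. \<exists>c\<in>A. p \<in> fst c \<and>
      \<not> degen (bdry_image c) (bdry_rep c (pot f)) (bdry_proj (snd c p)))" for f
  have iff: "conf f gbar \<in> \<B> \<longleftrightarrow> morse f" if "f \<in> adm" for f
  proof -
    have "conf f gbar \<in> \<M>" using that M by blast
    then show ?thesis unfolding \<B>_def \<M>_def using morse_iff[OF that] unfolding morse_def by blast
  qed
  have B: "\<B> \<subseteq> \<M>" unfolding \<B>_def \<M>_def by blast
  have sym: "\<M> \<subseteq> sym_tensors m A" unfolding M using conf_sym_tensors adm_Cfun by blast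
  have "openin (subtopology (Ctopology m A L V ch) \<M>) \<B>"
  proof (rule openin_subtopology_Ctopology[OF sym B])
    fix k assume k: "k \<in> \<B>"
    then obtain f0 where f0: "f0 \<in> adm" "k = conf f0 gbar" using B M by blast
    have m0: "morse f0" using iff[OF f0(1)] k f0(2) by simp
    \<comment> \<open>\<open>morse_open\<close> works in the charts of the cover, so the one good
      chart at each point is first exchanged for all charts around it.\<close>
    have "\<not> degen (bdry_image c) (bdry_rep c (pot f0)) (bdry_proj (snd c p))" if c: "c \<in> A" "p \<in> fst c" "p \<in> bdry A" for c p
    proof -
      obtain c' where c': "c' \<in> A" "p \<in> fst c'" "\<not> degen (bdry_image c') (bdry_rep c' (pot f0)) (bdry_proj (snd c' p))"
        using m0 c(3) unfolding morse_def by blast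
      show ?thesis by (rule pot_degen_chart[OF f0(1) c'(1) c(1) c'(2) c(2,3) c'(3)])
    qed
    from morse_open[OF f0(1) this] obtain e where e: "e > 0"
      "\<And>f. f \<in> adm \<Longrightarrow> Cnorm m L V ch (conf f gbar - conf f0 gbar) < e \<Longrightarrow> morse f"
      unfolding morse_def by blast
    show "\<exists>e>0. \<forall>h\<in>\<M>. Cnorm m L V ch (h - k) < e \<longrightarrow> h \<in> \<B>"
      using e iff unfolding M f0(2) by blast
  qed
  moreover have "subtopology (Ctopology m A L V ch) \<M> closure_of \<B> = \<M>"
  proof (rule dense_Ctopology[OF sym B])
    fix k and e :: real assume "k \<in> \<M>" and e: "e > 0"
    then obtain f where f: "f \<in> adm" "k = conf f gbar" using M by blast
    show "\<exists>h\<in>\<B>. Cnorm m L V ch (h - k) < e"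
      using morse_dense[OF f(1) e] iff unfolding f(2) morse_def by blast
  qed
  ultimately show ?thesis by blast
qed

end
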